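(* Let $\beta\ge 0$ and let $X_1,\dots,X_n$ be i.i.d. from $f_{\boldsymbol\theta_0}$, where $\{f_{\boldsymbol\theta}:\boldsymbol\theta\in\Theta\subset\mathbb R^p\}$ is the parametric model described in the context and the true parameter $\boldsymbol\theta_0$ belongs to $\Theta_0=\{\boldsymbol\theta\in\Theta:\boldsymbol g(\boldsymbol\theta)=\boldsymbol 0_r\}$. Assume that conditions (LB1)–(LB5) of the context hold (with $h=f_{\boldsymbol\theta_0}$). Then the restricted minimum density power divergence estimator $\widetilde{\boldsymbol\theta}_\beta$ of $\boldsymbol\theta$, obtained under the constraints $\boldsymbol g(\boldsymbol\theta)=\boldsymbol 0_r$, satisfies $$n^{1/2}(\widetilde{\boldsymbol\theta}_\beta-\boldsymbol\theta_0)\ \xrightarrow[n\to\infty]{\mathcal L}\ \mathcal N\big(\boldsymbol 0_p,\boldsymbol\Sigma_\beta(\boldsymbol\theta_0)\big),\qquad \boldsymbol\Sigma_\beta(\boldsymbol\theta_0)=\boldsymbol P_\beta(\boldsymbol\theta_0)\boldsymbol K_\beta(\boldsymbol\theta_0)\boldsymbol P_\beta(\boldsymbol\theta_0),$$ where $$\boldsymbol P_\beta(\boldsymbol\theta_0)=\boldsymbol J_\beta^{-1}(\boldsymbol\theta_0)-\boldsymbol Q_\beta(\boldsymbol\theta_0)\boldsymbol G^T(\boldsymbol\theta_0)\boldsymbol J_\beta^{-1}(\boldsymbol\theta_0),$$ $$\boldsymbol Q_\beta(\boldsymbol\theta_0)=\boldsymbol J_\beta^{-1}(\boldsymbol\theta_0)\boldsymbol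 G(\boldsymbol\theta_0)\left[\boldsymbol G^T(\boldsymbol\theta_0)\boldsymbol J_\beta^{-1}(\boldsymbol\theta_0)\boldsymbol G(\boldsymbol\theta_0)\right]^{-1}.$$
   Context: Model. $\{P_{\boldsymbol\theta}:\boldsymbol\theta\in\Theta\}$ is an identifiable parametric family of probability measures on a measurable space $\mathcal X$, $\Theta\subset\mathbb R^p$ open, $p\ge1$, with densities $f_{\boldsymbol\theta}$ with respect to a $\sigma$-finite measure $\mu$; $\int\cdots dx$ denotes integration with respect to $\mu$. The support does not depend on $\boldsymbol\theta$. Constraints. $\boldsymbol g:\mathbb R^p\to\mathbb R^r$, $r<p$, is such that the $p\times r$ matrix $\boldsymbol G(\boldsymbol\theta)=\partial\boldsymbol g^T(\boldsymbol\theta)/\partial\boldsymbol\theta$ exists, is continuous in $\boldsymbol\theta$, and has rank $r$. $\Theta_0=\{\boldsymbol\theta\in\Theta:\boldsymbol g(\boldsymbol\theta)=\boldsymbol 0_r\}$. Notation. $\boldsymbol u_{\boldsymbol\theta}(x)=\frac{\partial}{\partial\boldsymbol\theta}\log f_{\boldsymbol\theta}(x)$, $\boldsymbol I_{\boldsymbol\theta}(x)=-\frac{\partial}{\partial\boldsymbol\theta}\boldsymbol u_{\boldsymbol\theta}(x)$. For $\beta>0$, $V_{\boldsymbol\theta}(x)=\int f_{\boldsymbol\theta}^{1+\beta}(y)dy-(1+\frac1\beta)f_{\boldsymbol\theta}^\beta(x)$; for $\beta=0$, $V_{\boldsymbol\theta}(x)=-\log f_{\boldsymbol\theta}(x)$.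 When the true density belongs to the model, the following matrices are used: $$\boldsymbol J_\beta(\boldsymbol\theta)=\int\boldsymbol u_{\boldsymbol\theta}\boldsymbol u_{\boldsymbol\theta}^Tf_{\boldsymbol\theta}^{1+\beta}dx,\quad \boldsymbol K_\beta(\boldsymbol\theta)=\int\boldsymbol u_{\boldsymbol\theta}\boldsymbol u_{\boldsymbol\theta}^Tf_{\boldsymbol\theta}^{1+2\beta}dx-\boldsymbol\xi_\beta(\boldsymbol\theta)\boldsymbol\xi_\beta(\boldsymbol\theta)^T,\quad \boldsymbol\xi_\beta(\boldsymbol\theta)=\int\boldsymbol u_{\boldsymbol\theta}f_{\boldsymbol\theta}^{1+\beta}dx.$$ Estimator. The restricted minimum density power divergence estimator (RMDPDE) $\widetilde{\boldsymbol\theta}_\beta$ minimizes $\frac1n\sum_{i=1}^nV_{\boldsymbol\theta}(X_i)$ subject to $\boldsymbol g(\boldsymbol\theta)=\boldsymbol 0_r$. Conditions (for true density $h$, here $h=f_{\boldsymbol\theta_0}$): (LB1) The model distributions have common support, so $\mathcal X=\{x: f_{\boldsymbol\theta}(x)>0\}$ is independent of $\boldsymbol\theta$; the true distribution is also supported on $\mathcal X$, on which $h>0$. (LB2) There is an open subset $\omega\subset\Theta$ containing the best fitting parameter (here $\boldsymbol\theta_0$) such that for almost all $x\in\mathcal X$ and all $\boldsymbol\theta\in\omega$, $f_{\boldsymbol\theta}(x)$ is three times differentiable in $\boldsymbol\theta$ with third partial derivatives continuous in $\boldsymbol\theta$. (LB3) $\int f_{\boldsymbol\theta}^{1+\beta}(x)dx$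 and $\int f_{\boldsymbol\theta}^\beta(x)h(x)dx$ can be differentiated three times with respect to $\boldsymbol\theta$, and the derivatives can be taken under the integral sign. (LB4) The $p\times p$ matrix $\int\boldsymbol u_{\boldsymbol\theta}\boldsymbol u_{\boldsymbol\theta}^Tf_{\boldsymbol\theta}^{1+\beta}dx+\int\{\boldsymbol I_{\boldsymbol\theta}-\beta\boldsymbol u_{\boldsymbol\theta}\boldsymbol u_{\boldsymbol\theta}^T\}\{h-f_{\boldsymbol\theta}\}f_{\boldsymbol\theta}^\beta dx$ is positive definite at the best fitting parameter (here it equals $\boldsymbol J_\beta(\boldsymbol\theta_0)$). (LB5) There exist functions $M_{jkl}$ with $|\nabla_{jkl}V_{\boldsymbol\theta}(x)|\le M_{jkl}(x)$ for all $\boldsymbol\theta\in\omega$ (third-order partial derivatives in $\boldsymbol\theta$) and $E_h[M_{jkl}(X)]<\infty$ for all $j,k,l$.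
   Formalization: The limit law is proved for every consistent sequence of restricted (local or global) minimizers, and a consistent local one is shown to exist; (LB1)–(LB5) alone do not force the global minimizer to be consistent. J, K, ξ are assumed to exist at the true parameter, and r ≥ 1. *)

theory Defs
  imports "HOL-Probability.Probability"
begin

section \<open>Partial derivatives\<close>

definition partial_deriv :: "'p::finite \<Rightarrow> (real^'p \<Rightarrow> real) \<Rightarrow> real^'p \<Rightarrow> real" where
  "partial_deriv j F \<theta> = frechet_derivative F (at \<theta>) (axis j 1)"

definition thrice_differentiable_on :: "(real^'p::finite) set \<Rightarrow> (real^'p \<Rightarrow> real) \<Rightarrow> bool" where
  "thrice_differentiable_on A F \<longleftrightarrow>
     (\<forall>\<theta>\<in>A. F differentiable (at \<theta>)
        \<and> (\<forall>j. partial_deriv j F differentiable (at \<theta>))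
        \<and> (\<forall>j k. partial_deriv k (partial_deriv j F) differentiable (at \<theta>)))"

definition outer_prod :: "real^'p::finite \<Rightarrow> real^'p \<Rightarrow> real^'p^'p" where
  "outer_prod u v = (\<chi> i j. u $ i * v $ j)"

definition positive_definite :: "real^'p::finite^'p \<Rightarrow> bool" where
  "positive_definite A \<longleftrightarrow> transpose A = A \<and> (\<forall>v. v \<noteq> 0 \<longrightarrow> 0 < v \<bullet> (A *v v))"


section \<open>The model and the constraints\<close>

definition parametric_model ::
    "'x measure \<Rightarrow> (real^'p::finite) set \<Rightarrow> (real^'p \<Rightarrow> 'x \<Rightarrow> real) \<Rightarrow> bool" where
  "parametric_model \<mu> \<Theta> f \<longleftrightarrow>
     sigma_finite_measure \<mu> \<and> open \<Theta>
     \<and> (\<forall>\<theta>\<in>\<Theta>. f \<theta> \<in> borel_measurable \<mu> \<and> (\<forall>x\<in>space \<mu>. 0 \<le> f \<theta> x)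
              \<and> prob_space (density \<mu> (\<lambda>x. ennreal (f \<theta> x))))
     \<and> inj_on (\<lambda>\<theta>. density \<mu> (\<lambda>x. ennreal (f \<theta> x))) \<Theta>"

definition constraint_jacobian ::
    "(real^'p::finite \<Rightarrow> real^'r::finite) \<Rightarrow> real^'p \<Rightarrow> real^'r^'p" where
  "constraint_jacobian g \<theta> = (\<chi> i j. partial_deriv i (\<lambda>t. g t $ j) \<theta>)"

definition regular_constraint ::
    "(real^'p::finite) set \<Rightarrow> (real^'p \<Rightarrow> real^'r::finite) \<Rightarrow> bool" where
  "regular_constraint \<Theta> g \<longleftrightarrow>
     (\<forall>\<theta>\<in>\<Theta>. g differentiable (at \<theta>))
     \<and> continuous_on \<Theta> (constraint_jacobian g)
     \<and> (\<forall>\<theta>\<in>\<Theta>. rank (constraint_jacobian g \<theta>) = CARD('r))"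

definition constrained_set ::
    "(real^'p::finite) set \<Rightarrow> (real^'p \<Rightarrow> real^'r::finite) \<Rightarrow> (real^'p) set" where
  "constrained_set \<Theta> g = {\<theta>\<in>\<Theta>. g \<theta> = 0}"


section \<open>Density power divergence\<close>

definition score ::
    "(real^'p::finite \<Rightarrow> 'x \<Rightarrow> real) \<Rightarrow> real^'p \<Rightarrow> 'x \<Rightarrow> real^'p" where
  "score f \<theta> x = (\<chi> j. partial_deriv j (\<lambda>t. ln (f t x)) \<theta>)"

definition information ::
    "(real^'p::finite \<Rightarrow> 'x \<Rightarrow> real) \<Rightarrow> real^'p \<Rightarrow> 'x \<Rightarrow> real^'p^'p" where
  "information f \<theta> x = (\<chi> j k. - partial_deriv j (\<lambda>t. score f t x $ k) \<theta>)"

definition dpd_loss ::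
    "'x measure \<Rightarrow> (real^'p::finite \<Rightarrow> 'x \<Rightarrow> real) \<Rightarrow> real \<Rightarrow> real^'p \<Rightarrow> 'x \<Rightarrow> real" where
  "dpd_loss \<mu> f \<beta> \<theta> x =
     (if \<beta> = 0 then - ln (f \<theta> x)
      else (\<integral>y. f \<theta> y powr (1 + \<beta>) \<partial>\<mu>) - (1 + 1 / \<beta>) * f \<theta> x powr \<beta>)"

definition dpd_J ::
    "'x measure \<Rightarrow> (real^'p::finite \<Rightarrow> 'x \<Rightarrow> real) \<Rightarrow> real \<Rightarrow> real^'p \<Rightarrow> real^'p^'p" where
  "dpd_J \<mu> f \<beta> \<theta> =
     (\<integral>x. (f \<theta> x powr (1 + \<beta>)) *\<^sub>R outer_prod (score f \<theta> x) (score f \<theta> x) \<partial>\<mu>)"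

definition dpd_xi ::
    "'x measure \<Rightarrow> (real^'p::finite \<Rightarrow> 'x \<Rightarrow> real) \<Rightarrow> real \<Rightarrow> real^'p \<Rightarrow> real^'p" where
  "dpd_xi \<mu> f \<beta> \<theta> = (\<integral>x. (f \<theta> x powr (1 + \<beta>)) *\<^sub>R score f \<theta> x \<partial>\<mu>)"

definition dpd_K ::
    "'x measure \<Rightarrow> (real^'p::finite \<Rightarrow> 'x \<Rightarrow> real) \<Rightarrow> real \<Rightarrow> real^'p \<Rightarrow> real^'p^'p" where
  "dpd_K \<mu> f \<beta> \<theta> =
     (\<integral>x. (f \<theta> x powr (1 + 2 * \<beta>)) *\<^sub>R outer_prod (score f \<theta> x) (score f \<theta> x) \<partial>\<mu>)
     - outer_prod (dpd_xi \<mu> f \<beta> \<theta>) (dpd_xi \<mu> f \<beta> \<theta>)"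

text \<open>The Bochner integral of a non-integrable function is 0, so the existence of the integrals
  defining the matrices has to be said separately.\<close>

definition dpd_matrices_exist ::
    "'x measure \<Rightarrow> (real^'p::finite \<Rightarrow> 'x \<Rightarrow> real) \<Rightarrow> real \<Rightarrow> real^'p \<Rightarrow> bool" where
  "dpd_matrices_exist \<mu> f \<beta> \<theta> \<longleftrightarrow>
     integrable \<mu> (\<lambda>x. (f \<theta> x powr (1 + \<beta>)) *\<^sub>R outer_prod (score f \<theta> x) (score f \<theta> x))
     \<and> integrable \<mu> (\<lambda>x. (f \<theta> x powr (1 + \<beta>)) *\<^sub>R score f \<theta> x)
     \<and> integrable \<mu> (\<lambda>x. (f \<theta> x powr (1 + 2 * \<beta>)) *\<^sub>R outer_prod (score f \<theta> x) (score f \<theta> x))"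

definition dpd_Q ::
    "'x measure \<Rightarrow> (real^'p::finite \<Rightarrow> 'x \<Rightarrow> real) \<Rightarrow> (real^'p \<Rightarrow> real^'r::finite)
      \<Rightarrow> real \<Rightarrow> real^'p \<Rightarrow> real^'r^'p" where
  "dpd_Q \<mu> f g \<beta> \<theta> =
     (let Ji = matrix_inv (dpd_J \<mu> f \<beta> \<theta>); G = constraint_jacobian g \<theta>
      in Ji ** G ** matrix_inv (transpose G ** Ji ** G))"

definition dpd_P ::
    "'x measure \<Rightarrow> (real^'p::finite \<Rightarrow> 'x \<Rightarrow> real) \<Rightarrow> (real^'p \<Rightarrow> real^'r::finite)
      \<Rightarrow> real \<Rightarrow> real^'p \<Rightarrow> real^'p^'p" where
  "dpd_P \<mu> f g \<beta> \<theta> =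
     (let Ji = matrix_inv (dpd_J \<mu> f \<beta> \<theta>); G = constraint_jacobian g \<theta>
      in Ji - dpd_Q \<mu> f g \<beta> \<theta> ** transpose G ** Ji)"

definition dpd_Sigma ::
    "'x measure \<Rightarrow> (real^'p::finite \<Rightarrow> 'x \<Rightarrow> real) \<Rightarrow> (real^'p \<Rightarrow> real^'r::finite)
      \<Rightarrow> real \<Rightarrow> real^'p \<Rightarrow> real^'p^'p" where
  "dpd_Sigma \<mu> f g \<beta> \<theta> = dpd_P \<mu> f g \<beta> \<theta> ** dpd_K \<mu> f \<beta> \<theta> ** dpd_P \<mu> f g \<beta> \<theta>"


section \<open>Regularity conditions\<close>

text \<open>Throughout, \<open>S\<close> is the common support, \<open>h\<close> the true density, and \<open>\<omega>\<close> the open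
  subset of the parameter space on which the local conditions are imposed.\<close>

definition common_support ::
    "'x measure \<Rightarrow> 'x set \<Rightarrow> (real^'p::finite) set \<Rightarrow> (real^'p \<Rightarrow> 'x \<Rightarrow> real)
      \<Rightarrow> ('x \<Rightarrow> real) \<Rightarrow> bool" where
  "common_support \<mu> S \<Theta> f h \<longleftrightarrow>
     (\<forall>\<theta>\<in>\<Theta>. {x\<in>space \<mu>. 0 < f \<theta> x} = S) \<and> {x\<in>space \<mu>. 0 < h x} = S"

definition smooth_density ::
    "'x measure \<Rightarrow> 'x set \<Rightarrow> (real^'p::finite) set \<Rightarrow> (real^'p \<Rightarrow> 'x \<Rightarrow> real) \<Rightarrow> bool" where
  "smooth_density \<mu> S \<omega> f \<longleftrightarrow>
     (AE x in \<mu>. x \<in> S \<longrightarrow>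
        thrice_differentiable_on \<omega> (\<lambda>\<theta>. f \<theta> x)
        \<and> (\<forall>j k l. continuous_on \<omega>
              (partial_deriv l (partial_deriv k (partial_deriv j (\<lambda>\<theta>. f \<theta> x))))))"

definition thrice_differentiable_under_integral ::
    "'x measure \<Rightarrow> (real^'p::finite) set \<Rightarrow> (real^'p \<Rightarrow> 'x \<Rightarrow> real) \<Rightarrow> bool" where
  "thrice_differentiable_under_integral \<mu> \<omega> \<phi> \<longleftrightarrow>
     (let I = (\<lambda>\<theta>. \<integral>x. \<phi> \<theta> x \<partial>\<mu>);
          D1 = (\<lambda>j \<theta> x. partial_deriv j (\<lambda>t. \<phi> t x) \<theta>);
          D2 = (\<lambda>j k \<theta> x. partial_deriv k (partial_deriv j (\<lambda>t. \<phi> t x)) \<theta>);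
          D3 = (\<lambda>j k l \<theta> x. partial_deriv l (partial_deriv k (partial_deriv j (\<lambda>t. \<phi> t x))) \<theta>)
      in (\<forall>\<theta>\<in>\<omega>. integrable \<mu> (\<phi> \<theta>))
         \<and> thrice_differentiable_on \<omega> I
         \<and> (\<forall>\<theta>\<in>\<omega>. \<forall>j. integrable \<mu> (D1 j \<theta>)
               \<and> partial_deriv j I \<theta> = (\<integral>x. D1 j \<theta> x \<partial>\<mu>))
         \<and> (\<forall>\<theta>\<in>\<omega>. \<forall>j k. integrable \<mu> (D2 j k \<theta>)
               \<and> partial_deriv k (partial_deriv j I) \<theta> = (\<integral>x. D2 j k \<theta> x \<partial>\<mu>))
         \<and> (\<forall>\<theta>\<in>\<omega>. \<forall>j k l. integrable \<mu> (D3 j k l \<theta>)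
               \<and> partial_deriv l (partial_deriv k (partial_deriv j I)) \<theta> = (\<integral>x. D3 j k l \<theta> x \<partial>\<mu>)))"

text \<open>Since \<open>0 powr 0 = 0\<close>, for \<open>\<beta> = 0\<close> the factor \<open>f powr \<beta>\<close> is the indicator of
  the support; this agrees with integrating over the support only.\<close>

definition differentiable_integrals ::
    "'x measure \<Rightarrow> (real^'p::finite) set \<Rightarrow> (real^'p \<Rightarrow> 'x \<Rightarrow> real) \<Rightarrow> real \<Rightarrow> ('x \<Rightarrow> real) \<Rightarrow> bool" where
  "differentiable_integrals \<mu> \<omega> f \<beta> h \<longleftrightarrow>
     thrice_differentiable_under_integral \<mu> \<omega> (\<lambda>\<theta> x. f \<theta> x powr (1 + \<beta>))
     \<and> thrice_differentiable_under_integral \<mu> \<omega> (\<lambda>\<theta> x. f \<theta> x powr \<beta> * h x)"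

definition dpd_J_general ::
    "'x measure \<Rightarrow> (real^'p::finite \<Rightarrow> 'x \<Rightarrow> real) \<Rightarrow> real \<Rightarrow> ('x \<Rightarrow> real) \<Rightarrow> real^'p \<Rightarrow> real^'p^'p" where
  "dpd_J_general \<mu> f \<beta> h \<theta> =
     (\<integral>x. (f \<theta> x powr (1 + \<beta>)) *\<^sub>R outer_prod (score f \<theta> x) (score f \<theta> x) \<partial>\<mu>)
     + (\<integral>x. ((h x - f \<theta> x) * f \<theta> x powr \<beta>) *\<^sub>R
            (information f \<theta> x - \<beta> *\<^sub>R outer_prod (score f \<theta> x) (score f \<theta> x)) \<partial>\<mu>)"

lemma dpd_J_general_at_model: "dpd_J_general \<mu> f \<beta> (f \<theta>) \<theta> = dpd_J \<mu> f \<beta> \<theta>"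
  by (simp add: dpd_J_general_def dpd_J_def)

definition third_derivatives_dominated ::
    "'x measure \<Rightarrow> 'x set \<Rightarrow> (real^'p::finite) set \<Rightarrow> (real^'p \<Rightarrow> 'x \<Rightarrow> real) \<Rightarrow> real
      \<Rightarrow> ('x \<Rightarrow> real) \<Rightarrow> bool" where
  "third_derivatives_dominated \<mu> S \<omega> f \<beta> h \<longleftrightarrow>
     (\<exists>B :: 'p \<Rightarrow> 'p \<Rightarrow> 'p \<Rightarrow> 'x \<Rightarrow> real.
        (\<forall>j k l. integrable (density \<mu> (\<lambda>x. ennreal (h x))) (B j k l))
        \<and> (AE x in \<mu>. x \<in> S \<longrightarrow> (\<forall>\<theta>\<in>\<omega>. \<forall>j k l.
              \<bar>partial_deriv l (partial_deriv k (partial_deriv j (\<lambda>t. dpd_loss \<mu> f \<beta> t x))) \<theta>\<bar>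
                \<le> B j k l x)))"


section \<open>Samples, estimators and modes of convergence\<close>

definition iid_sample :: "'w measure \<Rightarrow> 'x measure \<Rightarrow> ('x \<Rightarrow> real) \<Rightarrow> (nat \<Rightarrow> 'w \<Rightarrow> 'x) \<Rightarrow> bool" where
  "iid_sample M \<mu> h X \<longleftrightarrow>
     prob_space M
     \<and> prob_space.indep_vars M (\<lambda>_. \<mu>) X UNIV
     \<and> (\<forall>i. distributed M \<mu> (X i) (\<lambda>x. ennreal (h x)))"

text \<open>An estimator is a sequence of measurable functions \<open>t n\<close> of the sample of size \<open>n\<close>.
  Observations are indexed from 0.\<close>

definition estimator :: "'x measure \<Rightarrow> (nat \<Rightarrow> (nat \<Rightarrow> 'x) \<Rightarrow> real^'p::finite) \<Rightarrow> bool" where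
  "estimator \<mu> t \<longleftrightarrow> (\<forall>n. t n \<in> borel_measurable (Pi\<^sub>M {..<n} (\<lambda>_. \<mu>)))"

definition at_sample ::
    "(nat \<Rightarrow> 'w \<Rightarrow> 'x) \<Rightarrow> (nat \<Rightarrow> (nat \<Rightarrow> 'x) \<Rightarrow> 'b) \<Rightarrow> nat \<Rightarrow> 'w \<Rightarrow> 'b" where
  "at_sample X t n w = t n (\<lambda>i\<in>{..<n}. X i w)"

definition dpd_objective ::
    "'x measure \<Rightarrow> (real^'p::finite \<Rightarrow> 'x \<Rightarrow> real) \<Rightarrow> real \<Rightarrow> nat \<Rightarrow> (nat \<Rightarrow> 'x) \<Rightarrow> real^'p \<Rightarrow> real" where
  "dpd_objective \<mu> f \<beta> n xs \<theta> = (1 / real n) * (\<Sum>i<n. dpd_loss \<mu> f \<beta> \<theta> (xs i))"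

definition minimizer_on :: "('a \<Rightarrow> real) \<Rightarrow> 'a set \<Rightarrow> 'a \<Rightarrow> bool" where
  "minimizer_on H A t \<longleftrightarrow> t \<in> A \<and> (\<forall>s\<in>A. H t \<le> H s)"

definition local_minimizer_on :: "('a::topological_space \<Rightarrow> real) \<Rightarrow> 'a set \<Rightarrow> 'a \<Rightarrow> bool" where
  "local_minimizer_on H A t \<longleftrightarrow> (\<exists>U. open U \<and> t \<in> U \<and> minimizer_on H (A \<inter> U) t)"

text \<open>With probability tending to one, the estimate is a (local or global) minimizer of the
  empirical objective subject to the constraint. The regularity conditions are local at the true
  parameter, so they guarantee a consistent sequence of local minimizers only; global minimizers
  are covered by \<open>restricted_mdpde_global\<close> below. The inner events avoid asking for the
  measurability of the set of samples at which this holds.\<close>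

definition restricted_mdpde ::
    "'w measure \<Rightarrow> (nat \<Rightarrow> 'w \<Rightarrow> 'x) \<Rightarrow> 'x measure \<Rightarrow> (real^'p::finite) set
      \<Rightarrow> (real^'p \<Rightarrow> 'x \<Rightarrow> real) \<Rightarrow> (real^'p \<Rightarrow> real^'r::finite) \<Rightarrow> real
      \<Rightarrow> (nat \<Rightarrow> (nat \<Rightarrow> 'x) \<Rightarrow> real^'p) \<Rightarrow> bool" where
  "restricted_mdpde M X \<mu> \<Theta> f g \<beta> t \<longleftrightarrow>
     estimator \<mu> t
     \<and> (\<exists>A. (\<forall>n. A n \<in> sets M) \<and> (\<lambda>n. measure M (A n)) \<longlonglongrightarrow> 1
          \<and> (\<forall>n. \<forall>w\<in>A n. local_minimizer_on
                (dpd_objective \<mu> f \<beta> n (\<lambda>i\<in>{..<n}. X i w)) (constrained_set \<Theta> g)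
                (at_sample X t n w)))"

lemma restricted_mdpde_global:
  assumes "prob_space M" "estimator \<mu> t"
    and "\<And>n w. w \<in> space M \<Longrightarrow>
      minimizer_on (dpd_objective \<mu> f \<beta> n (\<lambda>i\<in>{..<n}. X i w)) (constrained_set \<Theta> g)
        (at_sample X t n w)"
  shows "restricted_mdpde M X \<mu> \<Theta> f g \<beta> t"
proof -
  have "local_minimizer_on (dpd_objective \<mu> f \<beta> n (\<lambda>i\<in>{..<n}. X i w)) (constrained_set \<Theta> g)
          (at_sample X t n w)" if "w \<in> space M" for n w
    unfolding local_minimizer_on_def using assms(3)[OF that] by (intro exI[of _ UNIV]) simp
  moreover have "(\<lambda>n::nat. measure M (space M)) \<longlonglongrightarrow> 1"
    by (simp add: prob_space.prob_space[OF assms(1)])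
  ultimately show ?thesis
    unfolding restricted_mdpde_def using assms(2)
    by (intro conjI exI[of _ "\<lambda>_. space M"]) auto
qed

definition consistent_for ::
    "'w measure \<Rightarrow> (nat \<Rightarrow> 'w \<Rightarrow> 'a::metric_space) \<Rightarrow> 'a \<Rightarrow> bool" where
  "consistent_for M T c \<longleftrightarrow>
     (\<forall>\<epsilon>>0. (\<lambda>n. measure M {w\<in>space M. \<epsilon> < dist (T n w) c}) \<longlonglongrightarrow> 0)"

definition converges_in_law ::
    "'w measure \<Rightarrow> (nat \<Rightarrow> 'w \<Rightarrow> 'a::topological_space) \<Rightarrow> 'a measure \<Rightarrow> bool" where
  "converges_in_law M Y N \<longleftrightarrow>
     (\<forall>\<phi> :: 'a \<Rightarrow> real. continuous_on UNIV \<phi> \<and> bounded (range \<phi>) \<longrightarrow>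
        (\<lambda>n. \<integral>w. \<phi> (Y n w) \<partial>M) \<longlonglongrightarrow> (\<integral>y. \<phi> y \<partial>N))"

definition normal_law :: "real \<Rightarrow> real \<Rightarrow> real measure" where
  "normal_law m v =
     (if v = 0 then return borel m else density lborel (\<lambda>y. ennreal (normal_density m (sqrt v) y)))"

text \<open>The normal distribution with mean vector \<open>m\<close> and a possibly singular covariance
  matrix \<open>C\<close>, characterized by its one-dimensional projections.\<close>

definition multivariate_normal :: "(real^'p::finite) measure \<Rightarrow> real^'p \<Rightarrow> real^'p^'p \<Rightarrow> bool" where
  "multivariate_normal N m C \<longleftrightarrow>
     prob_space N \<and> sets N = sets borel
     \<and> transpose C = C
     \<and> (\<forall>a. 0 \<le> a \<bullet> (C *v a) \<and> distr N borel (\<lambda>y. a \<bullet> y) = normal_law (a \<bullet> m) (a \<bullet> (C *v a)))"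

definition asymptotically_normal ::
    "'w measure \<Rightarrow> (nat \<Rightarrow> 'w \<Rightarrow> real^'p::finite) \<Rightarrow> real^'p \<Rightarrow> real^'p^'p \<Rightarrow> bool" where
  "asymptotically_normal M T c C \<longleftrightarrow>
     (\<exists>N. multivariate_normal N 0 C
        \<and> converges_in_law M (\<lambda>n w. sqrt (real n) *\<^sub>R (T n w - c)) N)"

end

theory Submission
  imports Defs
begin

text \<open>
  Let \<open>s\<close> be the gradient at \<open>\<theta>\<^sub>0\<close> of the empirical objective, divided by \<open>1 + \<beta>\<close>. The Hessian
  of this rescaled objective at \<open>\<theta>\<^sub>0\<close> converges to \<open>J\<close> by the law of large numbers, and the dominated third derivatives make
  the gradient at a nearby \<open>t\<close> equal to \<open>s + J (t - \<theta>\<^sub>0)\<close> up to a small multiple of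
  \<open>t - \<theta>\<^sub>0\<close>. Since \<open>J\<close> is positive definite, a measurably selected minimizer over the constraint
  set in a small closed ball is within a multiple of the norm of \<open>s\<close> from \<open>\<theta>\<^sub>0\<close>, hence consistent
  and interior to the ball. For any consistent sequence of local minimizers, the Lagrange condition
  puts the gradient at \<open>t\<close> into the range of \<open>G t\<close>; applying \<open>P\<close>, which satisfies \<open>P G = 0\<close> and
  \<open>P J = 1 - Q G\<^sup>T\<close>, leaves \<open>t - \<theta>\<^sub>0 = - P s\<close> up to terms negligible against \<open>s\<close>. The central limit theorem for
  the projections of \<open>s\<close> and the Cramer-Wold device give the limit law, with covariance
  \<open>P K P\<close>.
\<close>

section \<open>Gaussian laws with a given covariance\<close>

text \<open>No rate of convergence is proved for a given estimator before the limit law. Consistency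
  makes the linearization error an arbitrarily small multiple of
  \<open>norm (t - \<theta>0)\<close>; the Lagrange condition and the constraint turn this into an
  arbitrarily small multiple of the norm of \<open>s\<close>, and \<open>s\<close> times the root of
  the sample size is tight by its second moment. Four obstacles shape the rest. The Hessian is only
  known to be integrable, so its law of large numbers rests on truncation. The limit covariance is
  always singular, since \<open>P\<close> is symmetric and \<open>P G = 0\<close>; the limit law has
  no density and is built as a linear image of independent standard normal variables. An estimator
  has to be a measurable function of the sample while minimizers need not be unique, so a measurable
  one must be selected. Finally, derivatives of the density in the parameter are not assumed
  measurable in the observation; this is recovered from the integrands in (LB3).\<close>

lemma sum_UNIV_delta_axis:
  fixes a :: "'p::finite \<Rightarrow> real"
  shows "(\<Sum>j\<in>UNIV. a j * axis i 1 $ j) = a i"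
  by (simp add: axis_def if_distrib cong: if_cong)

lemma quadratic_form_expand:
  fixes A :: "real^'p::finite^'p"
  assumes "transpose A = A"
  shows "(v + x *\<^sub>R w) \<bullet> (A *v (v + x *\<^sub>R w)) =
    v \<bullet> (A *v v) + 2 * x * (v \<bullet> (A *v w)) + x\<^sup>2 * (w \<bullet> (A *v w))"
proof -
  have "w \<bullet> (A *v v) = v \<bullet> (A *v w)"
    using assms by (metis dot_lmul_matrix inner_commute vector_transpose_matrix)
  then show ?thesis
    by (simp add: matrix_vector_right_distrib matrix_vector_mult_scaleR inner_add_left inner_add_right
        power2_eq_square algebra_simps)
qed

lemma inner_matrix_axis:
  fixes A :: "real^'p::finite^'p"
  shows "axis i 1 \<bullet> (A *v axis j 1) = A $ i $ j"
  by (simp add: inner_axis' matrix_vector_mult_def sum_UNIV_delta_axis)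

lemma inner_outer_prod_mult: "a \<bullet> (outer_prod u v *v b) = (a \<bullet> u) * (v \<bullet> b)"
proof -
  have "outer_prod u v *v b = (v \<bullet> b) *\<^sub>R u"
    by (simp add: outer_prod_def matrix_vector_mult_def inner_vec_def vec_eq_iff sum_distrib_left
        mult_ac)
  then show ?thesis by simp
qed

lemma sum_matrix_vector_mult:
  fixes A :: "'i \<Rightarrow> real^'q::finite^'p::finite"
  shows "(\<Sum>i\<in>I. A i) *v x = (\<Sum>i\<in>I. A i *v x)"
  by (induction I rule: infinite_finite_induct) (auto simp: matrix_vector_mult_add_rdistrib)

lemma inner_matrix_eq_sum:
  fixes A :: "real^'q::finite^'p::finite"
  shows "a \<bullet> (A *v b) = (\<Sum>i\<in>UNIV. \<Sum>j\<in>UNIV. a $ i * A $ i $ j * b $ j)"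
  by (simp add: matrix_vector_mult_def inner_vec_def sum_distrib_left mult.assoc)

text \<open>Symmetric Gaussian elimination: subtracting the outer product of a normalized column clears
  one row and column and preserves positive semidefiniteness.\<close>

lemma psd_sum_outer_prod_aux:
  fixes C :: "real^'p::finite^'p"
  assumes "finite I" "transpose C = C" "\<And>v. 0 \<le> v \<bullet> (C *v v)"
    and "\<And>i j. i \<notin> I \<Longrightarrow> C $ i $ j = 0"
  shows "\<exists>v :: 'p \<Rightarrow> real^'p. C = (\<Sum>i\<in>I. outer_prod (v i) (v i))"
  using assms
proof (induction I arbitrary: C rule: finite_induct)
  case empty
  then show ?case by (auto simp: vec_eq_iff)
next
  case (insert i I C)
  have sym: "C $ j $ k = C $ k $ j" for j k
    using insert.prems(1) by (metis transpose_def vec_lambda_beta)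
  define w where "w = (1 / sqrt (C $ i $ i)) *\<^sub>R (C *v axis i 1)"
  define C' where "C' = (if C $ i $ i = 0 then C else C - outer_prod w w)"
  have Cii: "0 \<le> C $ i $ i"
    using insert.prems(2)[of "axis i 1"] by (simp add: inner_matrix_axis)
  have w: "w $ k = C $ k $ i / sqrt (C $ i $ i)" for k
    by (simp add: w_def matrix_vector_mult_def sum_UNIV_delta_axis)
  have zero_row: "C' $ i $ k = 0" for k
  proof (cases "C $ i $ i = 0")
    case True
    \<comment> \<open>With a zero diagonal entry at \<open>i\<close> the quadratic form along this
      line is affine in \<open>x\<close>; being nonnegative for every real \<open>x\<close>, it must
      have slope 0.\<close>
    have *: "0 \<le> C $ k $ k + 2 * x * C $ k $ i" for x
      using insert.prems(2)[of "axis k 1 + x *\<^sub>R axis i 1"] True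
      by (simp add: quadratic_form_expand[OF insert.prems(1)] inner_matrix_axis)
    have "C $ k $ i = 0"
    proof (rule ccontr)
      assume "C $ k $ i \<noteq> 0"
      then show False
        using *[of "- (C $ k $ k + 1) / (2 * C $ k $ i)"] by (simp add: field_simps)
    qed
    then show ?thesis using True sym by (simp add: C'_def)
  next
    case False
    then show ?thesis
      using Cii by (simp add: C'_def outer_prod_def w sym[of k i] flip: real_sqrt_mult)
  qed
  have C'_sym: "transpose C' = C'"
    using insert.prems(1) sym by (auto simp: C'_def transpose_def vec_eq_iff outer_prod_def)
  have C'_psd: "0 \<le> v \<bullet> (C' *v v)" for v
  proof (cases "C $ i $ i = 0")
    case False
    \<comment> \<open>Completing the square: this \<open>x\<close> minimizes the form on the line
      through \<open>v\<close> in direction \<open>axis i 1\<close>, and the minimum is the form of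
      \<open>C'\<close> at \<open>v\<close>.\<close>
    define x where "x = - (v \<bullet> (C *v axis i 1)) / C $ i $ i"
    have "0 \<le> (v + x *\<^sub>R axis i 1) \<bullet> (C *v (v + x *\<^sub>R axis i 1))"
      by (rule insert.prems(2))
    also have "\<dots> = v \<bullet> (C *v v) - (v \<bullet> (C *v axis i 1))\<^sup>2 / C $ i $ i"
      using False unfolding quadratic_form_expand[OF insert.prems(1)]
      by (simp add: inner_matrix_axis x_def field_simps power2_eq_square)
    also have "\<dots> = v \<bullet> (C' *v v)"
      using False Cii
      by (simp add: C'_def matrix_vector_mult_diff_rdistrib inner_diff_right inner_outer_prod_mult
          w_def inner_commute power2_eq_square flip: real_sqrt_mult)
    finally show ?thesis .
  qed (simp add: C'_def insert.prems)
  have "C' $ j $ k = 0" if "j \<notin> I" for j k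
  proof (cases "j = i")
    case False
    then show ?thesis
      using that insert.prems(3)[of j] by (simp add: C'_def outer_prod_def w)
  qed (simp add: zero_row)
  from insert.IH[OF C'_sym C'_psd this] obtain v :: "'p \<Rightarrow> real^'p"
    where v: "C' = (\<Sum>i\<in>I. outer_prod (v i) (v i))" by auto
  \<comment> \<open>If the diagonal entry is 0, nothing was subtracted from \<open>C\<close>, so the
    new vector has to be 0.\<close>
  define v' where "v' = v(i := if C $ i $ i = 0 then 0 else w)"
  have "(\<Sum>j\<in>I. outer_prod (v' j) (v' j)) = (\<Sum>j\<in>I. outer_prod (v j) (v j))"
    using insert.hyps by (intro sum.cong) (auto simp: v'_def)
  then have "(\<Sum>j\<in>insert i I. outer_prod (v' j) (v' j)) = C"
    using insert.hyps v[symmetric]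
    by (auto simp: v'_def C'_def vec_eq_iff outer_prod_def)
  then show ?case by metis
qed

lemma psd_sum_outer_prod:
  fixes C :: "real^'p::finite^'p"
  assumes "transpose C = C" "\<And>v. 0 \<le> v \<bullet> (C *v v)"
  obtains v :: "'p \<Rightarrow> real^'p" where "C = (\<Sum>i\<in>UNIV. outer_prod (v i) (v i))"
  using psd_sum_outer_prod_aux[of UNIV C] assms by auto

lemma distr_normal_law:
  assumes "prob_space M" "distributed M lborel Y (normal_density m \<sigma>)" "0 < \<sigma>"
  shows "distr M borel Y = normal_law m (\<sigma>\<^sup>2)"
  using assms distributed_distr_eq_density[OF assms(2)]
  by (simp add: normal_law_def cong: distr_cong)

text \<open>Writing \<open>C\<close> as a sum of outer products of vectors \<open>v i\<close>, the
  law of the sum of \<open>z i *\<^sub>R v i\<close> with independent standard normal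
  \<open>z i\<close> works: each projection is a linear combination of independent normal variables.
  Singular \<open>C\<close> is included.\<close>

lemma multivariate_normal_exists:
  fixes C :: "real^'p::finite^'p"
  assumes sym: "transpose C = C" and psd: "\<And>v. 0 \<le> v \<bullet> (C *v v)"
  obtains N :: "(real^'p) measure" where "multivariate_normal N 0 C"
proof -
  obtain v :: "'p \<Rightarrow> real^'p" where v: "C = (\<Sum>i\<in>UNIV. outer_prod (v i) (v i))"
    using psd_sum_outer_prod[OF assms] .
  have quad: "a \<bullet> (C *v a) = (\<Sum>i\<in>UNIV. (a \<bullet> v i)\<^sup>2)" for a
  proof -
    have "a \<bullet> (C *v a) = (\<Sum>i\<in>UNIV. a \<bullet> (outer_prod (v i) (v i) *v a))"
      unfolding v by (simp add: sum_matrix_vector_mult inner_sum_right)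
    then show ?thesis
      by (simp add: inner_outer_prod_mult power2_eq_square inner_commute)
  qed
  let ?std = "density lborel (\<lambda>x. ennreal (std_normal_density x)) :: real measure"
  interpret std: prob_space ?std by (rule prob_space_normal_density) simp
  interpret prod: product_prob_space "\<lambda>_. ?std" "UNIV :: 'p set" ..
  define \<Omega> where "\<Omega> = (\<Pi>\<^sub>M i\<in>(UNIV::'p set). ?std)"
  interpret \<Omega>: prob_space \<Omega> unfolding \<Omega>_def by (rule prod.prob_space_axioms)
  have meas_comp[measurable]: "(\<lambda>z. z i) \<in> borel_measurable \<Omega>" for i
    unfolding \<Omega>_def by measurable
  define Z where "Z z = (\<Sum>i\<in>UNIV. z i *\<^sub>R v i)" for z :: "'p \<Rightarrow> real"
  have Z[measurable]: "Z \<in> borel_measurable \<Omega>" unfolding Z_def by measurable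
  have distr_comp: "distr \<Omega> ?std (\<lambda>z. z i) = ?std" for i
    unfolding \<Omega>_def by (rule distr_PiM_component) (auto intro: std.prob_space_axioms)
  have indep: "\<Omega>.indep_vars (\<lambda>_. borel) (\<lambda>i z. z i) UNIV"
  proof -
    have "\<Omega>.indep_vars (\<lambda>_. ?std) (\<lambda>i z. z i) UNIV"
    proof (subst \<Omega>.indep_vars_iff_distr_eq_PiM')
      show "distr \<Omega> (\<Pi>\<^sub>M i\<in>UNIV. ?std) (\<lambda>x. \<lambda>i\<in>UNIV. x i) = (\<Pi>\<^sub>M i\<in>UNIV. distr \<Omega> ?std (\<lambda>z. z i))"
        by (simp add: distr_comp) (simp add: \<Omega>_def distr_id restrict_def)
    qed (use meas_comp in auto)
    then show ?thesis
      by (rule \<Omega>.indep_vars_compose2) auto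
  qed
  have dist: "distributed \<Omega> lborel (\<lambda>z. z i) (normal_density 0 1)" for i
    unfolding distributed_def using distr_comp[of i] by (auto cong: distr_cong)
  have proj: "distr (distr \<Omega> borel Z) borel (\<lambda>y. a \<bullet> y) = normal_law 0 (a \<bullet> (C *v a))" for a
  proof -
    \<comment> \<open>The library theorem on sums of independent normal variables asks for positive
      standard deviations and a nonempty index set. Vanishing coefficients are therefore dropped; if
      none remain, the projection is constant and \<open>normal_law\<close> is a point mass.\<close>
    define I where "I = {i. a \<bullet> v i \<noteq> 0}"
    have aZ: "a \<bullet> Z z = (\<Sum>i\<in>I. 0 + (a \<bullet> v i) * z i)" for z
    proof -
      have "a \<bullet> Z z = (\<Sum>i\<in>UNIV. (a \<bullet> v i) * z i)"
        by (simp add: Z_def inner_sum_right mult.commute)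
      also have "\<dots> = (\<Sum>i\<in>I. (a \<bullet> v i) * z i)"
        by (intro sum.mono_neutral_right) (auto simp: I_def)
      finally show ?thesis by simp
    qed
    have quad_I: "a \<bullet> (C *v a) = (\<Sum>i\<in>I. (a \<bullet> v i)\<^sup>2)"
      unfolding quad by (intro sum.mono_neutral_right) (auto simp: I_def)
    have "distr (distr \<Omega> borel Z) borel (\<lambda>y. a \<bullet> y) = distr \<Omega> borel (\<lambda>z. a \<bullet> Z z)"
      by (subst distr_distr) (auto simp: comp_def)
    also have "\<dots> = normal_law 0 (a \<bullet> (C *v a))"
    proof (cases "I = {}")
      case True
      then show ?thesis
        unfolding quad_I aZ by (simp add: normal_law_def \<Omega>.distr_const)
    next
      case False
      have pos: "0 < (\<Sum>i\<in>I. (a \<bullet> v i)\<^sup>2)"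
        using False by (intro sum_pos) (auto simp: I_def)
      have "distributed \<Omega> lborel (\<lambda>z. \<Sum>i\<in>I. 0 + (a \<bullet> v i) * z i)
          (normal_density (\<Sum>i\<in>I. 0) (sqrt (\<Sum>i\<in>I. \<bar>a \<bullet> v i\<bar>\<^sup>2)))"
      proof (rule \<Omega>.sum_indep_normal)
        show "\<Omega>.indep_vars (\<lambda>i. borel) (\<lambda>i z. 0 + (a \<bullet> v i) * z i) I"
          by (rule \<Omega>.indep_vars_compose2[OF \<Omega>.indep_vars_subset[OF indep]]) auto
        show "distributed \<Omega> lborel (\<lambda>z. 0 + (a \<bullet> v i) * z i) (normal_density 0 \<bar>a \<bullet> v i\<bar>)"
          if "i \<in> I" for i
          using \<Omega>.normal_density_affine[OF dist, of "a \<bullet> v i" 0 i] that by (simp add: I_def)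
      qed (use False in \<open>auto simp: I_def\<close>)
      from distr_normal_law[OF \<Omega>.prob_space_axioms this] pos show ?thesis
        unfolding aZ quad_I by simp
    qed
    finally show ?thesis .
  qed
  have "multivariate_normal (distr \<Omega> borel Z) 0 C"
    unfolding multivariate_normal_def
    using proj sym psd \<Omega>.prob_space_distr[OF Z] by simp
  then show ?thesis by (rule that)
qed

section \<open>Averages of independent identically distributed variables\<close>

lemma (in prob_space) consistent_for_I_expectation:
  fixes Z :: "nat \<Rightarrow> 'a \<Rightarrow> 'b::{metric_space,second_countable_topology}"
  assumes [measurable]: "\<And>n. Z n \<in> borel_measurable M"
    and int: "\<And>n. integrable M (\<lambda>w. dist (Z n w) c)"
    and lim: "(\<lambda>n. expectation (\<lambda>w. dist (Z n w) c)) \<longlonglongrightarrow> 0"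
  shows "consistent_for M Z c"
  unfolding consistent_for_def
proof (intro allI impI)
  fix \<epsilon> :: real assume \<epsilon>: "0 < \<epsilon>"
  show "(\<lambda>n. measure M {w \<in> space M. \<epsilon> < dist (Z n w) c}) \<longlonglongrightarrow> 0"
  proof (rule tendsto_sandwich[OF _ _ tendsto_const])
    show "(\<lambda>n. expectation (\<lambda>w. dist (Z n w) c) / \<epsilon>) \<longlonglongrightarrow> 0"
      using tendsto_divide[OF lim tendsto_const, of \<epsilon>] \<epsilon> by simp
    have "measure M {w \<in> space M. \<epsilon> < dist (Z n w) c} \<le> expectation (\<lambda>w. dist (Z n w) c) / \<epsilon>" for n
    proof -
      have "measure M {w \<in> space M. \<epsilon> < dist (Z n w) c} \<le> measure M {w \<in> space M. \<epsilon> \<le> dist (Z n w) c}"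
        by (intro finite_measure_mono) auto
      also have "\<dots> \<le> expectation (\<lambda>w. dist (Z n w) c) / \<epsilon>"
        using int \<epsilon> by (intro integral_Markov_inequality_measure[where A="{}"]) auto
      finally show ?thesis .
    qed
    then show "\<forall>\<^sub>F n in sequentially. measure M {w \<in> space M. \<epsilon> < dist (Z n w) c} \<le> expectation (\<lambda>w. dist (Z n w) c) / \<epsilon>"
      by simp
  qed simp
qed

text \<open>Centred variables with different indices are orthogonal by independence, so only the
  diagonal of the expanded double sum survives. In both conclusions \<open>m\<close> is subtracted
  inside the sum.\<close>

lemma (in prob_space) variance_sum_iid:
  fixes Y :: "nat \<Rightarrow> 'a \<Rightarrow> real"
  assumes indep: "indep_vars (\<lambda>_. borel) Y UNIV"
    and sq: "\<And>i. integrable M (\<lambda>w. (Y i w)\<^sup>2)"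
    and mean: "\<And>i. expectation (Y i) = m"
    and var: "\<And>i. expectation (\<lambda>w. (Y i w)\<^sup>2) = v"
  shows "integrable M (\<lambda>w. (\<Sum>i<n. Y i w - m)\<^sup>2)"
    and "expectation (\<lambda>w. (\<Sum>i<n. Y i w - m)\<^sup>2) = real n * (v - m\<^sup>2)"
proof -
  have [measurable]: "Y i \<in> borel_measurable M" for i
    using indep by (auto simp: indep_vars_def)
  have int: "integrable M (Y i)" for i
    using square_integrable_imp_integrable[OF _ sq[of i]] by simp
  define Z where "Z i w = Y i w - m" for i w
  have Zind: "indep_vars (\<lambda>_. borel) Z UNIV"
    unfolding Z_def by (rule indep_vars_compose2[OF indep]) auto
  have Z: "integrable M (Z i)" "expectation (Z i) = 0" for i
    unfolding Z_def using int mean by (simp_all add: prob_space)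
  have Z2: "integrable M (\<lambda>w. (Z i w)\<^sup>2)" for i
    unfolding Z_def power2_diff using int sq by (auto simp: mult.assoc)
  have Z2e: "expectation (\<lambda>w. (Z i w)\<^sup>2) = v - m\<^sup>2" for i
    using int sq mean var
    by (simp add: Z_def power2_diff prob_space mult.assoc power2_eq_square algebra_simps)
  have ZZ: "integrable M (\<lambda>w. Z i w * Z j w)" "expectation (\<lambda>w. Z i w * Z j w) = 0" if "i \<noteq> j" for i j
  proof -
    have ind: "indep_vars (\<lambda>_. borel) Z {i, j}" by (rule indep_vars_subset[OF Zind]) auto
    show "integrable M (\<lambda>w. Z i w * Z j w)"
      using indep_vars_integrable[OF _ ind] that Z by simp
    show "expectation (\<lambda>w. Z i w * Z j w) = 0"
      using indep_vars_lebesgue_integral[OF _ ind] that Z by simp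
  qed
  have ZZi: "integrable M (\<lambda>w. Z i w * Z j w)" for i j
    using ZZ Z2 by (cases "i = j") (auto simp: power2_eq_square)
  have eq: "(\<Sum>i<n. Y i w - m)\<^sup>2 = (\<Sum>i<n. \<Sum>j<n. Z i w * Z j w)" for w
    by (simp add: power2_eq_square sum_product Z_def)
  show "integrable M (\<lambda>w. (\<Sum>i<n. Y i w - m)\<^sup>2)"
    unfolding eq using ZZi by auto
  have "expectation (\<lambda>w. (\<Sum>i<n. Y i w - m)\<^sup>2) = (\<Sum>i<n. \<Sum>j<n. expectation (\<lambda>w. Z i w * Z j w))"
    unfolding eq using ZZi by (simp add: Bochner_Integration.integral_sum)
  also have "\<dots> = (\<Sum>i<n. \<Sum>j<n. if i = j then v - m\<^sup>2 else 0)"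
    using ZZ Z2e by (intro sum.cong) (auto simp: power2_eq_square)
  also have "\<dots> = real n * (v - m\<^sup>2)" by simp
  finally show "expectation (\<lambda>w. (\<Sum>i<n. Y i w - m)\<^sup>2) = real n * (v - m\<^sup>2)" .
qed

text \<open>For bounded variables the mean square of the centred average is at most
  \<open>K\<^sup>2 / n\<close>, and the first absolute moment is at most its root. This serves the
  truncated variables below.\<close>

lemma (in prob_space) expectation_abs_average_le:
  fixes Y :: "nat \<Rightarrow> 'a \<Rightarrow> real"
  assumes indep: "indep_vars (\<lambda>_. borel) Y UNIV"
    and bd: "\<And>i w. \<bar>Y i w\<bar> \<le> K"
    and id: "\<And>i. distr M borel (Y i) = D"
    and n: "0 < n"
  shows "expectation (\<lambda>w. \<bar>(\<Sum>i<n. Y i w) / n - integral\<^sup>L D (\<lambda>y. y)\<bar>) \<le> K / sqrt n"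
proof -
  have [measurable]: "Y i \<in> borel_measurable M" for i
    using indep by (auto simp: indep_vars_def)
  have K: "0 \<le> K" using bd[of 0 undefined] by linarith
  define m v where "m = integral\<^sup>L D (\<lambda>y. y)" and "v = integral\<^sup>L D (\<lambda>y. y\<^sup>2)"
  have mean: "expectation (Y i) = m" for i
    unfolding m_def id[of i, symmetric] by (simp add: integral_distr)
  have var: "expectation (\<lambda>w. (Y i w)\<^sup>2) = v" for i
    unfolding v_def id[of i, symmetric] by (simp add: integral_distr)
  have sqb: "(Y i w)\<^sup>2 \<le> K\<^sup>2" for i w
    using bd[of i w] K abs_le_square_iff by fastforce
  have sq: "integrable M (\<lambda>w. (Y i w)\<^sup>2)" for i
    by (rule integrable_const_bound[where B="K\<^sup>2"]) (use sqb in auto)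
  note vs = variance_sum_iid[OF indep sq mean var]
  have vle: "v - m\<^sup>2 \<le> K\<^sup>2"
  proof -
    have "v = expectation (\<lambda>w. (Y 0 w)\<^sup>2)" by (simp add: var)
    also have "\<dots> \<le> expectation (\<lambda>w. K\<^sup>2)"
      using sq sqb by (intro integral_mono) auto
    finally show ?thesis by (simp add: prob_space) (smt (verit) zero_le_power2)
  qed
  define W where "W w = (\<Sum>i<n. Y i w) / n - m" for w
  have W: "W w = (\<Sum>i<n. Y i w - m) / n" for w
    using n by (simp add: W_def sum_subtractf field_simps)
  have W2: "integrable M (\<lambda>w. (W w)\<^sup>2)" "expectation (\<lambda>w. (W w)\<^sup>2) = (v - m\<^sup>2) / n"
    unfolding W power_divide using vs[of n] n by (auto simp: power2_eq_square)
  have [measurable]: "W \<in> borel_measurable M" unfolding W_def by measurable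
  have Wi: "integrable M W" using square_integrable_imp_integrable[OF _ W2(1)] by simp
  have "(expectation (\<lambda>w. \<bar>W w\<bar>))\<^sup>2 \<le> expectation (\<lambda>w. (W w)\<^sup>2)"
  proof -
    \<comment> \<open>Nonnegativity of the variance of the absolute value replaces the
      Cauchy-Schwarz inequality.\<close>
    have "0 \<le> variance (\<lambda>w. \<bar>W w\<bar>)" by (rule variance_positive)
    also have "\<dots> = expectation (\<lambda>w. \<bar>W w\<bar>\<^sup>2) - (expectation (\<lambda>w. \<bar>W w\<bar>))\<^sup>2"
      using Wi W2 by (intro variance_eq) auto
    finally show ?thesis by simp
  qed
  also have "\<dots> \<le> K\<^sup>2 / n" using vle n by (simp add: W2 divide_right_mono)
  also have "\<dots> = (K / sqrt n)\<^sup>2" by (simp add: power_divide)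
  finally have "expectation (\<lambda>w. \<bar>W w\<bar>) \<le> K / sqrt n"
    using K by (meson divide_nonneg_nonneg power2_le_imp_le real_sqrt_ge_zero of_nat_0_le_iff)
  then show ?thesis by (simp add: W_def m_def)
qed

text \<open>Truncating at a fixed level makes the variance bounded, and the truncated tail is small in
  mean uniformly in the sample size.\<close>

lemma (in prob_space) law_of_large_numbers_L1:
  fixes Y :: "nat \<Rightarrow> 'a \<Rightarrow> real"
  assumes indep: "indep_vars (\<lambda>_. borel) Y UNIV"
    and id: "\<And>i. distr M borel (Y i) = D"
    and int: "integrable D (\<lambda>y. y)"
  shows "(\<lambda>n. expectation (\<lambda>w. \<bar>(\<Sum>i<n. Y i w) / n - integral\<^sup>L D (\<lambda>y. y)\<bar>)) \<longlonglongrightarrow> 0"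
proof (rule LIMSEQ_I)
  fix e :: real assume e: "0 < e"
  have [measurable]: "Y i \<in> borel_measurable M" for i
    using indep by (auto simp: indep_vars_def)
  have sD[measurable_cong]: "sets D = sets borel" unfolding id[of 0, symmetric] by simp
  have intY: "integrable M (Y i)" for i
    using int unfolding id[of i, symmetric] by (simp add: integrable_distr_eq)
  define T where "T k y = (if \<bar>y\<bar> \<le> real k then y else 0)" for k and y :: real
  have [measurable]: "T k \<in> borel_measurable borel" for k unfolding T_def by measurable
  have "(\<lambda>k. \<integral>y. \<bar>y - T k y\<bar> \<partial>D) \<longlonglongrightarrow> (\<integral>y. 0 \<partial>D)"
  proof (rule integral_dominated_convergence[where w="\<lambda>y. \<bar>y\<bar>"])
    show "AE y in D. (\<lambda>k. \<bar>y - T k y\<bar>) \<longlonglongrightarrow> 0"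
    proof (intro AE_I2 tendsto_eventually)
      fix y :: real
      have "\<forall>\<^sub>F k in sequentially. nat \<lceil>\<bar>y\<bar>\<rceil> \<le> k" by (rule eventually_ge_at_top)
      then show "\<forall>\<^sub>F k in sequentially. \<bar>y - T k y\<bar> = 0"
      proof eventually_elim
        case (elim k)
        then have "\<bar>y\<bar> \<le> real k" by linarith
        then show ?case by (simp add: T_def)
      qed
    qed
    show "integrable D (\<lambda>y. \<bar>y\<bar>)" using int by simp
    show "AE y in D. norm \<bar>y - T k y\<bar> \<le> \<bar>y\<bar>" for k by (simp add: T_def)
  qed measurable
  then have "(\<lambda>k. \<integral>y. \<bar>y - T k y\<bar> \<partial>D) \<longlonglongrightarrow> 0" by simp
  \<comment> \<open>The truncation level depends on the law \<open>D\<close> only and is fixed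
    before \<open>n\<close>. The tail integral enters the final bound twice, which uses up two of
    the three thirds of \<open>e\<close>.\<close>
  from order_tendstoD(2)[OF this, of "e / 3"]
  have "\<forall>\<^sub>F k in sequentially. (\<integral>y. \<bar>y - T k y\<bar> \<partial>D) < e / 3"
    using e by simp
  then obtain k where k: "(\<integral>y. \<bar>y - T k y\<bar> \<partial>D) < e / 3"
    using eventually_happens'[OF sequentially_bot] by blast
  have Tint: "integrable D (T k)"
    by (rule Bochner_Integration.integrable_bound[OF int]) (auto simp: T_def)
  define D' where "D' = distr D borel (T k)"
  have D': "distr M borel (\<lambda>w. T k (Y i w)) = D'" for i
    unfolding D'_def id[of i, symmetric] by (subst distr_distr) (auto simp: comp_def)
  define m m' where "m = integral\<^sup>L D (\<lambda>y. y)" and "m' = integral\<^sup>L D' (\<lambda>y. y)"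
  have m': "m' = integral\<^sup>L D (T k)" unfolding m'_def D'_def by (simp add: integral_distr)
  have mm': "\<bar>m' - m\<bar> \<le> (\<integral>y. \<bar>y - T k y\<bar> \<partial>D)"
  proof -
    have "m' - m = (\<integral>y. T k y - y \<partial>D)" unfolding m' m_def using int Tint by simp
    also have "\<bar>\<dots>\<bar> \<le> (\<integral>y. \<bar>T k y - y\<bar> \<partial>D)" by (rule integral_abs_bound)
    finally show ?thesis by (simp add: abs_minus_commute)
  qed
  have ind': "indep_vars (\<lambda>_. borel) (\<lambda>i w. T k (Y i w)) UNIV"
    by (rule indep_vars_compose2[OF indep]) auto
  have TYint: "integrable M (\<lambda>w. T k (Y i w))" for i
    by (rule Bochner_Integration.integrable_bound[OF intY[of i]]) (auto simp: T_def)
  have rest: "expectation (\<lambda>w. \<bar>Y i w - T k (Y i w)\<bar>) = (\<integral>y. \<bar>y - T k y\<bar> \<partial>D)" for i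
    unfolding id[of i, symmetric] by (simp add: integral_distr)
  \<comment> \<open>The average deviates by the deviation of the truncated average, the average of
    the truncated parts, and the shift of the mean; each of the last two is at most the tail
    integral in expectation.\<close>
  have bound: "expectation (\<lambda>w. \<bar>(\<Sum>i<n. Y i w) / n - m\<bar>)
      \<le> real k / sqrt n + 2 * (\<integral>y. \<bar>y - T k y\<bar> \<partial>D)" if n: "0 < n" for n
  proof -
    have "expectation (\<lambda>w. \<bar>(\<Sum>i<n. Y i w) / n - m\<bar>)
      \<le> expectation (\<lambda>w. \<bar>(\<Sum>i<n. T k (Y i w)) / n - m'\<bar>
          + ((\<Sum>i<n. \<bar>Y i w - T k (Y i w)\<bar>) / n + \<bar>m' - m\<bar>))"
    proof (rule integral_mono)
      fix w
      have "(\<Sum>i<n. Y i w) / n = (\<Sum>i<n. T k (Y i w)) / n + (\<Sum>i<n. Y i w - T k (Y i w)) / n"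
        by (simp add: sum_subtractf diff_divide_distrib)
      moreover have "\<bar>(\<Sum>i<n. Y i w - T k (Y i w)) / n\<bar> \<le> (\<Sum>i<n. \<bar>Y i w - T k (Y i w)\<bar>) / n"
        by (simp add: divide_right_mono)
      ultimately show "\<bar>(\<Sum>i<n. Y i w) / n - m\<bar> \<le> \<bar>(\<Sum>i<n. T k (Y i w)) / n - m'\<bar>
          + ((\<Sum>i<n. \<bar>Y i w - T k (Y i w)\<bar>) / n + \<bar>m' - m\<bar>)"
        by linarith
    qed (use intY TYint in \<open>auto intro!: Bochner_Integration.integrable_add integrable_abs
        Bochner_Integration.integrable_diff Bochner_Integration.integrable_sum integrable_divide\<close>)
    also have "\<dots> = expectation (\<lambda>w. \<bar>(\<Sum>i<n. T k (Y i w)) / n - m'\<bar>)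
        + ((\<Sum>i<n. expectation (\<lambda>w. \<bar>Y i w - T k (Y i w)\<bar>)) / n + \<bar>m' - m\<bar>)"
      using intY TYint by (simp add: Bochner_Integration.integral_sum prob_space)
    also have "(\<Sum>i<n. expectation (\<lambda>w. \<bar>Y i w - T k (Y i w)\<bar>)) / n = (\<integral>y. \<bar>y - T k y\<bar> \<partial>D)"
      using n by (simp add: rest)
    also have "expectation (\<lambda>w. \<bar>(\<Sum>i<n. T k (Y i w)) / n - m'\<bar>) \<le> real k / sqrt n"
      unfolding m'_def by (rule expectation_abs_average_le[OF ind' _ D' n]) (auto simp: T_def)
    finally show ?thesis using mm' by simp
  qed
  have "(\<lambda>n. real k / sqrt (real n)) \<longlonglongrightarrow> 0"
    by (intro tendsto_divide_0[OF tendsto_const] filterlim_at_top_imp_at_infinity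
        filterlim_compose[OF sqrt_at_top filterlim_real_sequentially])
  from order_tendstoD(2)[OF this, of "e / 3"]
  have "\<forall>\<^sub>F n in sequentially. real k / sqrt n < e / 3"
    using e by simp
  then obtain N where N: "\<And>n. n \<ge> N \<Longrightarrow> real k / sqrt (real n) < e / 3"
    unfolding eventually_sequentially by blast
  show "\<exists>no. \<forall>n\<ge>no. norm (expectation (\<lambda>w. \<bar>(\<Sum>i<n. Y i w) / n - integral\<^sup>L D (\<lambda>y. y)\<bar>) - 0) < e"
  proof (intro exI[of _ "max 1 N"] allI impI)
    fix n assume "max 1 N \<le> n"
    then have "0 < n" "N \<le> n" by auto
    then have "expectation (\<lambda>w. \<bar>(\<Sum>i<n. Y i w) / n - m\<bar>) < e"
      using bound[of n] N[of n] k by linarith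
    then show "norm (expectation (\<lambda>w. \<bar>(\<Sum>i<n. Y i w) / n - integral\<^sup>L D (\<lambda>y. y)\<bar>) - 0) < e"
      by (simp add: m_def)
  qed
qed

text \<open>Convergence in mean gives convergence in probability by Markov's inequality. The
  observations may take values in any space, since only the real variables
  \<open>\<phi> (X i w)\<close> enter.\<close>

lemma (in prob_space) law_of_large_numbers:
  fixes \<phi> :: "'b \<Rightarrow> real" and X :: "nat \<Rightarrow> 'a \<Rightarrow> 'b"
  assumes indep: "indep_vars (\<lambda>_. N) X UNIV"
    and id: "\<And>i. distr M N (X i) = P"
    and int: "integrable P \<phi>"
  shows "consistent_for M (\<lambda>n w. (\<Sum>i<n. \<phi> (X i w)) / n) (integral\<^sup>L P \<phi>)"
proof -
  have X[measurable]: "X i \<in> measurable M N" for i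
    using indep by (auto simp: indep_vars_def)
  have [measurable_cong]: "sets P = sets N" unfolding id[of 0, symmetric] by simp
  have \<phi>[measurable]: "\<phi> \<in> borel_measurable N"
    using borel_measurable_integrable[OF int] by simp
  define D where "D = distr P borel \<phi>"
  have D: "distr M borel (\<lambda>w. \<phi> (X i w)) = D" for i
    unfolding D_def id[of i, symmetric] by (subst distr_distr) (auto simp: comp_def)
  have ind: "indep_vars (\<lambda>_. borel) (\<lambda>i w. \<phi> (X i w)) UNIV"
    by (rule indep_vars_compose2[OF indep]) auto
  have intD: "integrable D (\<lambda>y. y)" unfolding D_def using int by (simp add: integrable_distr_eq)
  have m: "integral\<^sup>L D (\<lambda>y. y) = integral\<^sup>L P \<phi>" unfolding D_def by (simp add: integral_distr)
  have intX: "integrable M (\<lambda>w. \<phi> (X i w))" for i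
    using int unfolding id[of i, symmetric] by (simp add: integrable_distr_eq)
  show ?thesis
  proof (rule consistent_for_I_expectation)
    show "(\<lambda>n. expectation (\<lambda>w. dist ((\<Sum>i<n. \<phi> (X i w)) / n) (integral\<^sup>L P \<phi>))) \<longlonglongrightarrow> 0"
      using law_of_large_numbers_L1[where Y="\<lambda>i w. \<phi> (X i w)", OF ind D intD] by (simp add: m dist_real_def)
  qed (use intX in \<open>auto simp: dist_real_def intro!: integrable_abs Bochner_Integration.integrable_diff integrable_divide\<close>)
qed

text \<open>The central limit theorem of the library covers positive variance. With variance 0 the
  summands vanish almost surely and the limit is the point mass that \<open>normal_law\<close>
  prescribes; both cases are needed because the covariance may be singular.\<close>

lemma (in prob_space) clt_projection:
  fixes Y :: "nat \<Rightarrow> 'a \<Rightarrow> real"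
  assumes indep: "indep_vars (\<lambda>_. borel) Y UNIV"
    and id: "\<And>i. distr M borel (Y i) = D"
    and mean: "integral\<^sup>L D (\<lambda>y. y) = 0"
    and sq: "integrable D (\<lambda>y. y\<^sup>2)"
    and var: "integral\<^sup>L D (\<lambda>y. y\<^sup>2) = v"
    and cont: "continuous_on UNIV \<phi>" and bd: "\<And>y. \<bar>\<phi> y\<bar> \<le> (B::real)"
  shows "(\<lambda>n. expectation (\<lambda>w. \<phi> ((\<Sum>i<n. Y i w) / sqrt n))) \<longlonglongrightarrow> integral\<^sup>L (normal_law 0 v) \<phi>"
proof (cases "v = 0")
  case True
  have [measurable]: "Y i \<in> borel_measurable M" for i
    using indep by (auto simp: indep_vars_def)
  have [measurable]: "\<phi> \<in> borel_measurable borel" using cont by (rule borel_measurable_continuous_onI)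
  have "AE w in M. Y i w = 0" for i
  proof -
    have "AE y in D. y\<^sup>2 = 0"
      using integral_nonneg_eq_0_iff_AE[OF sq] var True by auto
    then show ?thesis unfolding id[of i, symmetric] by (subst (asm) AE_distr_iff) auto
  qed
  then have "AE w in M. \<forall>i. Y i w = 0" by (simp add: AE_all_countable)
  then have "expectation (\<lambda>w. \<phi> ((\<Sum>i<n. Y i w) / sqrt n)) = expectation (\<lambda>w. \<phi> 0)" for n
    by (intro integral_cong_AE) auto
  then show ?thesis using True by (simp add: normal_law_def prob_space integral_return)
next
  case False
  have [measurable]: "Y i \<in> borel_measurable M" for i
    using indep by (auto simp: indep_vars_def)
  have [measurable]: "\<phi> \<in> borel_measurable borel" using cont by (rule borel_measurable_continuous_onI)
  define \<sigma> where "\<sigma> = sqrt v"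
  have "0 \<le> v" using var by (metis integral_nonneg_AE AE_I2 zero_le_power2)
  then have \<sigma>: "0 < \<sigma>" "\<sigma>\<^sup>2 = v" using False by (auto simp: \<sigma>_def)
  have e0: "expectation (Y n) = 0" for n
    using mean unfolding id[of n, symmetric] by (simp add: integral_distr)
  have i2: "integrable M (\<lambda>x. (Y n x)\<^sup>2)" for n
    using sq unfolding id[of n, symmetric] by (simp add: integrable_distr_eq)
  have v2: "variance (Y n) = \<sigma>\<^sup>2" for n
    using var unfolding id[of n, symmetric] e0 \<sigma> by (simp add: integral_distr)
  have w: "weak_conv_m (\<lambda>n. distr M borel (\<lambda>x. (\<Sum>i<n. Y i x) / sqrt (n * \<sigma>\<^sup>2))) std_normal_distribution"
  proof (rule central_limit_theorem_zero_mean[where \<mu> = D])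
    show "integrable M (\<lambda>x. (Y n x)\<^sup>2)" for n by (rule i2)
    show "variance (Y n) = \<sigma>\<^sup>2" for n by (rule v2)
    show "indep_vars (\<lambda>i. borel) Y UNIV" by (rule indep)
    show "expectation (Y n) = 0" for n by (rule e0)
    show "0 < \<sigma>" by (rule \<sigma>(1))
    show "distr M borel (Y n) = D" for n by (rule id)
  qed
  have rd: "real_distribution (distr M borel (\<lambda>x. (\<Sum>i<n. Y i x) / sqrt (real n * \<sigma>\<^sup>2)))" for n
    by (rule real_distribution_distr) measurable
  \<comment> \<open>The theorem normalizes by the standard deviation as well; multiplication by
    \<open>\<sigma>\<close> inside the test function undoes this.\<close>
  have cont': "isCont (\<lambda>y. \<phi> (\<sigma> * y)) x" for x
    using continuous_on_compose2[OF cont, of UNIV "\<lambda>y. \<sigma> * y"]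
    by (auto simp: continuous_on_eq_continuous_at intro!: continuous_intros)
  have bd': "norm (\<phi> (\<sigma> * y)) \<le> B" for y using bd by simp
  have "(\<lambda>n. integral\<^sup>L (distr M borel (\<lambda>x. (\<Sum>i<n. Y i x) / sqrt (n * \<sigma>\<^sup>2))) (\<lambda>y. \<phi> (\<sigma> * y)))
      \<longlonglongrightarrow> integral\<^sup>L std_normal_distribution (\<lambda>y. \<phi> (\<sigma> * y))"
    by (rule weak_conv_imp_integral_bdd_continuous_conv[OF rd real_dist_normal_dist w cont' bd'])
  moreover have "integral\<^sup>L (distr M borel (\<lambda>x. (\<Sum>i<n. Y i x) / sqrt (n * \<sigma>\<^sup>2))) (\<lambda>y. \<phi> (\<sigma> * y))
      = expectation (\<lambda>w. \<phi> ((\<Sum>i<n. Y i w) / sqrt n))" for n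
    using \<sigma>(1) by (simp add: integral_distr real_sqrt_mult)
  moreover have "integral\<^sup>L std_normal_distribution (\<lambda>y. \<phi> (\<sigma> * y)) = integral\<^sup>L (normal_law 0 v) \<phi>"
  proof -
    interpret std: real_distribution std_normal_distribution by (rule real_dist_normal_dist)
    have "distributed std_normal_distribution lborel (\<lambda>y. y) (normal_density 0 1)"
      unfolding distributed_def by (auto simp: distr_id2)
    from std.normal_density_affine[OF this, of \<sigma> 0] \<sigma>
    have "distributed std_normal_distribution lborel (\<lambda>y. \<sigma> * y) (normal_density 0 \<sigma>)" by simp
    note dd = distributed_distr_eq_density[OF this]
    have meas_sc: "(\<lambda>y. \<sigma> * y) \<in> borel_measurable std_normal_distribution" by simp
    from dd
    have "distr std_normal_distribution borel (\<lambda>y. \<sigma> * y) = normal_law 0 v"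
      using False \<sigma>_def by (simp add: normal_law_def cong: distr_cong)
    then show ?thesis by (metis integral_distr[of "\<lambda>y. \<sigma> * y" std_normal_distribution borel \<phi>] meas_sc \<open>\<phi> \<in> borel_measurable borel\<close>)
  qed
  ultimately show ?thesis by simp
qed

section \<open>The Cramer-Wold device\<close>

text \<open>Linear combinations of cosines of affine functions: exactly the test functions whose
  expectations are controlled by one-dimensional projections. The phase \<open>b\<close> provides
  sines, and \<open>a = 0\<close> provides constants, so complex exponentials are avoided.\<close>

inductive trig_poly :: "('a::real_inner \<Rightarrow> real) \<Rightarrow> bool" where
  cos: "trig_poly (\<lambda>y. c * cos (a \<bullet> y + b))"
| add: "trig_poly f \<Longrightarrow> trig_poly g \<Longrightarrow> trig_poly (\<lambda>y. f y + g y)"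

text \<open>The product-to-sum formula for cosines keeps the class closed under
  multiplication.\<close>

lemma trig_poly_mult_cos:
  assumes "trig_poly f"
  shows "trig_poly (\<lambda>y. f y * (c * cos (a \<bullet> y + b)))"
  using assms
proof induction
  case (cos c' a' b')
  have "trig_poly (\<lambda>y. c' * c / 2 * cos ((a' - a) \<bullet> y + (b' - b)) + c' * c / 2 * cos ((a' + a) \<bullet> y + (b' + b)))"
    by (intro trig_poly.intros)
  moreover have "c' * c / 2 * cos ((a' - a) \<bullet> y + (b' - b)) + c' * c / 2 * cos ((a' + a) \<bullet> y + (b' + b))
      = c' * cos (a' \<bullet> y + b') * (c * cos (a \<bullet> y + b))" for y
  proof -
    have "(a' - a) \<bullet> y + (b' - b) = (a' \<bullet> y + b') - (a \<bullet> y + b)"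
      "(a' + a) \<bullet> y + (b' + b) = (a' \<bullet> y + b') + (a \<bullet> y + b)"
      by (auto simp: inner_diff_left inner_add_left)
    then show ?thesis by (simp only: cos_diff cos_add) (simp add: algebra_simps)
  qed
  ultimately show ?case by simp
next
  case (add f g)
  then show ?case by (simp add: distrib_right trig_poly.add)
qed

lemma trig_poly_mult:
  assumes "trig_poly f" "trig_poly g"
  shows "trig_poly (\<lambda>y. f y * g y)"
  using assms(2)
proof induction
  case (cos c a b)
  then show ?case by (rule trig_poly_mult_cos[OF assms(1)])
next
  case (add g1 g2)
  then show ?case by (simp add: distrib_left trig_poly.add)
qed

lemma trig_poly_const: "trig_poly (\<lambda>y. c)"
  using trig_poly.cos[of c 0 0] by simp

lemma trig_poly_sum:
  "(\<And>i. i \<in> I \<Longrightarrow> trig_poly (f i)) \<Longrightarrow> trig_poly (\<lambda>y. \<Sum>i\<in>I. f i y)"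
  by (induction I rule: infinite_finite_induct) (auto intro: trig_poly_const trig_poly.add)

text \<open>The sine of a scaled coordinate is a cosine with phase \<open>- pi / 2\<close> in an
  axis direction; polynomial operations then stay inside the class.\<close>

lemma trig_poly_polynomial_of_sines:
  fixes p :: "real^'p::finite \<Rightarrow> real"
  assumes "real_polynomial_function p"
  shows "trig_poly (\<lambda>y::real^'p. p (\<chi> i. sin (y $ i / R)))"
  using assms
proof induction
  case (linear f)
  have "trig_poly (\<lambda>y::real^'p. \<Sum>i\<in>UNIV. f (axis i 1) * cos ((axis i (1 / R)) \<bullet> y + (- pi / 2)))"
    by (intro trig_poly_sum trig_poly.cos)
  moreover have "f (\<chi> i. sin (y $ i / R)) = (\<Sum>i\<in>UNIV. f (axis i 1) * cos ((axis i (1 / R)) \<bullet> y + (- pi / 2)))"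
    for y :: "real^'p"
  proof -
    have "f (\<chi> i. sin (y $ i / R)) = f (\<Sum>i\<in>UNIV. sin (y $ i / R) *\<^sub>R axis i 1)"
      by (rule arg_cong[where f=f]) (simp add: vec_eq_iff axis_def if_distrib cong: if_cong)
    also have "\<dots> = (\<Sum>i\<in>UNIV. sin (y $ i / R) * f (axis i 1))"
      using linear by (simp add: bounded_linear.linear linear_sum linear_scale)
    finally show ?thesis
      by (simp add: inner_axis' cos_diff mult.commute)
  qed
  ultimately show ?case by simp
qed (auto intro: trig_poly_const trig_poly.add trig_poly_mult)

lemma trig_poly_continuous: "trig_poly f \<Longrightarrow> continuous_on UNIV f"
  by (induction rule: trig_poly.induct) (auto intro!: continuous_intros)

lemma trig_poly_bounded: "trig_poly f \<Longrightarrow> \<exists>B. \<forall>y. \<bar>f y\<bar> \<le> B"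
proof (induction rule: trig_poly.induct)
  case (cos c a b)
  have "\<bar>c * cos (a \<bullet> y + b)\<bar> \<le> \<bar>c\<bar> * 1" for y
    unfolding abs_mult by (intro mult_left_mono) auto
  then show ?case by auto
next
  case (add f g)
  then obtain B C where "\<And>y. \<bar>f y\<bar> \<le> B" "\<And>y. \<bar>g y\<bar> \<le> C" by auto
  then have "\<bar>f y + g y\<bar> \<le> B + C" for y
    using abs_triangle_ineq[of "f y" "g y"] by (smt (verit))
  then show ?case by blast
qed

lemma (in finite_measure) integrable_bounded_continuous:
  fixes \<phi> :: "'b::topological_space \<Rightarrow> real"
  assumes "continuous_on UNIV \<phi>" "\<And>y. \<bar>\<phi> y\<bar> \<le> B" "Y \<in> borel_measurable M"
  shows "integrable M (\<lambda>w. \<phi> (Y w))"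
proof (rule integrable_const_bound[where B=B])
  show "(\<lambda>w. \<phi> (Y w)) \<in> borel_measurable M"
    using measurable_compose[OF assms(3) borel_measurable_continuous_onI[OF assms(1)]] .
qed (use assms in auto)

lemma (in prob_space) measure_norm_gt_small:
  fixes Y :: "'a \<Rightarrow> 'b::real_normed_vector"
  assumes [measurable]: "Y \<in> borel_measurable M" and "0 < e"
  obtains R where "0 < R" "measure M {w \<in> space M. R < norm (Y w)} < e"
proof -
  let ?A = "\<lambda>k::nat. {w \<in> space M. real k < norm (Y w)}"
  have "(\<lambda>k. measure M (?A k)) \<longlonglongrightarrow> measure M (\<Inter>k. ?A k)"
    by (rule finite_Lim_measure_decseq) (auto simp: decseq_def)
  also have "(\<Inter>k. ?A k) = {}"
    using reals_Archimedean2 less_asym by auto blast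
  finally have "(\<lambda>k. measure M (?A k)) \<longlonglongrightarrow> 0" by simp
  from order_tendstoD(2)[OF this \<open>0 < e\<close>] obtain k where k: "measure M (?A k) < e"
    using eventually_happens'[OF sequentially_bot] by blast
  \<comment> \<open>Adding 1 only makes the radius positive, as \<open>k\<close> may be 0.\<close>
  have "measure M {w \<in> space M. real k + 1 < norm (Y w)} \<le> measure M (?A k)"
    by (rule finite_measure_mono) auto
  with k show ?thesis by (intro that[of "real k + 1"]) auto
qed

lemma (in prob_space) expectation_diff_le_off_ball:
  fixes Y :: "'a \<Rightarrow> 'b::real_normed_vector" and \<phi> q :: "'b \<Rightarrow> real"
  assumes [measurable]: "Y \<in> borel_measurable M"
    and int: "integrable M (\<lambda>w. \<phi> (Y w))" "integrable M (\<lambda>w. q (Y w))"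
    and near: "\<And>y. norm y \<le> R \<Longrightarrow> \<bar>\<phi> y - q y\<bar> \<le> d"
    and far: "\<And>y. \<bar>\<phi> y - q y\<bar> \<le> d + C" and C: "0 \<le> C"
  shows "\<bar>expectation (\<lambda>w. \<phi> (Y w)) - expectation (\<lambda>w. q (Y w))\<bar>
    \<le> d + C * measure M {w \<in> space M. R < norm (Y w)}"
proof -
  have "\<bar>expectation (\<lambda>w. \<phi> (Y w)) - expectation (\<lambda>w. q (Y w))\<bar> = \<bar>expectation (\<lambda>w. \<phi> (Y w) - q (Y w))\<bar>"
    using int by simp
  also have "\<dots> \<le> expectation (\<lambda>w. \<bar>\<phi> (Y w) - q (Y w)\<bar>)" by (rule integral_abs_bound)
  also have "\<dots> \<le> expectation (\<lambda>w. d + C * indicat_real {w \<in> space M. R < norm (Y w)} w)"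
  proof (rule integral_mono)
    show "integrable M (\<lambda>w. d + C * indicat_real {w \<in> space M. R < norm (Y w)} w)"
      by (intro Bochner_Integration.integrable_add integrable_mult_right integrable_real_indicator)
         (auto simp: emeasure_eq_measure)
    show "\<bar>\<phi> (Y w) - q (Y w)\<bar> \<le> d + C * indicat_real {w \<in> space M. R < norm (Y w)} w" if "w \<in> space M" for w
      using near[of "Y w"] far[of "Y w"] that by (auto simp: indicator_def)
  qed (use int in auto)
  also have "\<dots> = d + C * measure M {w \<in> space M. R < norm (Y w)}"
    by (subst Bochner_Integration.integral_add) (auto simp: prob_space emeasure_eq_measure)
  finally show ?thesis .
qed

text \<open>On the cube where every coordinate of \<open>y/R\<close> lies in the range of \<open>arcsin\<close>, a continuous
  function of \<open>y\<close> is a continuous function of the sines of these coordinates; approximating the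
  latter by a polynomial gives a trigonometric polynomial that is close to it on the cube and
  bounded everywhere.\<close>

lemma trig_poly_approximation:
  fixes \<phi> :: "real^'p::finite \<Rightarrow> real"
  assumes cont: "continuous_on UNIV \<phi>" and bd: "\<And>y. \<bar>\<phi> y\<bar> \<le> B" and R: "0 < R" and d: "0 < d"
  obtains q where "trig_poly q" "\<And>y. norm y \<le> R \<Longrightarrow> \<bar>\<phi> y - q y\<bar> \<le> d"
    "\<And>y. \<bar>\<phi> y - q y\<bar> \<le> d + 2 * B"
proof -
  define \<psi> :: "real^'p \<Rightarrow> real" where "\<psi> s = \<phi> (\<chi> i. R * arcsin (s $ i))" for s
  let ?K = "cbox (-1) (1::real^'p)"
  have "continuous_on ?K \<psi>"
    unfolding \<psi>_def
    by (rule continuous_on_compose2[OF cont])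
       (auto intro!: continuous_intros simp: mem_box_cart)
  from Stone_Weierstrass_real_polynomial_function[OF compact_cbox this d]
  obtain p where p: "real_polynomial_function p" "\<And>s. s \<in> ?K \<Longrightarrow> \<bar>\<psi> s - p s\<bar> < d" by blast
  define q where "q y = p (\<chi> i. sin (y $ i / R))" for y :: "real^'p"
  have near: "\<bar>\<psi> (\<chi> i. sin (y $ i / R)) - q y\<bar> < d" for y
    unfolding q_def by (rule p(2)) (auto simp: mem_box_cart)
  show ?thesis
  proof
    show "trig_poly q" unfolding q_def by (rule trig_poly_polynomial_of_sines[OF p(1)])
    show "\<bar>\<phi> y - q y\<bar> \<le> d" if "norm y \<le> R" for y
    proof -
      have "arcsin (sin (y $ i / R)) = y $ i / R" for i
      proof (rule arcsin_sin)
        have "\<bar>y $ i\<bar> \<le> R" using component_le_norm_cart[of y i] that by simp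
        then have "\<bar>y $ i / R\<bar> \<le> 1" using R by (simp add: abs_div)
        then show "- (pi / 2) \<le> y $ i / R" "y $ i / R \<le> pi / 2"
          using pi_gt3 by linarith+
      qed
      then have "\<psi> (\<chi> i. sin (y $ i / R)) = \<phi> y"
        unfolding \<psi>_def using R by (auto intro!: arg_cong[where f=\<phi>] simp: vec_eq_iff)
      then show ?thesis using near[of y] by simp
    qed
    show "\<bar>\<phi> y - q y\<bar> \<le> d + 2 * B" for y
      using near[of y] bd[of y] bd[of "\<chi> i. R * arcsin ((\<chi> i. sin (y $ i / R)) $ i)"]
      unfolding \<psi>_def by linarith
  qed
qed

text \<open>Convergence for cosines extends by linearity to \<open>trig_poly\<close>. A bounded
  continuous function is uniformly close to such a function on a large ball, and tightness makes the
  bounded error outside the ball negligible for all large \<open>n\<close>.\<close>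

lemma converges_in_law_cramer_wold:
  fixes Y :: "nat \<Rightarrow> 'w \<Rightarrow> real^'p::finite"
  assumes M: "prob_space M" and Y[measurable]: "\<And>n. Y n \<in> borel_measurable M"
    and N: "prob_space N" and sN[measurable_cong]: "sets N = sets borel"
    and cos: "\<And>a b. (\<lambda>n. \<integral>w. cos (a \<bullet> Y n w + b) \<partial>M) \<longlonglongrightarrow> (\<integral>y. cos (a \<bullet> y + b) \<partial>N)"
    and tight: "\<And>e. 0 < e \<Longrightarrow>
      \<exists>R. \<forall>\<^sub>F n in sequentially. measure M {w\<in>space M. R < norm (Y n w)} < e"
  shows "converges_in_law M Y N"
  unfolding converges_in_law_def
proof (intro allI impI)
  fix \<phi> :: "real^'p \<Rightarrow> real" assume \<phi>: "continuous_on UNIV \<phi> \<and> bounded (range \<phi>)"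
  interpret M: prob_space M by fact
  interpret N: prob_space N by fact
  have id[measurable]: "(\<lambda>y. y) \<in> borel_measurable N" by measurable
  from \<phi> obtain B where B: "\<And>y. \<bar>\<phi> y\<bar> \<le> B" by (auto simp: bounded_iff)
  have B0: "0 \<le> B" using B[of 0] by linarith
  have lim: "(\<lambda>n. \<integral>w. q (Y n w) \<partial>M) \<longlonglongrightarrow> (\<integral>y. q y \<partial>N)" if "trig_poly q" for q
    using that
  proof induction
    case (cos c a b)
    then show ?case using tendsto_mult_left[OF assms(5), of c a b] by simp
  next
    case (add f g)
    obtain Bf Bg where "\<And>y. \<bar>f y\<bar> \<le> Bf" "\<And>y. \<bar>g y\<bar> \<le> Bg"
      using trig_poly_bounded add.hyps by meson
    then have "integrable M (\<lambda>w. f (Y n w))" "integrable M (\<lambda>w. g (Y n w))"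
      "integrable N f" "integrable N g" for n
      using add.hyps trig_poly_continuous M.integrable_bounded_continuous[OF _ _ Y]
        N.integrable_bounded_continuous[OF _ _ id] by blast+
    then show ?case using tendsto_add[OF add.IH] by simp
  qed
  show "(\<lambda>n. \<integral>w. \<phi> (Y n w) \<partial>M) \<longlonglongrightarrow> (\<integral>y. \<phi> y \<partial>N)"
  proof (rule LIMSEQ_I)
    fix e :: real assume e: "0 < e"
    \<comment> \<open>Each replacement of \<open>\<phi>\<close> by \<open>q\<close> costs at most
      \<open>d + 2 * B * \<eta>\<close>, which is less than \<open>e / 4\<close>; with the
      convergence for \<open>q\<close> three quarters of \<open>e\<close> are spent. The denominator
      has \<open>B + 1\<close> because \<open>B\<close> may be 0.\<close>
    define d where "d = e / 8"
    define \<eta> where "\<eta> = e / (16 * (B + 1))"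
    have d: "0 < d" and \<eta>: "0 < \<eta>" using e B0 by (auto simp: d_def \<eta>_def)
    have B\<eta>: "2 * B * \<eta> < e / 8" using e B0 by (simp add: \<eta>_def field_simps)
    obtain R1 where R1: "\<forall>\<^sub>F n in sequentially. measure M {w\<in>space M. R1 < norm (Y n w)} < \<eta>"
      using tight[OF \<eta>] by blast
    obtain R2 where R2: "0 < R2" "measure N {y\<in>space N. R2 < norm y} < \<eta>"
      using N.measure_norm_gt_small[OF id \<eta>] by blast
    define R where "R = max R1 R2"
    have R: "0 < R" using R2 by (auto simp: R_def)
    obtain q where q: "trig_poly q" "\<And>y. norm y \<le> R \<Longrightarrow> \<bar>\<phi> y - q y\<bar> \<le> d"
      "\<And>y. \<bar>\<phi> y - q y\<bar> \<le> d + 2 * B"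
      using trig_poly_approximation[OF conjunct1[OF \<phi>] B R d] by blast
    obtain Bq where Bq: "\<And>y. \<bar>q y\<bar> \<le> Bq" using trig_poly_bounded q by meson
    have nonneg: "0 \<le> 2 * B" using B0 by simp
    have approxN: "\<bar>(\<integral>y. \<phi> y \<partial>N) - (\<integral>y. q y \<partial>N)\<bar> < e / 4"
    proof -
      have 1: "\<bar>(\<integral>y. \<phi> y \<partial>N) - (\<integral>y. q y \<partial>N)\<bar> \<le> d + 2 * B * measure N {y\<in>space N. R < norm y}"
        using N.expectation_diff_le_off_ball[where \<phi>=\<phi> and q=q, OF id _ _ q(2,3) nonneg]
          N.integrable_bounded_continuous[OF conjunct1[OF \<phi>] B id]
          N.integrable_bounded_continuous[OF trig_poly_continuous[OF q(1)] Bq id] by simp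
      have "measure N {y\<in>space N. R < norm y} \<le> \<eta>"
      proof -
        have "measure N {y\<in>space N. R < norm y} \<le> measure N {y\<in>space N. R2 < norm y}"
          by (rule N.finite_measure_mono) (auto simp: R_def)
        then show ?thesis using R2 by simp
      qed
      from mult_left_mono[OF this nonneg] 1 show ?thesis
        using B\<eta> e unfolding d_def by linarith
    qed
    have approxM: "\<bar>(\<integral>w. \<phi> (Y n w) \<partial>M) - (\<integral>w. q (Y n w) \<partial>M)\<bar> < e / 4"
      if "measure M {w\<in>space M. R1 < norm (Y n w)} < \<eta>" for n
    proof -
      have 1: "\<bar>(\<integral>w. \<phi> (Y n w) \<partial>M) - (\<integral>w. q (Y n w) \<partial>M)\<bar> \<le> d + 2 * B * measure M {w\<in>space M. R < norm (Y n w)}"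
        using M.expectation_diff_le_off_ball[where \<phi>=\<phi> and q=q, OF Y _ _ q(2,3) nonneg]
          M.integrable_bounded_continuous[OF conjunct1[OF \<phi>] B Y]
          M.integrable_bounded_continuous[OF trig_poly_continuous[OF q(1)] Bq Y] by simp
      have "measure M {w\<in>space M. R < norm (Y n w)} \<le> \<eta>"
      proof -
        have "measure M {w\<in>space M. R < norm (Y n w)} \<le> measure M {w\<in>space M. R1 < norm (Y n w)}"
          by (rule M.finite_measure_mono) (auto simp: R_def)
        then show ?thesis using that by simp
      qed
      from mult_left_mono[OF this nonneg] 1 show ?thesis
        using B\<eta> e unfolding d_def by linarith
    qed
    have "\<forall>\<^sub>F n in sequentially. dist (\<integral>w. q (Y n w) \<partial>M) (\<integral>y. q y \<partial>N) < e / 4"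
      using tendstoD[OF lim[OF q(1)], of "e / 4"] e by simp
    with R1 have "\<forall>\<^sub>F n in sequentially. norm ((\<integral>w. \<phi> (Y n w) \<partial>M) - (\<integral>y. \<phi> y \<partial>N)) < e"
    proof eventually_elim
      case (elim n)
      show ?case using approxM[OF elim(1)] approxN elim(2)
        unfolding dist_real_def real_norm_def by linarith
    qed
    then show "\<exists>no. \<forall>n\<ge>no. norm ((\<integral>w. \<phi> (Y n w) \<partial>M) - (\<integral>y. \<phi> y \<partial>N)) < e"
      by (simp add: eventually_sequentially)
  qed
qed

section \<open>Constrained critical points\<close>

text \<open>A nonzero vector normal to the range of the derivative of \<open>(F, g)\<close> yields
  the multiplier. Its first component cannot vanish: the rest would be orthogonal to the range of
  \<open>g'\<close>, the whole space. Sussmann's open mapping theorem, which uses the derivative at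
  the single point \<open>t\<close>, takes the place of the implicit function theorem.\<close>

lemma lagrange_multiplier:
  fixes F :: "'a::euclidean_space \<Rightarrow> real" and g :: "'a \<Rightarrow> 'b::euclidean_space"
  assumes U: "open U" "t \<in> U" and cont: "continuous_on U F" "continuous_on U g"
    and F: "(F has_derivative F') (at t)" and g: "(g has_derivative g') (at t)"
    and surj: "surj g'" and gt: "g t = 0" and min: "\<And>s. s \<in> U \<Longrightarrow> g s = 0 \<Longrightarrow> F t \<le> F s"
  obtains l where "\<And>v. F' v = l \<bullet> g' v"
proof -
  have lF: "linear F'" and lg: "linear g'"
    using F g has_derivative_linear by blast+
  let ?h = "\<lambda>s. (F s, g s)" and ?h' = "\<lambda>v. (F' v, g' v)"
  have lh: "linear ?h'" using lF lg by (auto simp: linear_iff)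
  have h: "(?h has_derivative ?h') (at t)" using F g by (rule has_derivative_Pair)
  text \<open>If the derivative of \<open>(F, g)\<close> were onto, this map would be open at \<open>t\<close> and \<open>F\<close> could be
    decreased within the constraint set.\<close>
  have "\<not> surj ?h'"
  proof
    assume "surj ?h'"
    then obtain k where k: "linear k" "?h' \<circ> k = id"
      using linear_surjective_right_inverse[OF lh] by blast
    have "?h t \<in> interior (?h ` U)"
    proof (rule sussmann_open_mapping[OF U(1) _ U(2) h _ k(2)])
      show "continuous_on U ?h" using cont by (rule continuous_on_Pair)
      show "bounded_linear k" using k(1) by (simp add: linear_conv_bounded_linear)
    qed (use U in \<open>auto simp: interior_open\<close>)
    then obtain e where e: "0 < e" "cball (?h t) e \<subseteq> ?h ` U"
      unfolding mem_interior_cball by blast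
    have "(F t - e, g t) \<in> cball (?h t) e" using e by (simp add: dist_Pair_Pair dist_real_def)
    with e obtain s where "s \<in> U" "F s = F t - e" "g s = g t" by auto
    then show False using min[of s] gt e by simp
  qed
  moreover have "subspace (range ?h')" using lh by (simp add: linear_subspace_image)
  ultimately have "span (range ?h') \<noteq> UNIV" by (metis span_eq_iff)
  then have "span (range ?h') \<subset> span UNIV" by auto
  then obtain z where z: "z \<noteq> 0" "\<And>y. y \<in> span (range ?h') \<Longrightarrow> orthogonal z y"
    using orthogonal_to_subspace_exists_gen[of "range ?h'" UNIV] by blast
  obtain \<alpha> l where zeq: "z = (\<alpha>, l)" by (cases z)
  have orth: "\<alpha> * F' v + l \<bullet> g' v = 0" for v
    using z(2)[of "?h' v"] by (auto simp: zeq orthogonal_def span_base)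
  have "\<alpha> \<noteq> 0"
  proof
    assume "\<alpha> = 0"
    obtain v where "g' v = l" using surj by (metis surjD)
    then have "l \<bullet> l = 0" using orth[of v] \<open>\<alpha> = 0\<close> by simp
    then show False using z(1) zeq \<open>\<alpha> = 0\<close> by (simp add: zero_prod_def)
  qed
  then have "F' v = (- (1 / \<alpha>) *\<^sub>R l) \<bullet> g' v" for v
    using orth[of v] by (simp add: field_simps)
  then show ?thesis by (rule that)
qed

section \<open>Positive definite matrices and their inverses\<close>

lemma positive_definite_inner_ge:
  fixes A :: "real^'p::finite^'p"
  assumes "positive_definite A"
  obtains c where "0 < c" "\<And>v. c * (norm v)\<^sup>2 \<le> v \<bullet> (A *v v)"
proof -
  let ?S = "sphere 0 1 :: (real^'p) set"
  have "continuous_on ?S (\<lambda>v. v \<bullet> (A *v v))"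
    by (intro continuous_intros linear_continuous_on) (simp add: linear_conv_bounded_linear[symmetric])
  moreover have "?S \<noteq> {}" by (simp add: sphere_eq_empty)
  ultimately obtain u where u: "u \<in> ?S" "\<And>v. v \<in> ?S \<Longrightarrow> u \<bullet> (A *v u) \<le> v \<bullet> (A *v v)"
    using continuous_attains_inf[of ?S "\<lambda>v. v \<bullet> (A *v v)"] by auto
  show ?thesis
  proof
    have "u \<noteq> 0" using u(1) by auto
    then show "0 < u \<bullet> (A *v u)" using assms by (auto simp: positive_definite_def)
    show "(u \<bullet> (A *v u)) * (norm v)\<^sup>2 \<le> v \<bullet> (A *v v)" for v
    proof (cases "v = 0")
      case False
      then have "u \<bullet> (A *v u) \<le> (v /\<^sub>R norm v) \<bullet> (A *v (v /\<^sub>R norm v))"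
        by (intro u(2)) simp
      then have "u \<bullet> (A *v u) \<le> v \<bullet> (A *v v) / (norm v)\<^sup>2"
        by (simp add: matrix_vector_mult_scaleR power2_eq_square divide_inverse mult_ac)
      then show ?thesis using False by (simp add: pos_le_divide_eq)
    qed simp
  qed
qed

lemma positive_definite_invertible:
  fixes A :: "real^'p::finite^'p"
  assumes "positive_definite A"
  shows "invertible A"
proof -
  have "x = 0" if "A *v x = 0" for x
    using assms that unfolding positive_definite_def by (metis inner_zero_right less_irrefl)
  then have "inj ((*v) A)" by (simp add: inj_matrix_vector_mult matrix_left_invertible_ker matrix_left_invertible_injective linear_injective_0)
  then show ?thesis by (metis invertible_left_inverse matrix_left_invertible_injective)
qed

lemma
  fixes A :: "real^'p::finite^'p"
  assumes "invertible A"
  shows matrix_inv_mult_left: "matrix_inv A ** A = mat 1" and matrix_inv_mult_right: "A ** matrix_inv A = mat 1"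
  using assms someI_ex[of "\<lambda>A'. A ** A' = mat 1 \<and> A' ** A = mat 1"]
  unfolding invertible_def matrix_inv_def by blast+

lemma transpose_matrix_inv_symmetric:
  fixes A :: "real^'p::finite^'p"
  assumes "invertible A" "transpose A = A"
  shows "transpose (matrix_inv A) = matrix_inv A"
proof -
  have "transpose (matrix_inv A) ** A = mat 1"
    using matrix_inv_mult_right[OF assms(1)] assms(2) by (metis matrix_transpose_mul transpose_mat)
  then have "transpose (matrix_inv A) ** A ** matrix_inv A = matrix_inv A" by simp
  then show ?thesis by (simp add: matrix_mul_assoc[symmetric] matrix_inv_mult_right[OF assms(1)])
qed

lemma inner_transpose_mult:
  fixes A :: "real^'q::finite^'p::finite"
  shows "a \<bullet> (A *v b) = (transpose A *v a) \<bullet> b"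
  by (simp add: dot_lmul_matrix[symmetric])

lemma positive_definite_matrix_inv:
  fixes A :: "real^'p::finite^'p"
  assumes "positive_definite A"
  shows "positive_definite (matrix_inv A)"
proof -
  have inv: "invertible A" by (rule positive_definite_invertible[OF assms])
  have AA: "A *v (matrix_inv A *v v) = v" for v
    by (simp add: matrix_vector_mul_assoc matrix_inv_mult_right[OF inv])
  have "0 < v \<bullet> (matrix_inv A *v v)" if "v \<noteq> 0" for v
  proof -
    have "matrix_inv A *v v \<noteq> 0" using AA[of v] that by auto
    then have "0 < (matrix_inv A *v v) \<bullet> (A *v (matrix_inv A *v v))"
      using assms by (auto simp: positive_definite_def)
    then show ?thesis by (simp add: AA inner_commute)
  qed
  then show ?thesis
    using transpose_matrix_inv_symmetric[OF inv] assms by (auto simp: positive_definite_def)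
qed

lemma matrix_mult_diff_rdistrib:
  fixes A B :: "'a::ring_1^'n::finite^'m"
  shows "(A - B) ** C = A ** C - B ** C"
  by (simp add: matrix_matrix_mult_def vec_eq_iff sum_subtractf algebra_simps)

text \<open>On vectors of vectors \<open>norm\<close> is the Frobenius norm; the bound is the
  Cauchy-Schwarz inequality in each row.\<close>

lemma norm_matrix_vector_mult_le:
  fixes A :: "real^'q::finite^'p::finite"
  shows "norm (A *v v) \<le> norm A * norm v"
proof -
  have "norm (A *v v) = L2_set (\<lambda>i. \<bar>A $ i \<bullet> v\<bar>) UNIV"
    by (simp add: norm_vec_def matrix_vector_mul_component)
  also have "\<dots> \<le> L2_set (\<lambda>i. norm (A $ i) * norm v) UNIV"
    by (intro L2_set_mono) (auto simp: Cauchy_Schwarz_ineq2)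
  also have "\<dots> = norm A * norm v"
    by (simp add: L2_set_left_distrib norm_vec_def)
  finally show ?thesis .
qed

text \<open>The gradient estimate is integrated along the segment from \<open>\<theta>0\<close> to
  \<open>\<theta>\<close>. On it the remainder is bounded by its value at the far end, which gives
  the cubic term with constant \<open>b\<close>.\<close>

lemma quadratic_lower_bound:
  fixes F :: "real^'p::finite \<Rightarrow> real"
  assumes deriv: "\<And>\<theta>. \<theta> \<in> cball \<theta>0 r \<Longrightarrow> (F has_derivative (\<lambda>v. D \<theta> \<bullet> v)) (at \<theta>)"
    and grad: "\<And>\<theta>. \<theta> \<in> cball \<theta>0 r \<Longrightarrow>
      norm (D \<theta> - s - A *v (\<theta> - \<theta>0)) \<le> b * (norm (\<theta> - \<theta>0))\<^sup>2"
    and \<theta>: "\<theta> \<in> cball \<theta>0 r"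
  shows "F \<theta>0 + s \<bullet> (\<theta> - \<theta>0) + (\<theta> - \<theta>0) \<bullet> (A *v (\<theta> - \<theta>0)) / 2 - b * norm (\<theta> - \<theta>0) ^ 3 \<le> F \<theta>"
proof (cases "\<theta> = \<theta>0")
  case False
  define d where "d = \<theta> - \<theta>0"
  have dr: "norm d \<le> r" using \<theta> by (simp add: d_def dist_norm norm_minus_commute)
  have "0 \<le> b * (norm d)\<^sup>2" using order_trans[OF norm_ge_zero grad[OF \<theta>]] by (simp add: d_def)
  then have b: "0 \<le> b" using False by (simp add: d_def zero_le_mult_iff)
  \<comment> \<open>The derivative of \<open>h\<close> is the gradient error paired with
    \<open>d\<close> plus \<open>b * norm d ^ 3\<close>, the largest size of that pairing; so
    \<open>h\<close> increases from 0 to 1, which is the claim.\<close>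
  define h where "h \<tau> = F (\<theta>0 + \<tau> *\<^sub>R d) - \<tau> * (s \<bullet> d) - \<tau>\<^sup>2 / 2 * (d \<bullet> (A *v d)) + \<tau> * (b * norm d ^ 3)" for \<tau>
  have "h 0 \<le> h 1"
  proof (rule DERIV_nonneg_imp_nondecreasing[where f=h and a=0 and b=1])
    fix \<tau> :: real assume \<tau>: "0 \<le> \<tau>" "\<tau> \<le> 1"
    define \<theta>' where "\<theta>' = \<theta>0 + \<tau> *\<^sub>R d"
    have "norm (\<tau> *\<^sub>R d) \<le> r" using \<tau> dr mult_left_le_one_le[of "norm d" \<tau>] by simp
    then have in_ball: "\<theta>' \<in> cball \<theta>0 r" by (simp add: \<theta>'_def dist_norm)
    have "((\<lambda>\<tau>. \<theta>0 + \<tau> *\<^sub>R d) has_derivative (\<lambda>x. x *\<^sub>R d)) (at \<tau>)"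
      by (auto intro!: derivative_eq_intros)
    from has_derivative_compose[OF this, of F "\<lambda>v. D \<theta>' \<bullet> v"] deriv[OF in_ball]
    have "((\<lambda>\<tau>. F (\<theta>0 + \<tau> *\<^sub>R d)) has_derivative (\<lambda>x. D \<theta>' \<bullet> (x *\<^sub>R d))) (at \<tau>)"
      by (simp add: \<theta>'_def)
    then have F': "((\<lambda>\<tau>. F (\<theta>0 + \<tau> *\<^sub>R d)) has_real_derivative (D \<theta>' \<bullet> d)) (at \<tau>)"
      by (simp add: has_field_derivative_def mult.commute[of _ "D \<theta>' \<bullet> d"])
    have "(h has_real_derivative (D \<theta>' \<bullet> d - s \<bullet> d - \<tau> * (d \<bullet> (A *v d)) + b * norm d ^ 3)) (at \<tau>)"
      unfolding h_def by (auto intro!: derivative_eq_intros F')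
    moreover have "0 \<le> D \<theta>' \<bullet> d - s \<bullet> d - \<tau> * (d \<bullet> (A *v d)) + b * norm d ^ 3"
    proof -
      have "norm (D \<theta>' - s - A *v (\<theta>' - \<theta>0)) \<le> b * (norm (\<theta>' - \<theta>0))\<^sup>2" by (rule grad[OF in_ball])
      also have "(norm (\<theta>' - \<theta>0))\<^sup>2 = \<tau>\<^sup>2 * (norm d)\<^sup>2" by (simp add: \<theta>'_def power_mult_distrib)
      also have "b * (\<tau>\<^sup>2 * (norm d)\<^sup>2) \<le> b * (norm d)\<^sup>2"
        using \<tau> b by (intro mult_left_mono mult_left_le_one_le) (auto simp: power_le_one)
      finally have n: "norm (D \<theta>' - s - A *v (\<theta>' - \<theta>0)) \<le> b * (norm d)\<^sup>2" .
      have "\<bar>(D \<theta>' - s - A *v (\<theta>' - \<theta>0)) \<bullet> d\<bar> \<le> norm (D \<theta>' - s - A *v (\<theta>' - \<theta>0)) * norm d"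
        by (rule Cauchy_Schwarz_ineq2)
      also have "\<dots> \<le> b * (norm d)\<^sup>2 * norm d" using n by (rule mult_right_mono) simp
      also have "\<dots> = b * norm d ^ 3" by (simp add: power2_eq_square power3_eq_cube)
      finally have "\<bar>(D \<theta>' - s - A *v (\<theta>' - \<theta>0)) \<bullet> d\<bar> \<le> b * norm d ^ 3" .
      moreover have "(D \<theta>' - s - A *v (\<theta>' - \<theta>0)) \<bullet> d = D \<theta>' \<bullet> d - s \<bullet> d - \<tau> * (d \<bullet> (A *v d))"
        by (simp add: \<theta>'_def inner_diff_left inner_diff_right matrix_vector_mult_scaleR inner_commute)
      ultimately show ?thesis by linarith
    qed
    ultimately show "\<exists>y. (h has_real_derivative y) (at \<tau>) \<and> 0 \<le> y" by blast
  qed simp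
  then show ?thesis by (simp add: h_def d_def)
qed simp

text \<open>Half the form of \<open>J\<close> is at least \<open>c / 2\<close> times the squared
  distance. Replacing \<open>J\<close> by \<open>A\<close> costs \<open>c / 8\<close> and the cubic
  term another \<open>c / 8\<close>; the remaining \<open>c / 4\<close> must be balanced by the
  linear term.\<close>

lemma norm_le_of_quadratic_lower_bound:
  fixes F :: "real^'p::finite \<Rightarrow> real"
  assumes deriv: "\<And>\<theta>. \<theta> \<in> cball \<theta>0 r \<Longrightarrow> (F has_derivative (\<lambda>v. D \<theta> \<bullet> v)) (at \<theta>)"
    and grad: "\<And>\<theta>. \<theta> \<in> cball \<theta>0 r \<Longrightarrow>
      norm (D \<theta> - s - A *v (\<theta> - \<theta>0)) \<le> b * (norm (\<theta> - \<theta>0))\<^sup>2"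
    and \<theta>: "\<theta> \<in> cball \<theta>0 r" and le: "F \<theta> \<le> F \<theta>0"
    and c: "0 < c" "\<And>v. c * (norm v)\<^sup>2 \<le> v \<bullet> (J *v v)"
    and A: "norm (A - J) \<le> c / 4" and b: "b * r \<le> c / 8" "0 \<le> b"
  shows "norm (\<theta> - \<theta>0) \<le> 4 / c * norm s"
proof (cases "\<theta> = \<theta>0")
  case False
  define d where "d = \<theta> - \<theta>0"
  have d0: "0 < norm d" using False by (simp add: d_def)
  have dr: "norm d \<le> r" using \<theta> by (simp add: d_def dist_norm norm_minus_commute)
  have "F \<theta>0 + s \<bullet> d + d \<bullet> (A *v d) / 2 - b * norm d ^ 3 \<le> F \<theta>"
    unfolding d_def by (rule quadratic_lower_bound[OF deriv grad \<theta>])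
  then have 1: "s \<bullet> d + d \<bullet> (A *v d) / 2 - b * norm d ^ 3 \<le> 0" using le by simp
  have 2: "- (norm s * norm d) \<le> s \<bullet> d" using Cauchy_Schwarz_ineq2[of s d] by linarith
  have "\<bar>d \<bullet> ((A - J) *v d)\<bar> \<le> norm d * norm ((A - J) *v d)" by (rule Cauchy_Schwarz_ineq2)
  also have "\<dots> \<le> norm d * (norm (A - J) * norm d)"
    by (intro mult_left_mono norm_matrix_vector_mult_le) simp
  also have "\<dots> \<le> norm d * (c / 4 * norm d)"
    using A by (intro mult_left_mono mult_right_mono) auto
  finally have 3: "\<bar>d \<bullet> (A *v d) - d \<bullet> (J *v d)\<bar> \<le> c / 4 * (norm d)\<^sup>2"
    by (simp add: matrix_vector_mult_diff_rdistrib inner_diff_right power2_eq_square mult_ac)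
  have "b * norm d ^ 3 = b * norm d * (norm d)\<^sup>2" by (simp add: power2_eq_square power3_eq_cube)
  also have "\<dots> \<le> c / 8 * (norm d)\<^sup>2"
    using b dr order_trans[OF mult_left_mono[OF dr b(2)] b(1)] by (intro mult_right_mono) auto
  finally have 4: "b * norm d ^ 3 \<le> c / 8 * (norm d)\<^sup>2" .
  have "c / 4 * (norm d)\<^sup>2 \<le> norm s * norm d"
    using 1 2 3 4 c(2)[of d] by linarith
  then have "c / 4 * norm d \<le> norm s" using d0 by (simp add: power2_eq_square)
  then show ?thesis using c by (simp add: d_def field_simps)
qed (use c in simp)

text \<open>The oblique projection \<open>P A\<close> onto the kernel of \<open>transpose G\<close> along \<open>Ai G\<close>, where \<open>Ai\<close> is
  the inverse of \<open>A\<close>.\<close>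

locale constrained_quadratic =
  fixes A :: "real^'p::finite^'p" and G :: "real^'r::finite^'p"
  assumes pd: "positive_definite A" and inj_G: "inj ((*v) G)"
begin

definition "Ai = matrix_inv A"
definition "Q = Ai ** G ** matrix_inv (transpose G ** Ai ** G)"
definition "P = Ai - Q ** transpose G ** Ai"

lemma Ai: "Ai ** A = mat 1" "A ** Ai = mat 1" "transpose Ai = Ai" "positive_definite Ai"
  using positive_definite_invertible[OF pd] positive_definite_matrix_inv[OF pd]
  by (auto simp: Ai_def matrix_inv_mult_left matrix_inv_mult_right positive_definite_def)

lemma positive_definite_GAiG: "positive_definite (transpose G ** Ai ** G)"
proof -
  have "transpose (transpose G ** Ai ** G) = transpose G ** Ai ** G"
    by (simp add: matrix_transpose_mul Ai(3) matrix_mul_assoc)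
  moreover have "0 < v \<bullet> ((transpose G ** Ai ** G) *v v)" if "v \<noteq> 0" for v
  proof -
    have "G *v v \<noteq> 0" using inj_G that by (metis injD matrix_vector_mult_0_right)
    then have "0 < (G *v v) \<bullet> (Ai *v (G *v v))" using Ai(4) by (auto simp: positive_definite_def)
    then show ?thesis
      by (metis inner_transpose_mult matrix_vector_mul_assoc transpose_transpose)
  qed
  ultimately show ?thesis by (simp add: positive_definite_def)
qed

lemma P_mult_G: "P ** G = 0"
proof -
  let ?B = "transpose G ** Ai ** G"
  have "Q ** transpose G ** Ai ** G = Ai ** G ** (matrix_inv ?B ** ?B)"
    by (simp add: Q_def matrix_mul_assoc)
  then show ?thesis
    using matrix_inv_mult_left[OF positive_definite_invertible[OF positive_definite_GAiG]]
    by (simp add: P_def matrix_mult_diff_rdistrib)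
qed

lemma P_mult_A: "P ** A = mat 1 - Q ** transpose G"
proof -
  have "Q ** transpose G ** Ai ** A = Q ** transpose G ** (Ai ** A)" by (simp add: matrix_mul_assoc)
  then show ?thesis by (simp add: P_def matrix_mult_diff_rdistrib Ai(1))
qed

text \<open>This symmetry is why the limit covariance reads \<open>P ** K ** P\<close> without a
  transpose, and it moves \<open>P\<close> across inner products.\<close>

lemma transpose_P: "transpose P = P"
proof -
  let ?B = "transpose G ** Ai ** G"
  have "transpose (matrix_inv ?B) = matrix_inv ?B"
    using positive_definite_GAiG
    by (intro transpose_matrix_inv_symmetric positive_definite_invertible) (auto simp: positive_definite_def)
  then have "transpose (Q ** transpose G ** Ai) = Q ** transpose G ** Ai"
    by (simp add: Q_def matrix_transpose_mul Ai(3) matrix_mul_assoc)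
  moreover have "transpose (X - Y) = transpose X - transpose Y" for X Y :: "real^'p^'p"
    by (simp add: transpose_def vec_eq_iff)
  ultimately show ?thesis by (simp add: P_def Ai(3))
qed

text \<open>Applying \<open>P\<close> to the Lagrange condition \<open>y = Gf t *v l\<close> annihilates the multiplier
  term up to the modulus of continuity of the constraint Jacobian.\<close>

lemma constrained_critical_point_expansion:
  fixes g :: "real^'p \<Rightarrow> real^'r" and Gf :: "real^'p \<Rightarrow> real^'r^'p"
  assumes g: "(g has_derivative (\<lambda>v. transpose G *v v)) (at \<theta>0)" "g \<theta>0 = 0"
    and Gf: "isCont Gf \<theta>0" "Gf \<theta>0 = G" and e: "0 < e"
  obtains \<delta> where "0 < \<delta>"
    "\<And>t y s l. norm (t - \<theta>0) < \<delta> \<Longrightarrow> g t = 0 \<Longrightarrow> y = Gf t *v l \<Longrightarrow>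
      norm (y - s - A *v (t - \<theta>0)) \<le> \<delta> * norm (t - \<theta>0) \<Longrightarrow>
      norm (t - \<theta>0 + P *v s) \<le> e * norm s"
proof -
  obtain B where B: "0 < B" "\<And>l. B * norm l \<le> norm (G *v l)"
    using linear_inj_bounded_below_pos[OF matrix_vector_mul_linear inj_G] by blast
  define a p q where "a = norm A" and "p = norm P" and "q = norm Q"
  \<comment> \<open>The three main summands are the factors of the multiplier term, of the
    constraint term \<open>Q *v (transpose G *v d)\<close> and of the remainder
    \<open>P *v \<rho>\<close>; the final 1 only makes \<open>C\<close> at least 1.\<close>
  define C where "C = p * (2 / B) * (a + 1) + q + p + 1"
  have nonneg: "0 \<le> a" "0 \<le> p" "0 \<le> q" by (auto simp: a_def p_def q_def)
  have C: "1 \<le> C" using nonneg B(1) by (simp add: C_def)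
  \<comment> \<open>In order: \<open>B / 2\<close> keeps the perturbed Jacobian bounded below on
    \<open>l\<close>; 1 bounds the remainder by \<open>norm d\<close>; \<open>1 / (2 * C)\<close>
    lets half of \<open>norm d\<close> be absorbed; the last entry turns the resulting constant into
    \<open>e\<close>.\<close>
  define \<eta> where "\<eta> = Min {B / 2, 1, 1 / (2 * C), e / (C * (2 * p + 2))}"
  have \<eta>: "0 < \<eta>" "\<eta> \<le> B / 2" "\<eta> \<le> 1" "\<eta> \<le> 1 / (2 * C)" "\<eta> \<le> e / (C * (2 * p + 2))"
  proof -
    show "0 < \<eta>" using B C e nonneg by (simp add: \<eta>_def)
  qed (simp_all only: \<eta>_def Min_le finite.intros insert_iff simp_thms)
  obtain \<delta>1 where \<delta>1: "0 < \<delta>1"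
    "\<And>t. norm (t - \<theta>0) < \<delta>1 \<Longrightarrow> norm (g t - g \<theta>0 - transpose G *v (t - \<theta>0)) \<le> \<eta> * norm (t - \<theta>0)"
    using g(1) \<eta>(1) unfolding has_derivative_at_alt by blast
  obtain \<delta>2 where \<delta>2: "0 < \<delta>2" "\<And>t. norm (t - \<theta>0) < \<delta>2 \<Longrightarrow> norm (Gf t - G) < \<eta>"
    using Gf(1) \<eta>(1) unfolding continuous_at_eps_delta Gf(2) dist_norm by blast
  define \<delta> where "\<delta> = Min {\<delta>1, \<delta>2, \<eta>}"
  have \<delta>: "0 < \<delta>" "\<delta> \<le> \<delta>1" "\<delta> \<le> \<delta>2" "\<delta> \<le> \<eta>" using \<delta>1 \<delta>2 \<eta> by (auto simp: \<delta>_def)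
  show ?thesis
  proof (rule that[OF \<delta>(1)])
    fix t y s l
    assume near: "norm (t - \<theta>0) < \<delta>" and gt: "g t = 0" and y: "y = Gf t *v l"
      and lin: "norm (y - s - A *v (t - \<theta>0)) \<le> \<delta> * norm (t - \<theta>0)"
    define d \<rho> where "d = t - \<theta>0" and "\<rho> = y - s - A *v (t - \<theta>0)"
    have \<rho>: "norm \<rho> \<le> \<eta> * norm d"
      using lin \<delta>(4) mult_right_mono[OF \<delta>(4), of "norm d"] by (simp add: \<rho>_def d_def)
    \<comment> \<open>Since \<open>g\<close> vanishes at \<open>t\<close> and at
      \<open>\<theta>0\<close>, this vector is, up to sign, the linearization error of
      \<open>g\<close>.\<close>
    have Gd: "norm (transpose G *v d) \<le> \<eta> * norm d"
      using \<delta>1(2)[of t] near \<delta>(2) gt g(2) by (simp add: d_def)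
    have Gl: "norm ((Gf t - G) *v l) \<le> \<eta> * norm l"
    proof -
      have "norm (Gf t - G) \<le> \<eta>" using \<delta>2(2)[of t] near \<delta>(3) by simp
      then show ?thesis
        using norm_matrix_vector_mult_le[of "Gf t - G" l] mult_right_mono[of _ \<eta> "norm l"]
        by (smt (verit) norm_ge_zero)
    qed
    have ys: "norm y \<le> norm s + (a + 1) * norm d"
    proof -
      have "y = s + A *v d + \<rho>" by (simp add: \<rho>_def d_def)
      then have "norm y \<le> norm s + norm (A *v d) + norm \<rho>"
        by (smt (verit) norm_triangle_ineq)
      moreover have "norm (A *v d) \<le> a * norm d" unfolding a_def by (rule norm_matrix_vector_mult_le)
      moreover have "\<eta> * norm d \<le> 1 * norm d" using \<eta>(3) by (rule mult_right_mono) simp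
      ultimately show ?thesis using \<rho> by (simp add: distrib_right)
    qed
    have ly: "norm l \<le> 2 / B * norm y"
    proof -
      have "G *v l = y - (Gf t - G) *v l" by (simp add: y matrix_vector_mult_diff_rdistrib)
      then have "norm (G *v l) \<le> norm y + norm ((Gf t - G) *v l)" by (metis norm_triangle_ineq4)
      moreover have "\<eta> * norm l \<le> B / 2 * norm l" using \<eta>(2) by (rule mult_right_mono) simp
      ultimately have "B / 2 * norm l \<le> norm y" using B(2)[of l] Gl by simp
      then show ?thesis using B(1) by (simp add: field_simps)
    qed
    \<comment> \<open>Applying \<open>P\<close> to \<open>y = s + A *v d + \<rho>\<close>: on the
      left only the perturbation of the Jacobian survives, on the right \<open>P *v (A *v d)\<close>
      is \<open>d\<close> minus its constraint component.\<close>
    have eq: "d + P *v s = P *v ((Gf t - G) *v l) + Q *v (transpose G *v d) - P *v \<rho>"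
    proof -
      have "P *v y = P *v ((Gf t - G) *v l)"
      proof -
        have "P *v (G *v l) = 0" by (simp add: matrix_vector_mul_assoc P_mult_G)
        then show ?thesis by (simp add: y matrix_vector_mult_diff_rdistrib matrix_vector_mult_diff_distrib)
      qed
      moreover have "P *v (A *v d) = d - Q *v (transpose G *v d)"
        by (simp only: matrix_vector_mul_assoc P_mult_A matrix_vector_mult_diff_rdistrib matrix_vector_mul_lid)
      moreover have "P *v \<rho> = P *v y - P *v s - P *v (A *v d)"
        by (simp add: \<rho>_def d_def matrix_vector_mult_diff_distrib)
      ultimately have "P *v \<rho> = P *v ((Gf t - G) *v l) - P *v s - (d - Q *v (transpose G *v d))"
        by simp
      moreover have "z + w = x + y - (x - w - (z - y))" for w x y z :: "real^'p" by simp
      ultimately show ?thesis by metis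
    qed
    have main: "norm (d + P *v s) \<le> \<eta> * C * (norm s + norm d)"
    proof -
      have "norm (d + P *v s) \<le> norm (P *v ((Gf t - G) *v l)) + norm (Q *v (transpose G *v d)) + norm (P *v \<rho>)"
        unfolding eq by (smt (verit) norm_triangle_ineq norm_triangle_ineq4)
      also have "\<dots> \<le> p * (\<eta> * norm l) + q * (\<eta> * norm d) + p * (\<eta> * norm d)"
        using Gl Gd \<rho> nonneg unfolding p_def q_def
        by (intro add_mono order_trans[OF norm_matrix_vector_mult_le[of P]]
            order_trans[OF norm_matrix_vector_mult_le[of Q]] mult_left_mono) auto
      also have "norm l \<le> 2 / B * (norm s + (a + 1) * norm d)"
        using ly ys B(1) order_trans[OF ly mult_left_mono[OF ys, of "2 / B"]] by simp
      also have "\<dots> \<le> 2 / B * ((a + 1) * (norm s + norm d))"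
        using B(1) nonneg by (intro mult_left_mono) (auto simp: algebra_simps)
      finally have "norm (d + P *v s) \<le> p * (\<eta> * (2 / B * ((a + 1) * (norm s + norm d)))) + q * (\<eta> * norm d) + p * (\<eta> * norm d)"
        using nonneg \<eta>(1) B(1) by (simp add: mult_left_mono)
      also have "\<dots> \<le> p * (\<eta> * (2 / B * ((a + 1) * (norm s + norm d)))) + q * (\<eta> * (norm s + norm d)) + p * (\<eta> * (norm s + norm d))"
        using nonneg \<eta>(1) B(1) by (intro add_mono mult_left_mono) auto
      also have "\<dots> = \<eta> * (C - 1) * (norm s + norm d)"
        by (simp add: C_def algebra_simps add_divide_distrib)
      also have "\<dots> \<le> \<eta> * C * (norm s + norm d)"
        using \<eta>(1) by (intro mult_right_mono) auto
      finally show ?thesis .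
    qed
    have Ps: "norm (P *v s) \<le> p * norm s" unfolding p_def by (rule norm_matrix_vector_mult_le)
    have "norm d \<le> norm (d + P *v s) + norm (P *v s)"
      using norm_triangle_ineq4[of "d + P *v s" "P *v s"] by simp
    \<comment> \<open>Half of \<open>norm d\<close> is absorbed on the left, so
      \<open>norm d\<close> is controlled by \<open>norm s\<close> before the factor
      \<open>e\<close> is extracted.\<close>
    moreover have "\<eta> * C * (norm s + norm d) \<le> 1 / 2 * (norm s + norm d)"
      using \<eta>(4) C by (intro mult_right_mono) (auto simp: field_simps)
    ultimately have "norm d \<le> (2 * p + 1) * norm s" using main Ps by (simp add: algebra_simps)
    then have "norm s + norm d \<le> (2 * p + 2) * norm s" by (simp add: algebra_simps)
    then have "norm (d + P *v s) \<le> \<eta> * C * ((2 * p + 2) * norm s)"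
      using main \<eta>(1) C by (smt (verit) mult_left_mono mult_nonneg_nonneg)
    also have "\<dots> = \<eta> * (C * (2 * p + 2)) * norm s" by (simp add: mult_ac)
    also have "\<dots> \<le> e * norm s"
      using \<eta>(5) C nonneg by (intro mult_right_mono) (auto simp: pos_le_divide_eq)
    finally show "norm (t - \<theta>0 + P *v s) \<le> e * norm s" by (simp add: d_def)
  qed
qed

end

section \<open>Measurable selection of minimizers\<close>

text \<open>Measurability of a set-valued map, tested on closed sets. For singleton values it
  amounts to Borel measurability of the point.\<close>

definition hit_measurable :: "'x measure \<Rightarrow> ('x \<Rightarrow> 'a::topological_space set) \<Rightarrow> bool" where
  "hit_measurable N A \<longleftrightarrow> (\<forall>F. closed F \<longrightarrow> {x\<in>space N. A x \<inter> F \<noteq> {}} \<in> sets N)"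

definition argmin_on :: "('a \<Rightarrow> real) \<Rightarrow> 'a set \<Rightarrow> 'a set" where
  "argmin_on \<phi> A = {a\<in>A. \<forall>b\<in>A. \<phi> a \<le> \<phi> b}"

text \<open>The minimum over \<open>A\<close> is attained in \<open>F\<close> if the minima over
  \<open>A\<close> and over \<open>A \<inter> F\<close> agree. Comparing them through rational
  levels leaves countably many conditions on sublevel sets, which is what measurability
  requires.\<close>

lemma argmin_on_inter_iff:
  fixes A :: "'a::topological_space set"
  assumes "compact A" "continuous_on A \<phi>" "closed F"
  shows "argmin_on \<phi> A \<inter> F \<noteq> {} \<longleftrightarrow> A \<noteq> {} \<and>
    (\<forall>q\<in>\<rat>. (\<exists>a\<in>A. \<phi> a \<le> q) \<longrightarrow> (\<exists>a\<in>A \<inter> F. \<phi> a \<le> q))"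
proof (intro iffI conjI ballI impI)
  assume "argmin_on \<phi> A \<inter> F \<noteq> {}"
  then show "A \<noteq> {}" by (auto simp: argmin_on_def)
next
  fix q assume "argmin_on \<phi> A \<inter> F \<noteq> {}" "\<exists>a\<in>A. \<phi> a \<le> q"
  then obtain a b where "a \<in> A" "a \<in> F" "\<forall>b\<in>A. \<phi> a \<le> \<phi> b" "b \<in> A" "\<phi> b \<le> q"
    by (auto simp: argmin_on_def)
  then show "\<exists>a\<in>A \<inter> F. \<phi> a \<le> q"
    by (intro bexI[of _ a]) fastforce+
next
  assume *: "A \<noteq> {} \<and> (\<forall>q\<in>\<rat>. (\<exists>a\<in>A. \<phi> a \<le> q) \<longrightarrow> (\<exists>a\<in>A \<inter> F. \<phi> a \<le> q))"
  have hit: "\<exists>b\<in>A \<inter> F. \<phi> b \<le> q" if "q \<in> \<rat>" "a \<in> A" "\<phi> a < q" for a q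
    using * that by (meson less_imp_le)
  obtain a where a: "a \<in> A" "\<forall>b\<in>A. \<phi> a \<le> \<phi> b"
    using continuous_attains_inf[OF assms(1) conjunct1[OF *] assms(2)] by blast
  have AF: "compact (A \<inter> F)" using assms(1,3) by (rule compact_Int_closed)
  obtain q0 where q0: "q0 \<in> \<rat>" "\<phi> a < q0" using Rats_dense_in_real[of "\<phi> a" "\<phi> a + 1"] by auto
  have ne: "A \<inter> F \<noteq> {}" using hit[OF q0(1) a(1) q0(2)] by blast
  have "continuous_on (A \<inter> F) \<phi>" using assms(2) by (rule continuous_on_subset) auto
  from continuous_attains_inf[OF AF ne this]
  obtain c where c: "c \<in> A \<inter> F" "\<forall>b\<in>A \<inter> F. \<phi> c \<le> \<phi> b" by blast
  have "\<phi> c \<le> \<phi> a"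
  proof (rule ccontr)
    assume "\<not> \<phi> c \<le> \<phi> a"
    then obtain q where q: "q \<in> \<rat>" "\<phi> a < q" "q < \<phi> c" using Rats_dense_in_real[of "\<phi> a" "\<phi> c"] by auto
    obtain b where "b \<in> A \<inter> F" "\<phi> b \<le> q" using hit[OF q(1) a(1) q(2)] by blast
    then show False using bspec[OF c(2), of b] q(3) by simp
  qed
  then have "\<forall>b\<in>A. \<phi> c \<le> \<phi> b" using a(2) order_trans by blast
  then have "c \<in> argmin_on \<phi> A \<inter> F" using c(1) by (simp add: argmin_on_def)
  then show "argmin_on \<phi> A \<inter> F \<noteq> {}" by blast
qed

lemma compact_argmin_on:
  fixes A :: "'a::t2_space set"
  assumes "compact A" "continuous_on A \<phi>"
  shows "compact (argmin_on \<phi> A)"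
proof (cases "A = {}")
  case False
  obtain a where a: "a \<in> A" "\<forall>b\<in>A. \<phi> a \<le> \<phi> b"
    using continuous_attains_inf[OF assms(1) False assms(2)] by blast
  have "argmin_on \<phi> A = A \<inter> \<phi> -` {..\<phi> a}"
    using a order_trans unfolding argmin_on_def by blast
  moreover have "closed (A \<inter> \<phi> -` {..\<phi> a})"
    using assms by (intro continuous_closed_preimage) (auto simp: compact_imp_closed)
  ultimately show ?thesis using assms(1)
    by (metis Int_absorb2 Int_lower1 compact_Int_closed inf.commute)
qed (simp add: argmin_on_def)

lemma argmin_on_nonempty:
  fixes A :: "'a::topological_space set"
  assumes "compact A" "continuous_on A \<phi>" "A \<noteq> {}"
  shows "argmin_on \<phi> A \<noteq> {}"
  using continuous_attains_inf[OF assms(1,3,2)] by (auto simp: argmin_on_def)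

text \<open>The level \<open>q\<close> may be attained only off the dense set, hence the slack
  \<open>1 / Suc k\<close> and the strict inequality; compactness recovers the level
  \<open>q\<close> from all these slacks.\<close>

lemma sublevel_hit_eq_dense:
  fixes C :: "'a::t2_space set"
  assumes "compact C" "continuous_on C \<phi>" "D \<subseteq> C" "C \<subseteq> closure D"
  shows "(\<exists>a\<in>C. \<phi> a \<le> q) \<longleftrightarrow> C \<noteq> {} \<and> (\<forall>k::nat. \<exists>d\<in>D. \<phi> d < q + 1 / Suc k)"
proof (intro iffI conjI allI)
  assume "\<exists>a\<in>C. \<phi> a \<le> q"
  then obtain a where a: "a \<in> C" "\<phi> a \<le> q" by blast
  show "C \<noteq> {}" using a by auto
  fix k :: nat
  show "\<exists>d\<in>D. \<phi> d < q + 1 / Suc k"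
  proof (rule ccontr)
    assume "\<not> ?thesis"
    then have "\<phi> ` D \<subseteq> {q + 1 / Suc k..}" by auto
    moreover have "closure D \<subseteq> C" using assms compact_imp_closed closure_minimal by blast
    ultimately have "\<phi> ` closure D \<subseteq> {q + 1 / Suc k..}"
      using assms(2) by (intro image_closure_subset) (auto intro: continuous_on_subset)
    moreover have "\<phi> a \<in> \<phi> ` closure D" using a assms(4) by blast
    ultimately have "q + 1 / Suc k \<le> \<phi> a" by auto
    moreover have "0 < 1 / real (Suc k)" by simp
    ultimately show False using a(2) by linarith
  qed
next
  assume *: "C \<noteq> {} \<and> (\<forall>k::nat. \<exists>d\<in>D. \<phi> d < q + 1 / Suc k)"
  then obtain a where a: "a \<in> C" "\<And>b. b \<in> C \<Longrightarrow> \<phi> a \<le> \<phi> b"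
    using continuous_attains_inf[OF assms(1) _ assms(2)] by blast
  have "\<phi> a \<le> q"
  proof (rule field_le_epsilon)
    fix e :: real assume "0 < e"
    then obtain k :: nat where k: "1 / Suc k < e" using nat_approx_posE by blast
    obtain d where "d \<in> D" "\<phi> d < q + 1 / Suc k" using * by blast
    then show "\<phi> a \<le> q + e" using a(2)[of d] assms(3) k by fastforce
  qed
  then show "\<exists>a\<in>C. \<phi> a \<le> q" using a by blast
qed

text \<open>Sublevel conditions reduce to countably many points, at each of which \<open>H\<close>
  is measurable in \<open>x\<close>. A dense subset of \<open>C\<close> might miss the closed test
  set \<open>E\<close>, so a countable dense subset of \<open>C \<inter> E\<close> is chosen for
  each \<open>E\<close>.\<close>

lemma hit_measurable_argmin_caratheodory:
  fixes C :: "'a::{metric_space,second_countable_topology} set" and H :: "'x \<Rightarrow> 'a \<Rightarrow> real"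
  assumes C: "compact C"
    and cont: "\<And>x. x \<in> space N \<Longrightarrow> continuous_on C (H x)"
    and meas: "\<And>a. a \<in> C \<Longrightarrow> (\<lambda>x. H x a) \<in> borel_measurable N"
  shows "hit_measurable N (\<lambda>x. argmin_on (H x) C)"
  unfolding hit_measurable_def
proof (intro allI impI)
  fix F :: "'a set" assume F: "closed F"
  have sub: "{x\<in>space N. \<exists>a\<in>C \<inter> E. H x a \<le> q} \<in> sets N" if "closed E" for E q
  proof -
    have K: "compact (C \<inter> E)" using C that by (rule compact_Int_closed)
    obtain D where D: "countable D" "D \<subseteq> C \<inter> E" "C \<inter> E \<subseteq> closure D"
      using separable[of "C \<inter> E"] by auto
    have "{x\<in>space N. \<exists>a\<in>C \<inter> E. H x a \<le> q}
        = {x\<in>space N. C \<inter> E \<noteq> {} \<and> (\<forall>k::nat. \<exists>d\<in>D. H x d < q + 1 / Suc k)}"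
    proof (intro Collect_cong conj_cong refl)
      fix x assume "x \<in> space N"
      then have "continuous_on (C \<inter> E) (H x)" using cont continuous_on_subset by blast
      from sublevel_hit_eq_dense[OF K this D(2,3)]
      show "(\<exists>a\<in>C \<inter> E. H x a \<le> q) \<longleftrightarrow> C \<inter> E \<noteq> {} \<and> (\<forall>k::nat. \<exists>d\<in>D. H x d < q + 1 / Suc k)" .
    qed
    also have "\<dots> = {x\<in>space N. \<forall>k::nat. \<exists>d\<in>D. H x d < q + 1 / Suc k} \<inter> (if C \<inter> E \<noteq> {} then space N else {})"
      by auto
    also have "\<dots> \<in> sets N"
    proof -
      have "{x\<in>space N. H x d < q + 1 / Suc k} \<in> sets N" if "d \<in> D" for d k
        using meas[of d] D(2) that by (intro borel_measurable_less) auto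
      then have "{x\<in>space N. \<forall>k::nat. \<exists>d\<in>D. H x d < q + 1 / Suc k} \<in> sets N"
        by (intro sets.sets_Collect_countable_All sets.sets_Collect_countable_Ex' D(1))
      then show ?thesis by auto
    qed
    finally show ?thesis .
  qed
  have "{x\<in>space N. argmin_on (H x) C \<inter> F \<noteq> {}} = {x\<in>space N. C \<noteq> {} \<and>
      (\<forall>q\<in>\<rat>. (\<exists>a\<in>C \<inter> UNIV. H x a \<le> q) \<longrightarrow> (\<exists>a\<in>C \<inter> F. H x a \<le> q))}"
    using argmin_on_inter_iff[OF C cont F] by auto
  also have "\<dots> = {x\<in>space N. \<forall>q\<in>\<rat>. (\<exists>a\<in>C \<inter> UNIV. H x a \<le> q) \<longrightarrow> (\<exists>a\<in>C \<inter> F. H x a \<le> q)}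
      \<inter> (if C \<noteq> {} then space N else {})" by auto
  also have "\<dots> \<in> sets N"
    using sub[OF F] sub[OF closed_UNIV]
    by (intro sets.Int sets.sets_Collect_countable_All' sets.sets_Collect_imp countable_rat) auto
  finally show "{x\<in>space N. argmin_on (H x) C \<inter> F \<noteq> {}} \<in> sets N" .
qed

text \<open>With a fixed criterion and a varying set, a sublevel set of \<open>\<phi>\<close> is
  itself a closed test set. Coordinates are the criteria used below.\<close>

lemma hit_measurable_argmin:
  fixes A :: "'x \<Rightarrow> 'a::t2_space set"
  assumes A: "hit_measurable N A" and cpt: "\<And>x. x \<in> space N \<Longrightarrow> compact (A x)"
    and cont: "continuous_on UNIV \<phi>"
  shows "hit_measurable N (\<lambda>x. argmin_on \<phi> (A x))"
  unfolding hit_measurable_def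
proof (intro allI impI)
  fix F :: "'a set" assume F: "closed F"
  have sub: "{x\<in>space N. \<exists>a\<in>A x \<inter> E. \<phi> a \<le> q} \<in> sets N" if "closed E" for E q
  proof -
    have "closed (E \<inter> \<phi> -` {..q})"
      using that cont by (intro closed_Int closed_vimage) auto
    then have "{x\<in>space N. A x \<inter> (E \<inter> \<phi> -` {..q}) \<noteq> {}} \<in> sets N" using A by (auto simp: hit_measurable_def)
    also have "{x\<in>space N. A x \<inter> (E \<inter> \<phi> -` {..q}) \<noteq> {}} = {x\<in>space N. \<exists>a\<in>A x \<inter> E. \<phi> a \<le> q}"
      by auto
    finally show ?thesis .
  qed
  have "{x\<in>space N. argmin_on \<phi> (A x) \<inter> F \<noteq> {}} = {x\<in>space N. A x \<inter> UNIV \<noteq> {} \<and>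
      (\<forall>q\<in>\<rat>. (\<exists>a\<in>A x \<inter> UNIV. \<phi> a \<le> q) \<longrightarrow> (\<exists>a\<in>A x \<inter> F. \<phi> a \<le> q))}"
    using argmin_on_inter_iff[OF cpt continuous_on_subset[OF cont] F] by auto
  also have "\<dots> \<in> sets N"
    using sub[OF F] sub[OF closed_UNIV] A
    by (intro sets.sets_Collect_conj sets.sets_Collect_countable_All' sets.sets_Collect_imp countable_rat)
       (auto simp: hit_measurable_def)
  finally show "{x\<in>space N. argmin_on \<phi> (A x) \<inter> F \<noteq> {}} \<in> sets N" .
qed

text \<open>Minimizing the coordinates one after the other leaves a single point.\<close>

lemma hit_measurable_selection_aux:
  fixes A :: "'x \<Rightarrow> (real^'p::finite) set"
  assumes "finite I" "hit_measurable N A" "\<And>x. x \<in> space N \<Longrightarrow> compact (A x) \<and> A x \<noteq> {}"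
  shows "\<exists>A'. hit_measurable N A' \<and>
    (\<forall>x\<in>space N. compact (A' x) \<and> A' x \<noteq> {} \<and> A' x \<subseteq> A x \<and> (\<forall>i\<in>I. \<forall>a\<in>A' x. \<forall>b\<in>A' x. a $ i = b $ i))"
  using assms(1)
proof (induction I rule: finite_induct)
  case empty
  then show ?case using assms by auto
next
  case (insert i I)
  from insert.IH obtain A' where A': "hit_measurable N A'" and all: "\<forall>x\<in>space N. compact (A' x) \<and>
      A' x \<noteq> {} \<and> A' x \<subseteq> A x \<and> (\<forall>i\<in>I. \<forall>a\<in>A' x. \<forall>b\<in>A' x. a $ i = b $ i)"
    by (elim exE conjE)
  have cont: "continuous_on S (\<lambda>a::real^'p. a $ i)" for S by (intro continuous_intros)
  let ?B = "\<lambda>x. argmin_on (\<lambda>a. a $ i) (A' x)"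
  have "compact (A' x)" if "x \<in> space N" for x using bspec[OF all that] by blast
  then have hit: "hit_measurable N ?B" by (rule hit_measurable_argmin[OF A' _ cont])
  have B: "compact (?B x) \<and> ?B x \<noteq> {} \<and> ?B x \<subseteq> A x \<and> (\<forall>j\<in>insert i I. \<forall>a\<in>?B x. \<forall>b\<in>?B x. a $ j = b $ j)"
    if x: "x \<in> space N" for x
  proof -
    note all_x = bspec[OF all x]
    have K: "compact (A' x)" "A' x \<noteq> {}" "A' x \<subseteq> A x" using all_x by blast+
    have eq: "a $ j = b $ j" if "j \<in> I" "a \<in> A' x" "b \<in> A' x" for j a b
      using all_x that by blast
    have "a $ j = b $ j" if "j \<in> insert i I" "a \<in> ?B x" "b \<in> ?B x" for j a b
      using that eq[of j a b] by (auto simp: argmin_on_def order_antisym)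
    moreover have "?B x \<subseteq> A x" using K(3) by (auto simp: argmin_on_def)
    ultimately show ?thesis
      using compact_argmin_on[OF K(1) cont] argmin_on_nonempty[OF K(1) cont K(2)] by blast
  qed
  show ?case by (rule exI[of _ ?B]) (use hit B in blast)
qed

text \<open>Once all coordinates are constant on \<open>A' x\<close>, this set is a singleton. The
  point then lies outside an open set exactly when \<open>A' x\<close> hits the closed
  complement.\<close>

lemma hit_measurable_selection:
  fixes A :: "'x \<Rightarrow> (real^'p::finite) set"
  assumes "hit_measurable N A" "\<And>x. x \<in> space N \<Longrightarrow> compact (A x) \<and> A x \<noteq> {}"
  obtains t where "t \<in> borel_measurable N" "\<And>x. x \<in> space N \<Longrightarrow> t x \<in> A x"
proof -
  have "\<exists>A'. hit_measurable N A' \<and> (\<forall>x\<in>space N. compact (A' x) \<and> A' x \<noteq> {} \<and>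
      A' x \<subseteq> A x \<and> (\<forall>i\<in>UNIV. \<forall>a\<in>A' x. \<forall>b\<in>A' x. a $ i = b $ i))"
    by (rule hit_measurable_selection_aux[OF finite assms(1)]) (rule assms(2))
  then obtain A' where A': "hit_measurable N A'" and all: "\<forall>x\<in>space N. compact (A' x) \<and> A' x \<noteq> {} \<and>
      A' x \<subseteq> A x \<and> (\<forall>i\<in>UNIV. \<forall>a\<in>A' x. \<forall>b\<in>A' x. a $ i = b $ i)"
    by (elim exE conjE)
  define t where "t x = (SOME a. a \<in> A' x)" for x
  have t: "A' x = {t x}" and tA: "t x \<in> A x" if "x \<in> space N" for x
  proof -
    have *: "A' x \<noteq> {}" "A' x \<subseteq> A x" "\<And>i a b. a \<in> A' x \<Longrightarrow> b \<in> A' x \<Longrightarrow> a $ i = b $ i"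
      using bspec[OF all that] by blast+
    have tx: "t x \<in> A' x" unfolding t_def using *(1) by (simp add: some_in_eq)
    have "a = t x" if "a \<in> A' x" for a
      using *(3)[OF that tx] by (simp add: vec_eq_iff)
    with tx *(2) show "A' x = {t x}" "t x \<in> A x" by blast+
  qed
  show ?thesis
  proof
    show "t \<in> borel_measurable N"
    proof (rule borel_measurableI)
      fix S :: "(real^'p) set" assume "open S"
      then have "{x\<in>space N. A' x \<inter> - S \<noteq> {}} \<in> sets N" using A' by (auto simp: hit_measurable_def)
      moreover have "t -` S \<inter> space N = space N - {x\<in>space N. A' x \<inter> - S \<noteq> {}}" using t by auto
      ultimately show "t -` S \<inter> space N \<in> sets N" by simp
    qed
    show "t x \<in> A x" if "x \<in> space N" for x using tA[OF that] .
  qed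
qed

lemma measurable_minimizer_on:
  fixes C :: "(real^'p::finite) set" and H :: "'x \<Rightarrow> real^'p \<Rightarrow> real"
  assumes C: "compact C" "C \<noteq> {}"
    and cont: "\<And>x. x \<in> space N \<Longrightarrow> continuous_on C (H x)"
    and meas: "\<And>a. a \<in> C \<Longrightarrow> (\<lambda>x. H x a) \<in> borel_measurable N"
  obtains t where "t \<in> borel_measurable N" "\<And>x. x \<in> space N \<Longrightarrow> minimizer_on (H x) C (t x)"
proof -
  have hm: "hit_measurable N (\<lambda>x. argmin_on (H x) C)"
    by (rule hit_measurable_argmin_caratheodory[OF C(1) cont meas])
  have ne: "compact (argmin_on (H x) C) \<and> argmin_on (H x) C \<noteq> {}" if "x \<in> space N" for x
    by (rule conjI[OF compact_argmin_on[OF C(1) cont[OF that]] argmin_on_nonempty[OF C(1) cont[OF that] C(2)]])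
  obtain t where t: "t \<in> borel_measurable N" "\<And>x. x \<in> space N \<Longrightarrow> t x \<in> argmin_on (H x) C"
    using hit_measurable_selection[where A="\<lambda>x. argmin_on (H x) C", OF hm ne] by metis
  show ?thesis
  proof (rule that[OF t(1)])
    show "minimizer_on (H x) C (t x)" if "x \<in> space N" for x
      using t(2)[OF that] unfolding minimizer_on_def argmin_on_def by blast
  qed
qed

section \<open>Events of high probability\<close>

lemma borel_measurable_vecI:
  fixes f :: "'a \<Rightarrow> ('b::euclidean_space)^'n::finite"
  assumes "\<And>i. (\<lambda>x. f x $ i) \<in> borel_measurable M"
  shows "f \<in> borel_measurable M"
proof (rule borel_measurable_euclidean_space[THEN iffD2], rule ballI)
  fix u :: "'b^'n" assume "u \<in> Basis"
  then obtain i v where "u = axis i v" "v \<in> Basis" by (auto simp: Basis_vec_def)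
  then show "(\<lambda>x. f x \<bullet> u) \<in> borel_measurable M"
    using assms[of i] by (simp add: inner_axis)
qed

lemma borel_measurable_vec_nth:
  fixes f :: "'a \<Rightarrow> ('b::euclidean_space)^'n::finite"
  assumes "f \<in> borel_measurable M"
  shows "(\<lambda>x. f x $ i) \<in> borel_measurable M"
  using measurable_compose[OF assms borel_measurable_continuous_onI[of "\<lambda>v. v $ i"]]
  by (simp add: continuous_on_component continuous_on_id)

text \<open>As in the definition of the estimator, an inner event avoids measurability of \<open>P n\<close>.\<close>

definition with_high_prob :: "'w measure \<Rightarrow> (nat \<Rightarrow> 'w \<Rightarrow> bool) \<Rightarrow> bool" where
  "with_high_prob M P \<longleftrightarrow> (\<exists>A. (\<forall>n. A n \<in> sets M) \<and> (\<lambda>n. measure M (A n)) \<longlonglongrightarrow> 1 \<and>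
     (\<forall>n. \<forall>w\<in>A n. P n w))"

lemma with_high_prob_mono:
  assumes "with_high_prob M P" "\<And>n w. w \<in> space M \<Longrightarrow> P n w \<Longrightarrow> Q n w"
  shows "with_high_prob M Q"
proof -
  obtain A where A: "\<forall>n. A n \<in> sets M" "(\<lambda>n. measure M (A n)) \<longlonglongrightarrow> 1" "\<forall>n. \<forall>w\<in>A n. P n w"
    using assms(1) unfolding with_high_prob_def by blast
  have "\<forall>n. \<forall>w\<in>A n. Q n w" using A assms(2) sets.sets_into_space by blast
  with A(1,2) show ?thesis unfolding with_high_prob_def by blast
qed

context prob_space
begin

lemma with_high_prob_conj:
  assumes "with_high_prob M P" "with_high_prob M Q"
  shows "with_high_prob M (\<lambda>n w. P n w \<and> Q n w)"
proof -
  obtain A where A: "\<And>n. A n \<in> sets M" "(\<lambda>n. prob (A n)) \<longlonglongrightarrow> 1" "\<And>n w. w \<in> A n \<Longrightarrow> P n w"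
    using assms(1) unfolding with_high_prob_def by blast
  obtain B where B: "\<And>n. B n \<in> sets M" "(\<lambda>n. prob (B n)) \<longlonglongrightarrow> 1" "\<And>n w. w \<in> B n \<Longrightarrow> Q n w"
    using assms(2) unfolding with_high_prob_def by blast
  have "(\<lambda>n. prob (A n \<inter> B n)) \<longlonglongrightarrow> 1"
  proof (rule tendsto_sandwich[OF _ _ _ tendsto_const])
    have "prob (A n) + prob (B n) - 1 \<le> prob (A n \<inter> B n)" for n
      using measure_Un3[of "A n" M "B n"] A(1)[of n] B(1)[of n] prob_le_1[of "A n \<union> B n"]
      by (simp add: fmeasurable_eq_sets)
    then show "\<forall>\<^sub>F n in sequentially. prob (A n) + prob (B n) - 1 \<le> prob (A n \<inter> B n)" by simp
    show "(\<lambda>n. prob (A n) + prob (B n) - 1) \<longlonglongrightarrow> 1"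
      using tendsto_diff[OF tendsto_add[OF A(2) B(2)] tendsto_const[of 1]] by simp
  qed simp
  moreover have "A n \<inter> B n \<in> sets M" for n using A(1) B(1) by auto
  moreover have "\<forall>w\<in>A n \<inter> B n. P n w \<and> Q n w" for n using A(3) B(3) by blast
  ultimately show ?thesis unfolding with_high_prob_def by (intro exI[of _ "\<lambda>n. A n \<inter> B n"]) blast
qed

lemma with_high_prob_eventually:
  assumes "\<forall>\<^sub>F n in sequentially. P n"
  shows "with_high_prob M (\<lambda>n w. P n)"
  unfolding with_high_prob_def
proof (intro exI[of _ "\<lambda>n. if P n then space M else {}"] conjI allI ballI)
  show "(\<lambda>n. prob (if P n then space M else {})) \<longlonglongrightarrow> 1"
    using assms by (intro tendsto_eventually) (auto elim!: eventually_mono simp: prob_space)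
qed (auto split: if_splits)

lemma with_high_prob_AE:
  assumes "AE w in M. P w"
  shows "with_high_prob M (\<lambda>n. P)"
proof -
  obtain N where N: "N \<in> sets M" "emeasure M N = 0" "{w\<in>space M. \<not> P w} \<subseteq> N"
    using assms by (auto elim: AE_E)
  have "prob N = 0" using N(2) by (simp add: measure_def)
  then have "prob (space M - N) = 1" using N(1) by (simp add: prob_compl)
  then show ?thesis
    unfolding with_high_prob_def using N by (intro exI[of _ "\<lambda>_. space M - N"]) auto
qed

lemma with_high_prob_consistent_for:
  fixes Z :: "nat \<Rightarrow> 'a \<Rightarrow> 'b::{metric_space,second_countable_topology}"
  assumes "consistent_for M Z c" "\<And>n. Z n \<in> borel_measurable M" "0 < e"
  shows "with_high_prob M (\<lambda>n w. dist (Z n w) c \<le> e)"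
  unfolding with_high_prob_def
proof (intro exI[of _ "\<lambda>n. space M - {w\<in>space M. e < dist (Z n w) c}"] conjI allI ballI)
  have meas: "{w\<in>space M. e < dist (Z n w) c} \<in> sets M" for n
    using assms(2)[of n] by measurable
  then show "space M - {w\<in>space M. e < dist (Z n w) c} \<in> sets M" for n by auto
  have "(\<lambda>n. prob {w\<in>space M. e < dist (Z n w) c}) \<longlonglongrightarrow> 0"
    using assms(1,3) by (simp add: consistent_for_def)
  from tendsto_diff[OF tendsto_const[of 1] this]
  show "(\<lambda>n. prob (space M - {w\<in>space M. e < dist (Z n w) c})) \<longlonglongrightarrow> 1"
    using meas by (simp add: prob_compl)
qed auto

text \<open>One null sequence bounds all measurable events of failure at once; in this way a
  statement about inner events becomes an estimate of probabilities.\<close>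

lemma measure_le_with_high_prob:
  assumes "with_high_prob M P"
  obtains q where "q \<longlonglongrightarrow> 0" "\<And>n B. B \<in> sets M \<Longrightarrow> (\<And>w. w \<in> B \<Longrightarrow> \<not> P n w) \<Longrightarrow> prob B \<le> q n"
proof -
  obtain A where A: "\<And>n. A n \<in> sets M" "(\<lambda>n. prob (A n)) \<longlonglongrightarrow> 1" "\<And>n w. w \<in> A n \<Longrightarrow> P n w"
    using assms unfolding with_high_prob_def by blast
  show ?thesis
  proof (rule that[of "\<lambda>n. 1 - prob (A n)"])
    show "(\<lambda>n. 1 - prob (A n)) \<longlonglongrightarrow> 0"
      using tendsto_diff[OF tendsto_const[of 1] A(2)] by simp
    fix n B assume B: "B \<in> sets M" "\<And>w. w \<in> B \<Longrightarrow> \<not> P n w"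
    have "B \<subseteq> space M - A n" using B A(3) sets.sets_into_space by blast
    then have "prob B \<le> prob (space M - A n)" using A(1) by (intro finite_measure_mono) auto
    then show "prob B \<le> 1 - prob (A n)" using A(1) by (simp add: prob_compl)
  qed
qed

lemma consistent_for_with_high_prob:
  assumes "\<And>e. 0 < e \<Longrightarrow> with_high_prob M (\<lambda>n w. dist (Z n w) c \<le> e)"
  shows "consistent_for M Z c"
  unfolding consistent_for_def
proof (intro allI impI)
  fix e :: real assume "0 < e"
  obtain q where q: "q \<longlonglongrightarrow> 0"
    "\<And>n B. B \<in> sets M \<Longrightarrow> (\<And>w. w \<in> B \<Longrightarrow> \<not> dist (Z n w) c \<le> e) \<Longrightarrow> prob B \<le> q n"
    using measure_le_with_high_prob[OF assms[OF \<open>0 < e\<close>]] by metis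
  have q0: "0 \<le> q n" for n using q(2)[of "{}"] by simp
  have "prob {w\<in>space M. e < dist (Z n w) c} \<le> q n" for n
  proof (cases "{w\<in>space M. e < dist (Z n w) c} \<in> sets M")
    case True
    then show ?thesis by (rule q(2)) auto
  next
    case False
    \<comment> \<open>A set outside \<open>sets M\<close> has \<open>measure\<close> 0 by default,
      so the bound needs only that \<open>q n\<close> is nonnegative.\<close>
    then show ?thesis using q0 by (simp add: measure_notin_sets)
  qed
  then show "(\<lambda>n. prob {w\<in>space M. e < dist (Z n w) c}) \<longlonglongrightarrow> 0"
    by (intro tendsto_sandwich[OF _ _ tendsto_const q(1)]) auto
qed

lemma with_high_prob_ball_finite:
  assumes "finite I" "\<And>i. i \<in> I \<Longrightarrow> with_high_prob M (P i)"
  shows "with_high_prob M (\<lambda>n w. \<forall>i\<in>I. P i n w)"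
  using assms
proof (induction I rule: finite_induct)
  case empty
  then show ?case using with_high_prob_eventually[of "\<lambda>_. True"] by simp
next
  case (insert i I)
  have "with_high_prob M (\<lambda>n w. P i n w \<and> (\<forall>j\<in>I. P j n w))"
    using insert by (intro with_high_prob_conj) auto
  then show ?case by simp
qed

text \<open>Finitely many coordinate events hold together with high probability. The components may
  be vectors themselves, so two applications cover matrices entry by entry.\<close>

lemma consistent_for_vec:
  fixes Z :: "nat \<Rightarrow> 'a \<Rightarrow> 'b::{real_normed_vector,second_countable_topology}^'q::finite"
  assumes "\<And>i. consistent_for M (\<lambda>n w. Z n w $ i) (c $ i)"
    and "\<And>i n. (\<lambda>w. Z n w $ i) \<in> borel_measurable M"
  shows "consistent_for M Z c"
proof (rule consistent_for_with_high_prob)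
  fix e :: real assume e: "0 < e"
  let ?q = "real CARD('q)"
  have "with_high_prob M (\<lambda>n w. \<forall>i\<in>UNIV. dist (Z n w $ i) (c $ i) \<le> e / ?q)"
    using e assms by (intro with_high_prob_ball_finite with_high_prob_consistent_for) auto
  then show "with_high_prob M (\<lambda>n w. dist (Z n w) c \<le> e)"
  proof (rule with_high_prob_mono)
    fix n w assume *: "\<forall>i\<in>UNIV. dist (Z n w $ i) (c $ i) \<le> e / ?q"
    have "dist (Z n w) c \<le> (\<Sum>i\<in>UNIV. dist (Z n w $ i) (c $ i))"
      unfolding dist_vec_def by (rule L2_set_le_sum) simp
    also have "\<dots> \<le> (\<Sum>i\<in>(UNIV::'q set). e / ?q)" using * by (intro sum_mono) auto
    finally show "dist (Z n w) c \<le> e" by simp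
  qed
qed

text \<open>The cosine is Lipschitz with constant 1 and bounded by 1: where \<open>U n\<close> and
  \<open>V n\<close> are within \<open>e / 2\<close> the change is at most \<open>e / 2\<close>, and
  elsewhere it is at most 2, on an event of probability below \<open>e / 4\<close> for large
  \<open>n\<close>.\<close>

lemma expectation_cos_slutsky:
  fixes U V :: "nat \<Rightarrow> 'a \<Rightarrow> real"
  assumes [measurable]: "\<And>n. U n \<in> borel_measurable M" "\<And>n. V n \<in> borel_measurable M"
    and diff: "consistent_for M (\<lambda>n w. U n w - V n w) 0"
    and lim: "(\<lambda>n. expectation (\<lambda>w. cos (V n w + b))) \<longlonglongrightarrow> l"
  shows "(\<lambda>n. expectation (\<lambda>w. cos (U n w + b))) \<longlonglongrightarrow> l"
proof -
  have int: "integrable M (\<lambda>w. cos (U n w + b))" "integrable M (\<lambda>w. cos (V n w + b))" for n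
    by (auto intro!: integrable_const_bound[where B=1])
  have "(\<lambda>n. expectation (\<lambda>w. cos (U n w + b)) - expectation (\<lambda>w. cos (V n w + b))) \<longlonglongrightarrow> 0"
  proof (rule LIMSEQ_I)
    fix e :: real assume e: "0 < e"
    let ?B = "\<lambda>n. {w\<in>space M. e / 2 < dist (U n w - V n w) 0}"
    have "(\<lambda>n. prob (?B n)) \<longlonglongrightarrow> 0" using diff e unfolding consistent_for_def by (auto dest: spec[of _ "e / 2"])
    from order_tendstoD(2)[OF this, of "e / 4"] obtain no where no: "\<And>n. no \<le> n \<Longrightarrow> prob (?B n) < e / 4"
      using e by (auto simp: eventually_sequentially)
    have "\<bar>expectation (\<lambda>w. cos (U n w + b)) - expectation (\<lambda>w. cos (V n w + b))\<bar> < e" if "no \<le> n" for n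
    proof -
      have "\<bar>expectation (\<lambda>w. cos (U n w + b)) - expectation (\<lambda>w. cos (V n w + b))\<bar>
          = \<bar>expectation (\<lambda>w. cos (U n w + b) - cos (V n w + b))\<bar>"
        using int by simp
      also have "\<dots> \<le> expectation (\<lambda>w. \<bar>cos (U n w + b) - cos (V n w + b)\<bar>)" by (rule integral_abs_bound)
      also have "\<dots> \<le> expectation (\<lambda>w. e / 2 + 2 * indicat_real (?B n) w)"
      proof (rule integral_mono)
        show "integrable M (\<lambda>w. e / 2 + 2 * indicat_real (?B n) w)"
          by (intro Bochner_Integration.integrable_add integrable_mult_right integrable_real_indicator)
             (auto simp: emeasure_eq_measure)
        fix w assume w: "w \<in> space M"
        have "\<bar>cos (U n w + b) - cos (V n w + b)\<bar> \<le> \<bar>U n w - V n w\<bar>"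
          using cos_diff_cos[of "U n w + b" "V n w + b"] abs_sin_x_le_abs_x[of "(V n w - U n w) / 2"]
            mult_mono[of "\<bar>sin ((U n w + b + (V n w + b)) / 2)\<bar>" 1 "\<bar>sin ((V n w + b - (U n w + b)) / 2)\<bar>" "\<bar>(V n w - U n w) / 2\<bar>"]
          by (simp add: abs_mult)
        moreover have "\<bar>cos (U n w + b) - cos (V n w + b)\<bar> \<le> 2"
          using abs_cos_le_one[of "U n w + b"] abs_cos_le_one[of "V n w + b"] by linarith
        ultimately show "\<bar>cos (U n w + b) - cos (V n w + b)\<bar> \<le> e / 2 + 2 * indicat_real (?B n) w"
          using w e by (auto simp: indicator_def dist_real_def)
      qed (use int in auto)
      also have "\<dots> = e / 2 + 2 * prob (?B n)"
        by (subst Bochner_Integration.integral_add) (auto simp: prob_space emeasure_eq_measure)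
      finally show ?thesis using no[OF that] by simp
    qed
    then show "\<exists>no. \<forall>n\<ge>no. norm (expectation (\<lambda>w. cos (U n w + b)) - expectation (\<lambda>w. cos (V n w + b)) - 0) < e"
      by auto
  qed
  from tendsto_add[OF this lim] show ?thesis by simp
qed

end

section \<open>Averages of a smooth loss\<close>

text \<open>Separates the asymptotic argument from the divergence. \<open>\<psi>\<close> and
  \<open>Hs\<close> stand for the gradient and the Hessian of the loss at \<open>\<theta>0\<close>;
  third derivatives appear only through the envelope \<open>b\<close> in \<open>D_approx\<close>.
  \<open>Gd\<close> is a set of observations of probability one to which the smoothness conditions
  are restricted.\<close>

locale iid_smooth_loss = prob_space M
  for M :: "'w measure" +
  fixes \<mu> L :: "'x measure" and X :: "nat \<Rightarrow> 'w \<Rightarrow> 'x"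
    and V :: "real^'p::finite \<Rightarrow> 'x \<Rightarrow> real" and D :: "real^'p \<Rightarrow> 'x \<Rightarrow> real^'p"
    and \<psi> :: "'x \<Rightarrow> real^'p" and Hs :: "'x \<Rightarrow> real^'p^'p" and b :: "'x \<Rightarrow> real"
    and Gd :: "'x set" and \<theta>0 :: "real^'p" and r :: real and J K :: "real^'p^'p"
  assumes indep: "indep_vars (\<lambda>_. \<mu>) X UNIV" and ident: "\<And>i. distr M \<mu> (X i) = L"
    and Gd: "Gd \<in> sets \<mu>" "AE x in L. x \<in> Gd"
    and r: "0 < r"
    and V_meas: "\<And>\<theta>. \<theta> \<in> cball \<theta>0 r \<Longrightarrow> V \<theta> \<in> borel_measurable \<mu>"
    and V_deriv: "\<And>x \<theta>. x \<in> Gd \<Longrightarrow> \<theta> \<in> cball \<theta>0 r \<Longrightarrow>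
      ((\<lambda>\<theta>. V \<theta> x) has_derivative (\<lambda>v. D \<theta> x \<bullet> v)) (at \<theta>)"
    and D_approx: "\<And>x \<theta>. x \<in> Gd \<Longrightarrow> \<theta> \<in> cball \<theta>0 r \<Longrightarrow>
      norm (D \<theta> x - \<psi> x - Hs x *v (\<theta> - \<theta>0)) \<le> b x * (norm (\<theta> - \<theta>0))\<^sup>2"
    and b: "\<And>x. 0 \<le> b x" "integrable L b"
    and \<psi>_meas: "\<psi> \<in> borel_measurable \<mu>"
    and \<psi>_mean: "\<And>a. (\<integral>x. a \<bullet> \<psi> x \<partial>L) = 0"
    and \<psi>_sq: "\<And>a. integrable L (\<lambda>x. (a \<bullet> \<psi> x)\<^sup>2)"
    and \<psi>_var: "\<And>a. (\<integral>x. (a \<bullet> \<psi> x)\<^sup>2 \<partial>L) = a \<bullet> (K *v a)" and K_sym: "transpose K = K"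
    and Hs: "\<And>i j. integrable L (\<lambda>x. Hs x $ i $ j)" "\<And>i j. (\<integral>x. Hs x $ i $ j \<partial>L) = J $ i $ j"
    and J: "positive_definite J"
begin

lemma X_meas[measurable]: "X i \<in> measurable M \<mu>"
  using indep by (auto simp: indep_vars_def)

lemma sets_L[measurable_cong]: "sets L = sets \<mu>"
  unfolding ident[of 0, symmetric] by simp

lemma prob_space_L: "prob_space L"
  unfolding ident[of 0, symmetric] by (rule prob_space_distr) measurable

lemma [measurable]: "\<psi> \<in> borel_measurable \<mu>" by (rule \<psi>_meas)

lemma b_meas[measurable]: "b \<in> borel_measurable \<mu>"
  using borel_measurable_integrable[OF b(2)] by simp

lemma Hs_comp_meas[measurable]: "(\<lambda>x. Hs x $ i $ j) \<in> borel_measurable \<mu>"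
  using borel_measurable_integrable[OF Hs(1)] by simp

lemma Hs_meas[measurable]: "Hs \<in> borel_measurable \<mu>"
  by (intro borel_measurable_vecI Hs_comp_meas)

definition obj :: "nat \<Rightarrow> (nat \<Rightarrow> 'x) \<Rightarrow> real^'p \<Rightarrow> real" where
  "obj n xs \<theta> = (1 / real n) * (\<Sum>i<n. V \<theta> (xs i))"

abbreviation "sample_obj n w \<equiv> obj n (\<lambda>i\<in>{..<n}. X i w)"

definition "grad_mean n w = (1 / real n) *\<^sub>R (\<Sum>i<n. \<psi> (X i w))"
definition "hess_mean n w = (1 / real n) *\<^sub>R (\<Sum>i<n. Hs (X i w))"
definition "bound_mean n w = (\<Sum>i<n. b (X i w)) / real n"
definition "good_sample n w \<longleftrightarrow> (\<forall>i<n. X i w \<in> Gd)"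

lemma mean_meas[measurable]:
  "grad_mean n \<in> borel_measurable M" "hess_mean n \<in> borel_measurable M" "bound_mean n \<in> borel_measurable M"
  unfolding grad_mean_def hess_mean_def bound_mean_def by measurable

lemma good_sample_whp: "with_high_prob M good_sample"
proof -
  have "AE w in M. X i w \<in> Gd" for i
    using Gd(2) unfolding ident[of i, symmetric]
    by (subst (asm) AE_distr_iff) (use Gd(1) in \<open>auto simp: sets.sets_into_space[THEN subsetD] Int_def[symmetric]\<close>)
  then have "AE w in M. \<forall>i. X i w \<in> Gd" by (simp add: AE_all_countable)
  from with_high_prob_mono[OF with_high_prob_AE[OF this]] show ?thesis
    by (auto simp: good_sample_def)
qed

lemma \<psi>_integrable: "integrable L (\<lambda>x. a \<bullet> \<psi> x)"
proof -
  interpret L: prob_space L by (rule prob_space_L)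
  show ?thesis by (rule L.square_integrable_imp_integrable[OF _ \<psi>_sq]) measurable
qed

lemma grad_mean_consistent: "consistent_for M grad_mean 0"
proof (rule consistent_for_vec)
  fix i
  have "consistent_for M (\<lambda>n w. (\<Sum>k<n. axis i 1 \<bullet> \<psi> (X k w)) / real n) 0"
    using law_of_large_numbers[OF indep ident \<psi>_integrable[of "axis i 1"]] \<psi>_mean[of "axis i 1"] by simp
  then show "consistent_for M (\<lambda>n w. grad_mean n w $ i) (0 $ i)"
    by (simp add: grad_mean_def inner_axis')
qed (intro borel_measurable_vec_nth mean_meas)

lemma hess_mean_consistent: "consistent_for M hess_mean J"
proof (rule consistent_for_vec)
  fix i
  show "consistent_for M (\<lambda>n w. hess_mean n w $ i) (J $ i)"
  proof (rule consistent_for_vec)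
    fix j
    show "consistent_for M (\<lambda>n w. hess_mean n w $ i $ j) (J $ i $ j)"
      using law_of_large_numbers[OF indep ident Hs(1)[of i j]] by (simp add: hess_mean_def Hs(2))
  qed (intro borel_measurable_vec_nth mean_meas)
qed (intro borel_measurable_vec_nth mean_meas)

lemma bound_mean_consistent: "consistent_for M bound_mean (integral\<^sup>L L b)"
  using law_of_large_numbers[OF indep ident b(2)] unfolding bound_mean_def .

text \<open>The added 1 leaves room for the sample average of \<open>b\<close>, which stays below
  \<open>bound\<close> with high probability, and keeps \<open>bound\<close> away from 0.\<close>

definition "bound = integral\<^sup>L L b + 1"

lemma bound: "1 \<le> bound"
  using b(1) by (simp add: bound_def integral_nonneg_AE)

lemma bound_mean_whp: "with_high_prob M (\<lambda>n w. bound_mean n w \<le> bound)"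
  by (rule with_high_prob_mono[OF with_high_prob_consistent_for[OF bound_mean_consistent _ zero_less_one]])
     (auto simp: bound_def dist_real_def)

lemma obj_expansion:
  assumes good: "good_sample n w" and n: "0 < n"
  obtains Dn where
    "\<And>\<theta>. \<theta> \<in> cball \<theta>0 r \<Longrightarrow> (sample_obj n w has_derivative (\<lambda>v. Dn \<theta> \<bullet> v)) (at \<theta>)"
    "\<And>\<theta>. \<theta> \<in> cball \<theta>0 r \<Longrightarrow> norm (Dn \<theta> - grad_mean n w - hess_mean n w *v (\<theta> - \<theta>0))
      \<le> bound_mean n w * (norm (\<theta> - \<theta>0))\<^sup>2"
proof -
  define Dn where "Dn \<theta> = (1 / real n) *\<^sub>R (\<Sum>i<n. D \<theta> (X i w))" for \<theta>
  have Gdi: "X i w \<in> Gd" if "i < n" for i using good that by (simp add: good_sample_def)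
  show ?thesis
  proof (rule that[of Dn])
    fix \<theta> assume \<theta>: "\<theta> \<in> cball \<theta>0 r"
    have eq: "sample_obj n w = (\<lambda>\<theta>. (1 / real n) * (\<Sum>i<n. V \<theta> (X i w)))"
      by (auto simp: obj_def)
    have "((\<lambda>\<theta>. (1 / real n) * (\<Sum>i<n. V \<theta> (X i w))) has_derivative
        (\<lambda>v. (1 / real n) * (\<Sum>i<n. D \<theta> (X i w) \<bullet> v))) (at \<theta>)"
      using V_deriv[OF Gdi \<theta>] by (intro has_derivative_mult_right has_derivative_sum) auto
    then show "(sample_obj n w has_derivative (\<lambda>v. Dn \<theta> \<bullet> v)) (at \<theta>)"
      unfolding eq by (simp add: Dn_def inner_sum_left)
    have "Dn \<theta> - grad_mean n w - hess_mean n w *v (\<theta> - \<theta>0)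
        = (1 / real n) *\<^sub>R (\<Sum>i<n. D \<theta> (X i w) - \<psi> (X i w) - Hs (X i w) *v (\<theta> - \<theta>0))"
      by (simp add: Dn_def grad_mean_def hess_mean_def scaleR_matrix_vector_assoc[symmetric]
          sum_matrix_vector_mult sum_subtractf scaleR_diff_right)
    also have "norm \<dots> \<le> (1 / real n) * (\<Sum>i<n. b (X i w) * (norm (\<theta> - \<theta>0))\<^sup>2)"
    proof -
      have "norm (\<Sum>i<n. D \<theta> (X i w) - \<psi> (X i w) - Hs (X i w) *v (\<theta> - \<theta>0))
          \<le> (\<Sum>i<n. b (X i w) * (norm (\<theta> - \<theta>0))\<^sup>2)"
        by (rule sum_norm_le) (use D_approx[OF Gdi \<theta>] in auto)
      from mult_left_mono[OF this, of "1 / real n"] show ?thesis by simp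
    qed
    also have "\<dots> = bound_mean n w * (norm (\<theta> - \<theta>0))\<^sup>2"
      by (simp add: bound_mean_def sum_distrib_right)
    finally show "norm (Dn \<theta> - grad_mean n w - hess_mean n w *v (\<theta> - \<theta>0))
      \<le> bound_mean n w * (norm (\<theta> - \<theta>0))\<^sup>2" .
  qed
qed

text \<open>The event does not depend on the point \<open>\<theta>\<close>: on it every point of the
  ball that does at least as well as \<open>\<theta>0\<close> is close to \<open>\<theta>0\<close>.
  A minimizer chosen from the sample may therefore be inserted.\<close>

lemma obj_local_bound:
  obtains c \<rho> where "0 < c" "0 < \<rho>" "\<rho> \<le> r"
    "with_high_prob M (\<lambda>n w. \<forall>\<theta>\<in>cball \<theta>0 \<rho>. sample_obj n w \<theta> \<le> sample_obj n w \<theta>0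
      \<longrightarrow> norm (\<theta> - \<theta>0) \<le> c * norm (grad_mean n w))"
proof -
  obtain c where c: "0 < c" "\<And>v. c * (norm v)\<^sup>2 \<le> v \<bullet> (J *v v)"
    using positive_definite_inner_ge[OF J] by blast
  \<comment> \<open>The radius makes the cubic remainder at most an eighth of the coercivity
    constant, as the quadratic comparison requires.\<close>
  define \<rho> where "\<rho> = min r (c / (8 * bound))"
  have \<rho>: "0 < \<rho>" "\<rho> \<le> r" "bound * \<rho> \<le> c / 8"
    using r c bound by (auto simp: \<rho>_def min_def field_simps)
  have "with_high_prob M (\<lambda>n w. (good_sample n w \<and> 0 < n) \<and> (dist (hess_mean n w) J \<le> c / 4 \<and> bound_mean n w \<le> bound))"
    using c(1) by (intro with_high_prob_conj good_sample_whp bound_mean_whp with_high_prob_eventually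
        eventually_gt_at_top with_high_prob_consistent_for[OF hess_mean_consistent]) auto
  then have "with_high_prob M (\<lambda>n w. \<forall>\<theta>\<in>cball \<theta>0 \<rho>. sample_obj n w \<theta> \<le> sample_obj n w \<theta>0
      \<longrightarrow> norm (\<theta> - \<theta>0) \<le> 4 / c * norm (grad_mean n w))"
  proof (rule with_high_prob_mono, intro ballI impI)
    fix n w \<theta>
    assume *: "(good_sample n w \<and> 0 < n) \<and> (dist (hess_mean n w) J \<le> c / 4 \<and> bound_mean n w \<le> bound)"
      and \<theta>: "\<theta> \<in> cball \<theta>0 \<rho>" and le: "sample_obj n w \<theta> \<le> sample_obj n w \<theta>0"
    have sub: "\<theta>' \<in> cball \<theta>0 r" if "\<theta>' \<in> cball \<theta>0 \<rho>" for \<theta>' using that \<rho>(2) by auto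
    obtain Dn where Dn: "\<And>\<theta>. \<theta> \<in> cball \<theta>0 r \<Longrightarrow> (sample_obj n w has_derivative (\<lambda>v. Dn \<theta> \<bullet> v)) (at \<theta>)"
      "\<And>\<theta>. \<theta> \<in> cball \<theta>0 r \<Longrightarrow> norm (Dn \<theta> - grad_mean n w - hess_mean n w *v (\<theta> - \<theta>0))
        \<le> bound_mean n w * (norm (\<theta> - \<theta>0))\<^sup>2"
      using obj_expansion[of n w] * by metis
    have bn: "0 \<le> bound_mean n w" using b(1) by (simp add: bound_mean_def sum_nonneg)
    show "norm (\<theta> - \<theta>0) \<le> 4 / c * norm (grad_mean n w)"
    proof (rule norm_le_of_quadratic_lower_bound[OF Dn(1) Dn(2) \<theta> le c])
      show "norm (hess_mean n w - J) \<le> c / 4" using * by (simp add: dist_norm)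
      show "bound_mean n w * \<rho> \<le> c / 8"
        using * order_trans[OF mult_right_mono[of "bound_mean n w" bound \<rho>] \<rho>(3)] \<rho>(1) by auto
    qed (use sub bn in auto)
  qed
  then show ?thesis using c \<rho> by (intro that[of "4 / c" \<rho>]) auto
qed

section \<open>Fluctuations of the scaled gradient mean\<close>

lemma sum_norm_sq: "integrable M (\<lambda>w. (a \<bullet> (sqrt (real n) *\<^sub>R grad_mean n w))\<^sup>2)"
  "0 < n \<Longrightarrow> expectation (\<lambda>w. (a \<bullet> (sqrt (real n) *\<^sub>R grad_mean n w))\<^sup>2) = a \<bullet> (K *v a)"
proof -
  let ?Y = "\<lambda>i w. a \<bullet> \<psi> (X i w)"
  have ind: "indep_vars (\<lambda>_. borel) ?Y UNIV"
    by (rule indep_vars_compose2[OF indep]) measurable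
  have sq: "integrable M (\<lambda>w. (?Y i w)\<^sup>2)" for i
    using \<psi>_sq[of a] unfolding ident[of i, symmetric] by (subst (asm) integrable_distr_eq) auto
  have mean: "expectation (?Y i) = 0" for i
    using \<psi>_mean[of a] unfolding ident[of i, symmetric] by (subst (asm) integral_distr) auto
  have var: "expectation (\<lambda>w. (?Y i w)\<^sup>2) = a \<bullet> (K *v a)" for i
    using \<psi>_var[of a] unfolding ident[of i, symmetric] by (subst (asm) integral_distr) auto
  note vs = variance_sum_iid[OF ind sq mean var, of n]
  have eq: "(a \<bullet> (sqrt (real n) *\<^sub>R grad_mean n w))\<^sup>2 = (\<Sum>i<n. ?Y i w - 0)\<^sup>2 / real n" for w
  proof -
    have "a \<bullet> (sqrt (real n) *\<^sub>R grad_mean n w) = sqrt (real n) / real n * (\<Sum>i<n. ?Y i w)"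
      by (simp add: grad_mean_def inner_sum_right)
    then have "(a \<bullet> (sqrt (real n) *\<^sub>R grad_mean n w))\<^sup>2 = (sqrt (real n))\<^sup>2 / (real n)\<^sup>2 * (\<Sum>i<n. ?Y i w)\<^sup>2"
      by (simp only: power_mult_distrib power_divide)
    then show ?thesis by (simp add: power2_eq_square[of "real n"])
  qed
  show "integrable M (\<lambda>w. (a \<bullet> (sqrt (real n) *\<^sub>R grad_mean n w))\<^sup>2)"
    unfolding eq using vs(1) by simp
  show "expectation (\<lambda>w. (a \<bullet> (sqrt (real n) *\<^sub>R grad_mean n w))\<^sup>2) = a \<bullet> (K *v a)" if "0 < n"
    unfolding eq using vs(2) that by simp
qed

text \<open>Markov's inequality for the squared norm, whose expectation is the trace of
  \<open>K\<close> for every positive \<open>n\<close>; the radius does not depend on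
  \<open>n\<close>.\<close>

lemma scaled_grad_mean_tight:
  assumes "0 < e"
  obtains R where "0 < R" "\<And>n. 0 < n \<Longrightarrow> prob {w\<in>space M. R < norm (sqrt (real n) *\<^sub>R grad_mean n w)} \<le> e"
proof -
  define T where "T = (\<Sum>i\<in>UNIV. K $ i $ i)"
  \<comment> \<open>Chosen so that the trace \<open>T\<close> divided by the square of
    \<open>R\<close> is at most \<open>e\<close>; the absolute value and the 1 make \<open>R\<close>
    positive without information on the sign of \<open>T\<close>.\<close>
  define R where "R = sqrt ((\<bar>T\<bar> + 1) / e)"
  have R: "0 < R" "R\<^sup>2 = (\<bar>T\<bar> + 1) / e" using assms by (auto simp: R_def)
  have "prob {w\<in>space M. R < norm (sqrt (real n) *\<^sub>R grad_mean n w)} \<le> e" if n: "0 < n" for n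
  proof -
    let ?S = "\<lambda>w. sqrt (real n) *\<^sub>R grad_mean n w"
    have eq: "(norm (?S w))\<^sup>2 = (\<Sum>i\<in>UNIV. (axis i 1 \<bullet> ?S w)\<^sup>2)" for w
      by (simp only: inner_axis' power2_norm_eq_inner) (simp add: inner_vec_def power2_eq_square)
    have int: "integrable M (\<lambda>w. (norm (?S w))\<^sup>2)"
      unfolding eq by (intro Bochner_Integration.integrable_sum sum_norm_sq(1))
    have exp: "expectation (\<lambda>w. (norm (?S w))\<^sup>2) = T"
      unfolding eq T_def using n
      by (subst Bochner_Integration.integral_sum) (auto simp del: inner_scaleR_right simp: sum_norm_sq inner_matrix_axis)
    have "prob {w\<in>space M. R < norm (?S w)} \<le> prob {w\<in>space M. R\<^sup>2 \<le> (norm (?S w))\<^sup>2}"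
      using R(1) by (intro finite_measure_mono) (auto intro!: power_mono simp del: norm_scaleR)
    also have "\<dots> \<le> expectation (\<lambda>w. (norm (?S w))\<^sup>2) / R\<^sup>2"
      using int R(1) by (intro integral_Markov_inequality_measure[where A="{}"]) auto
    also have "\<dots> \<le> e"
    proof -
      have "T * e \<le> (\<bar>T\<bar> + 1) * e" using assms by (intro mult_right_mono) auto
      then show ?thesis unfolding exp R(2) using assms by (simp add: field_simps)
    qed
    finally show ?thesis .
  qed
  with R(1) show ?thesis by (rule that)
qed

lemma scaled_grad_mean_clt:
  "(\<lambda>n. expectation (\<lambda>w. cos (a \<bullet> (sqrt (real n) *\<^sub>R grad_mean n w) + c)))
    \<longlonglongrightarrow> (\<integral>y. cos (y + c) \<partial>normal_law 0 (a \<bullet> (K *v a)))"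
proof -
  let ?Y = "\<lambda>i w. a \<bullet> \<psi> (X i w)"
  define Dd where "Dd = distr L borel (\<lambda>x. a \<bullet> \<psi> x)"
  have ind: "indep_vars (\<lambda>_. borel) ?Y UNIV"
    by (rule indep_vars_compose2[OF indep]) measurable
  have id: "distr M borel (?Y i) = Dd" for i
    unfolding Dd_def ident[of i, symmetric] by (subst distr_distr) (auto simp: comp_def)
  have "(\<lambda>n. expectation (\<lambda>w. cos ((\<Sum>i<n. ?Y i w) / sqrt (real n) + c)))
      \<longlonglongrightarrow> (\<integral>y. cos (y + c) \<partial>normal_law 0 (a \<bullet> (K *v a)))"
  proof (rule clt_projection[where B=1 and \<phi>="\<lambda>y. cos (y + c)", OF ind id])
    show "(\<integral>y. y \<partial>Dd) = 0" unfolding Dd_def by (subst integral_distr) (auto simp: \<psi>_mean)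
    show "integrable Dd (\<lambda>y. y\<^sup>2)" unfolding Dd_def by (subst integrable_distr_eq) (auto simp: \<psi>_sq)
    show "(\<integral>y. y\<^sup>2 \<partial>Dd) = a \<bullet> (K *v a)" unfolding Dd_def by (subst integral_distr) (auto simp: \<psi>_var)
  qed (auto intro!: continuous_intros)
  moreover have "a \<bullet> (sqrt (real n) *\<^sub>R grad_mean n w) = (\<Sum>i<n. ?Y i w) / sqrt (real n)" for n w
    by (cases "n = 0") (simp_all add: grad_mean_def inner_sum_right field_simps)
  ultimately show ?thesis by simp
qed

end

section \<open>Constrained minimizers of an averaged loss\<close>

locale constrained_iid_loss = iid_smooth_loss M \<mu> L X V D \<psi> Hs b Gd \<theta>0 r J K
  for M :: "'w measure" and \<mu> L :: "'x measure" and X V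
    and D :: "real^'p::finite \<Rightarrow> 'x \<Rightarrow> real^'p" and \<psi> Hs b Gd \<theta>0 r J K +
  fixes \<Theta> :: "(real^'p) set" and g :: "real^'p \<Rightarrow> real^'r::finite" and Gf :: "real^'p \<Rightarrow> real^'r^'p"
  assumes cball_subset: "cball \<theta>0 r \<subseteq> \<Theta>" and g0: "g \<theta>0 = 0"
    and g_deriv: "\<And>\<theta>. \<theta> \<in> cball \<theta>0 r \<Longrightarrow> (g has_derivative (\<lambda>v. transpose (Gf \<theta>) *v v)) (at \<theta>)"
    and Gf_cont: "isCont Gf \<theta>0"
    and Gf_inj: "\<And>\<theta>. \<theta> \<in> cball \<theta>0 r \<Longrightarrow> inj ((*v) (Gf \<theta>))"
begin

sublocale cq: constrained_quadratic J "Gf \<theta>0"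
  using J Gf_inj r by unfold_locales auto

definition restricted_estimator :: "(nat \<Rightarrow> (nat \<Rightarrow> 'x) \<Rightarrow> real^'p) \<Rightarrow> bool" where
  "restricted_estimator t \<longleftrightarrow> estimator \<mu> t \<and>
    with_high_prob M (\<lambda>n w. local_minimizer_on (sample_obj n w) (constrained_set \<Theta> g) (at_sample X t n w))"

lemma at_sample_measurable:
  assumes "estimator \<mu> t"
  shows "at_sample X t n \<in> borel_measurable M"
proof -
  have "(\<lambda>w. \<lambda>i\<in>{..<n}. X i w) \<in> measurable M (\<Pi>\<^sub>M i\<in>{..<n}. \<mu>)"
    by (intro measurable_restrict) measurable
  moreover have "t n \<in> borel_measurable (\<Pi>\<^sub>M i\<in>{..<n}. \<mu>)" using assms by (simp add: estimator_def)
  ultimately show ?thesis unfolding at_sample_def by (rule measurable_compose)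
qed

text \<open>The minimization runs over a compact piece of the constraint set, where a minimizer
  exists for each sample, and on the product space, so that the result is a function of the first
  \<open>n\<close> observations alone.\<close>

lemma measurable_argmin_estimator:
  assumes "\<rho> \<le> r" "0 < \<rho>"
  obtains t where "estimator \<mu> t"
    "\<And>n w. good_sample n w \<Longrightarrow> w \<in> space M \<Longrightarrow>
      minimizer_on (sample_obj n w) (cball \<theta>0 \<rho> \<inter> {\<theta>. g \<theta> = 0}) (at_sample X t n w)"
proof -
  let ?C = "cball \<theta>0 \<rho> \<inter> {\<theta>. g \<theta> = 0}" and ?N = "\<lambda>n. \<Pi>\<^sub>M i\<in>{..<n}. \<mu>"
  have sub: "cball \<theta>0 \<rho> \<subseteq> cball \<theta>0 r" using assms by auto
  have "continuous_on (cball \<theta>0 \<rho>) g"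
    using g_deriv sub by (meson continuous_at_imp_continuous_on has_derivative_continuous subsetD)
  then have "closed (cball \<theta>0 \<rho> \<inter> g -` {0})" by (intro continuous_closed_preimage) auto
  moreover have "cball \<theta>0 \<rho> \<inter> g -` {0} = ?C" by auto
  ultimately have "closed ?C" by simp
  then have C: "compact ?C" by (metis compact_Int_closed compact_cball Int_assoc Int_absorb)
  have C0: "?C \<noteq> {}"
  proof -
    have "\<theta>0 \<in> ?C" using g0 assms by simp
    then show ?thesis by blast
  qed
  \<comment> \<open>Continuity in \<open>\<theta>\<close> is known only if all observations lie in
    \<open>Gd\<close>. Replacing the objective by 0 at other samples gives a function continuous in
    \<open>\<theta>\<close> and measurable in the sample everywhere.\<close>
  define H where "H n xs \<theta> = (if \<forall>i<n. xs i \<in> Gd then obj n xs \<theta> else 0)" for n xs \<theta>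
  have "\<exists>t. t \<in> borel_measurable (?N n) \<and> (\<forall>xs\<in>space (?N n). minimizer_on (H n xs) ?C (t xs))" for n
  proof -
    have cont: "continuous_on ?C (H n xs)" for xs
    proof (cases "\<forall>i<n. xs i \<in> Gd")
      case True
      have "continuous_on ?C (\<lambda>\<theta>. V \<theta> (xs i))" if "i < n" for i
      proof (intro continuous_at_imp_continuous_on ballI)
        fix \<theta> assume "\<theta> \<in> ?C"
        then have "\<theta> \<in> cball \<theta>0 r" using sub by auto
        from V_deriv[OF _ this] show "isCont (\<lambda>\<theta>. V \<theta> (xs i)) \<theta>"
          using True that has_derivative_continuous by blast
      qed
      then have "continuous_on ?C (obj n xs)"
        unfolding obj_def by (intro continuous_intros) auto
      then show ?thesis using True by (simp add: H_def)
    next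
      case False
      then have "H n xs \<theta> = 0" for \<theta> by (simp only: H_def if_False)
      then have "H n xs = (\<lambda>_. 0)" by (rule ext)
      then show ?thesis by simp
    qed
    have meas: "(\<lambda>xs. H n xs \<theta>) \<in> borel_measurable (?N n)" if "\<theta> \<in> ?C" for \<theta>
    proof -
      have [measurable]: "V \<theta> \<in> borel_measurable \<mu>" using that sub by (intro V_meas) auto
      have [measurable]: "Gd \<in> sets \<mu>" by (rule Gd(1))
      have comp: "(\<lambda>xs. V \<theta> (xs i)) \<in> borel_measurable (?N n)" if "i < n" for i
        using that by (intro measurable_compose[OF measurable_component_singleton]) auto
      have "(\<lambda>xs. obj n xs \<theta>) \<in> borel_measurable (?N n)"
        unfolding obj_def by (intro borel_measurable_times borel_measurable_const borel_measurable_sum comp) auto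
      moreover have "{xs\<in>space (?N n). \<forall>i\<in>{..<n}. xs i \<in> Gd} \<in> sets (?N n)"
      proof (rule sets.sets_Collect_finite_All)
        fix i assume "i \<in> {..<n}"
        then have "(\<lambda>xs. xs i) \<in> measurable (?N n) \<mu>" by (rule measurable_component_singleton)
        from measurable_sets[OF this Gd(1)] show "{xs\<in>space (?N n). xs i \<in> Gd} \<in> sets (?N n)"
          by (simp add: vimage_def Int_def conj_commute)
      qed auto
      ultimately show ?thesis
        unfolding H_def by (intro measurable_If) auto
    qed
    obtain t where "t \<in> borel_measurable (?N n)" "\<And>xs. xs \<in> space (?N n) \<Longrightarrow> minimizer_on (H n xs) ?C (t xs)"
      using measurable_minimizer_on[OF C C0, of "?N n" "H n"] cont meas by blast
    then show ?thesis by blast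
  qed
  then obtain t where t: "\<And>n. t n \<in> borel_measurable (?N n)"
    "\<And>n xs. xs \<in> space (?N n) \<Longrightarrow> minimizer_on (H n xs) ?C (t n xs)" by metis
  show ?thesis
  proof (rule that)
    show "estimator \<mu> t" using t(1) by (simp add: estimator_def)
    fix n w assume good: "good_sample n w" and w: "w \<in> space M"
    have xs: "(\<lambda>i\<in>{..<n}. X i w) \<in> space (?N n)"
      using w measurable_space[OF X_meas] by (auto simp: space_PiM)
    show "minimizer_on (sample_obj n w) ?C (at_sample X t n w)"
    proof -
      have "H n (\<lambda>i\<in>{..<n}. X i w) \<theta> = sample_obj n w \<theta>" for \<theta>
        using good by (simp add: H_def good_sample_def)
      then have "H n (\<lambda>i\<in>{..<n}. X i w) = sample_obj n w" by (rule ext)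
      with t(2)[OF xs] show ?thesis by (simp add: at_sample_def)
    qed
  qed
qed

theorem restricted_estimator_exists:
  "\<exists>t. restricted_estimator t \<and> consistent_for M (at_sample X t) \<theta>0"
proof -
  obtain c \<rho> where c: "0 < c" and \<rho>: "0 < \<rho>" "\<rho> \<le> r"
    and loc: "with_high_prob M (\<lambda>n w. \<forall>\<theta>\<in>cball \<theta>0 \<rho>. sample_obj n w \<theta> \<le> sample_obj n w \<theta>0
      \<longrightarrow> norm (\<theta> - \<theta>0) \<le> c * norm (grad_mean n w))"
    using obj_local_bound .
  obtain t where t: "estimator \<mu> t"
    "\<And>n w. good_sample n w \<Longrightarrow> w \<in> space M \<Longrightarrow>
      minimizer_on (sample_obj n w) (cball \<theta>0 \<rho> \<inter> {\<theta>. g \<theta> = 0}) (at_sample X t n w)"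
    using measurable_argmin_estimator[OF \<rho>(2,1)] by blast
  have near: "with_high_prob M (\<lambda>n w. good_sample n w \<and> dist (at_sample X t n w) \<theta>0 \<le> e)" if e: "0 < e" for e
  proof -
    have "with_high_prob M (\<lambda>n w. good_sample n w \<and> (dist (grad_mean n w) 0 \<le> e / c \<and>
      (\<forall>\<theta>\<in>cball \<theta>0 \<rho>. sample_obj n w \<theta> \<le> sample_obj n w \<theta>0
      \<longrightarrow> norm (\<theta> - \<theta>0) \<le> c * norm (grad_mean n w))))"
      using e c by (intro with_high_prob_conj good_sample_whp loc
          with_high_prob_consistent_for[OF grad_mean_consistent]) auto
    then show ?thesis
    proof (rule with_high_prob_mono)
      fix n w
      assume w: "w \<in> space M" and *: "good_sample n w \<and> (dist (grad_mean n w) 0 \<le> e / c \<and>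
      (\<forall>\<theta>\<in>cball \<theta>0 \<rho>. sample_obj n w \<theta> \<le> sample_obj n w \<theta>0
      \<longrightarrow> norm (\<theta> - \<theta>0) \<le> c * norm (grad_mean n w)))"
      have min: "minimizer_on (sample_obj n w) (cball \<theta>0 \<rho> \<inter> {\<theta>. g \<theta> = 0}) (at_sample X t n w)"
        using t(2) * w by blast
      \<comment> \<open>The true parameter is a competitor in the restricted minimization, so the
        minimizer satisfies the premise of the local bound.\<close>
      have "\<theta>0 \<in> cball \<theta>0 \<rho> \<inter> {\<theta>. g \<theta> = 0}" using g0 \<rho> by auto
      with min have "at_sample X t n w \<in> cball \<theta>0 \<rho>"
        "sample_obj n w (at_sample X t n w) \<le> sample_obj n w \<theta>0"
        unfolding minimizer_on_def by blast+
      then have "norm (at_sample X t n w - \<theta>0) \<le> c * norm (grad_mean n w)" using * by blast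
      also have "\<dots> \<le> c * (e / c)" using * c by (intro mult_left_mono) auto
      finally show "good_sample n w \<and> dist (at_sample X t n w) \<theta>0 \<le> e"
        using * c by (simp add: dist_norm)
    qed
  qed
  have "with_high_prob M (\<lambda>n w. local_minimizer_on (sample_obj n w) (constrained_set \<Theta> g) (at_sample X t n w))"
  \<comment> \<open>Half the radius keeps the estimate in the open ball; that ball is the
    neighbourhood witnessing a local minimum over the whole constraint set.\<close>
  proof (rule with_high_prob_mono[OF near[of "\<rho> / 2"]])
    fix n w assume w: "w \<in> space M" and *: "good_sample n w \<and> dist (at_sample X t n w) \<theta>0 \<le> \<rho> / 2"
    have min: "minimizer_on (sample_obj n w) (cball \<theta>0 \<rho> \<inter> {\<theta>. g \<theta> = 0}) (at_sample X t n w)"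
      using t(2) * w by blast
    have in_ball: "at_sample X t n w \<in> ball \<theta>0 \<rho>" using * \<rho> by (simp add: dist_commute)
    have "constrained_set \<Theta> g \<inter> ball \<theta>0 \<rho> \<subseteq> cball \<theta>0 \<rho> \<inter> {\<theta>. g \<theta> = 0}"
      by (auto simp: constrained_set_def)
    moreover have "at_sample X t n w \<in> constrained_set \<Theta> g \<inter> ball \<theta>0 \<rho>"
      using min in_ball cball_subset \<rho>(2) by (auto simp: constrained_set_def minimizer_on_def)
    ultimately have "minimizer_on (sample_obj n w) (constrained_set \<Theta> g \<inter> ball \<theta>0 \<rho>) (at_sample X t n w)"
      using min unfolding minimizer_on_def by blast
    then show "local_minimizer_on (sample_obj n w) (constrained_set \<Theta> g) (at_sample X t n w)"
      unfolding local_minimizer_on_def using in_ball by (intro exI[of _ "ball \<theta>0 \<rho>"]) auto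
  qed (use \<rho> in auto)
  moreover have "consistent_for M (at_sample X t) \<theta>0"
    by (rule consistent_for_with_high_prob, rule with_high_prob_mono[OF near]) auto
  ultimately show ?thesis using t(1) by (auto simp: restricted_estimator_def)
qed

text \<open>The error is relative to the gradient mean, not to the distance of the estimate, so
  tightness of the scaled gradient suffices afterwards. The estimate is an arbitrary consistent one,
  not the one constructed above.\<close>

lemma estimator_expansion_whp:
  assumes t: "restricted_estimator t" "consistent_for M (at_sample X t) \<theta>0" and e: "0 < e"
  shows "with_high_prob M (\<lambda>n w. norm (at_sample X t n w - \<theta>0 + cq.P *v grad_mean n w) \<le> e * norm (grad_mean n w))"
proof -
  have est: "estimator \<mu> t" using t(1) by (simp add: restricted_estimator_def)
  have \<theta>0: "\<theta>0 \<in> cball \<theta>0 r" using r by simp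
  obtain \<delta> where \<delta>: "0 < \<delta>"
    "\<And>t y s l. norm (t - \<theta>0) < \<delta> \<Longrightarrow> g t = 0 \<Longrightarrow> y = Gf t *v l \<Longrightarrow>
      norm (y - s - J *v (t - \<theta>0)) \<le> \<delta> * norm (t - \<theta>0) \<Longrightarrow>
      norm (t - \<theta>0 + cq.P *v s) \<le> e * norm s"
    using cq.constrained_critical_point_expansion[OF g_deriv[OF \<theta>0] g0 Gf_cont refl e] by blast
  \<comment> \<open>The first entry makes the second-order remainder at most
    \<open>\<delta> / 2\<close> times the distance, the other half of \<open>\<delta>\<close> being
    spent on the Hessian mean. The remaining entries keep the estimate within
    \<open>\<delta>\<close> and in the open ball of radius \<open>r\<close>.\<close>
  define \<eta> where "\<eta> = min (\<delta> / (2 * bound)) (min (\<delta> / 2) (r / 2))"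
  have \<eta>: "0 < \<eta>" "\<eta> < \<delta>" "\<eta> < r" "bound * \<eta> \<le> \<delta> / 2"
  proof -
    show "0 < \<eta>" "\<eta> < \<delta>" "\<eta> < r" using \<delta>(1) r bound by (auto simp: \<eta>_def)
    have "bound * \<eta> \<le> bound * (\<delta> / (2 * bound))" using bound by (intro mult_left_mono) (auto simp: \<eta>_def)
    then show "bound * \<eta> \<le> \<delta> / 2" using bound by simp
  qed
  have "with_high_prob M (\<lambda>n w. (good_sample n w \<and> 0 < n) \<and> (dist (hess_mean n w) J \<le> \<delta> / 2 \<and> bound_mean n w \<le> bound)
    \<and> dist (at_sample X t n w) \<theta>0 \<le> \<eta> \<and>
    local_minimizer_on (sample_obj n w) (constrained_set \<Theta> g) (at_sample X t n w))"
    using t \<delta>(1) \<eta>(1) unfolding restricted_estimator_def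
    by (intro with_high_prob_conj good_sample_whp bound_mean_whp with_high_prob_eventually
        eventually_gt_at_top with_high_prob_consistent_for[OF hess_mean_consistent]
        with_high_prob_consistent_for[OF t(2)] at_sample_measurable est) auto
  then show ?thesis
  proof (rule with_high_prob_mono)
    fix n w
    define \<theta> where "\<theta> = at_sample X t n w"
    let ?F = "sample_obj n w"
    assume "(good_sample n w \<and> 0 < n) \<and> (dist (hess_mean n w) J \<le> \<delta> / 2 \<and> bound_mean n w \<le> bound)
      \<and> dist (at_sample X t n w) \<theta>0 \<le> \<eta> \<and>
      local_minimizer_on (sample_obj n w) (constrained_set \<Theta> g) (at_sample X t n w)"
    then have good: "good_sample n w" "0 < n" and hess: "norm (hess_mean n w - J) \<le> \<delta> / 2"
      and bn: "bound_mean n w \<le> bound" and near: "norm (\<theta> - \<theta>0) \<le> \<eta>"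
      and min: "local_minimizer_on ?F (constrained_set \<Theta> g) \<theta>"
      by (auto simp: \<theta>_def dist_norm)
    obtain Dn where Dn: "\<And>\<theta>. \<theta> \<in> cball \<theta>0 r \<Longrightarrow> (?F has_derivative (\<lambda>v. Dn \<theta> \<bullet> v)) (at \<theta>)"
      "\<And>\<theta>. \<theta> \<in> cball \<theta>0 r \<Longrightarrow> norm (Dn \<theta> - grad_mean n w - hess_mean n w *v (\<theta> - \<theta>0))
        \<le> bound_mean n w * (norm (\<theta> - \<theta>0))\<^sup>2"
      using obj_expansion[OF good] by blast
    have \<theta>b: "\<theta> \<in> ball \<theta>0 r" using near \<eta>(3) by (simp add: dist_norm norm_minus_commute)
    then have \<theta>c: "\<theta> \<in> cball \<theta>0 r" by simp
    obtain U where U: "open U" "\<theta> \<in> U" "\<theta> \<in> constrained_set \<Theta> g"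
      "\<And>s. s \<in> constrained_set \<Theta> g \<inter> U \<Longrightarrow> ?F \<theta> \<le> ?F s"
      using min unfolding local_minimizer_on_def minimizer_on_def by blast
    have g\<theta>: "g \<theta> = 0" using U(3) by (simp add: constrained_set_def)
    \<comment> \<open>The neighbourhood of local minimality is cut down to the ball on which the
      objective and the constraint are known to be continuous.\<close>
    let ?U = "U \<inter> ball \<theta>0 r"
    have subU: "s \<in> cball \<theta>0 r" if "s \<in> ?U" for s using that by auto
    obtain l where l: "\<And>v. Dn \<theta> \<bullet> v = l \<bullet> (transpose (Gf \<theta>) *v v)"
    proof (rule lagrange_multiplier[where U="?U" and F="?F" and g=g and t=\<theta>])
      show "open ?U" using U(1) by auto
      show "\<theta> \<in> ?U" using U(2) \<theta>b by auto
      show "continuous_on ?U ?F"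
        using Dn(1)[OF subU] has_derivative_continuous continuous_at_imp_continuous_on by blast
      show "continuous_on ?U g"
        using g_deriv[OF subU] has_derivative_continuous continuous_at_imp_continuous_on by blast
      show "(?F has_derivative (\<lambda>v. Dn \<theta> \<bullet> v)) (at \<theta>)" by (rule Dn(1)[OF \<theta>c])
      show "(g has_derivative (\<lambda>v. transpose (Gf \<theta>) *v v)) (at \<theta>)" by (rule g_deriv[OF \<theta>c])
      show "surj ((*v) (transpose (Gf \<theta>)))"
        using Gf_inj[OF \<theta>c]
        by (metis full_rank_injective full_rank_surjective rank_transpose)
      show "g \<theta> = 0" by (rule g\<theta>)
      show "?F \<theta> \<le> ?F s" if "s \<in> ?U" "g s = 0" for s
      proof (rule U(4))
        have "s \<in> \<Theta>" using subU[OF that(1)] cball_subset by blast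
        then show "s \<in> constrained_set \<Theta> g \<inter> U" using that by (simp add: constrained_set_def)
      qed
    qed (rule that)
    have y: "Dn \<theta> = Gf \<theta> *v l"
    proof -
      have "Dn \<theta> \<bullet> v = (Gf \<theta> *v l) \<bullet> v" for v
        using l[of v] inner_transpose_mult[of l "transpose (Gf \<theta>)" v] by simp
      then show ?thesis by (metis vector_eq_rdot)
    qed
    have lin: "norm (Dn \<theta> - grad_mean n w - J *v (\<theta> - \<theta>0)) \<le> \<delta> * norm (\<theta> - \<theta>0)"
    proof -
      let ?d = "\<theta> - \<theta>0"
      have "Dn \<theta> - grad_mean n w - J *v ?d = (Dn \<theta> - grad_mean n w - hess_mean n w *v ?d) + (hess_mean n w - J) *v ?d"
        by (simp add: matrix_vector_mult_diff_rdistrib)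
      then have "norm (Dn \<theta> - grad_mean n w - J *v ?d) \<le> norm (Dn \<theta> - grad_mean n w - hess_mean n w *v ?d)
          + norm ((hess_mean n w - J) *v ?d)"
        by (metis norm_triangle_ineq)
      also have "\<dots> \<le> bound_mean n w * (norm ?d)\<^sup>2 + norm (hess_mean n w - J) * norm ?d"
        by (intro add_mono Dn(2)[OF \<theta>c] norm_matrix_vector_mult_le)
      also have "\<dots> \<le> bound * (norm ?d)\<^sup>2 + \<delta> / 2 * norm ?d"
        using hess bn by (intro add_mono mult_right_mono) auto
      also have "bound * (norm ?d)\<^sup>2 = bound * norm ?d * norm ?d" by (simp add: power2_eq_square)
      also have "\<dots> \<le> \<delta> / 2 * norm ?d"
        using near bound order_trans[OF mult_left_mono[OF near] \<eta>(4)] by (intro mult_right_mono) auto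
      finally show ?thesis by (simp add: algebra_simps)
    qed
    show "norm (at_sample X t n w - \<theta>0 + cq.P *v grad_mean n w) \<le> e * norm (grad_mean n w)"
      using \<delta>(2)[OF _ g\<theta> y lin] near \<eta>(2) by (simp add: \<theta>_def)
  qed
qed

text \<open>Off an event of small probability the scaled gradient is at most \<open>R\<close>. The
  expansion with relative error \<open>\<epsilon> / R\<close> then bounds the scaled remainder by
  \<open>\<epsilon>\<close>.\<close>

lemma scaled_expansion_consistent:
  assumes t: "restricted_estimator t" "consistent_for M (at_sample X t) \<theta>0"
  shows "consistent_for M (\<lambda>n w. sqrt (real n) *\<^sub>R (at_sample X t n w - \<theta>0)
    + cq.P *v (sqrt (real n) *\<^sub>R grad_mean n w)) 0"
  unfolding consistent_for_def
proof (intro allI impI)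
  fix \<epsilon> :: real assume \<epsilon>: "0 < \<epsilon>"
  let ?R = "\<lambda>n w. sqrt (real n) *\<^sub>R (at_sample X t n w - \<theta>0) + cq.P *v (sqrt (real n) *\<^sub>R grad_mean n w)"
  have R_eq: "?R n w = sqrt (real n) *\<^sub>R (at_sample X t n w - \<theta>0 + cq.P *v grad_mean n w)" for n w
    by (simp add: scaleR_add_right matrix_vector_mult_scaleR)
  let ?B = "\<lambda>n. {w\<in>space M. \<epsilon> < dist (?R n w) 0}"
  have [measurable]: "at_sample X t n \<in> borel_measurable M" for n
    using t(1) by (intro at_sample_measurable) (simp add: restricted_estimator_def)
  have Pm[measurable]: "(\<lambda>w. A *v grad_mean n w) \<in> borel_measurable M" for A :: "real^'p^'p" and n
    by (rule measurable_compose[OF mean_meas(1) borel_measurable_continuous_onI])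
       (intro linear_continuous_on linear_linear[THEN iffD2] matrix_vector_mul_linear)
  have B_meas: "?B n \<in> sets M" for n unfolding R_eq by measurable
  show "(\<lambda>n. prob (?B n)) \<longlonglongrightarrow> 0"
  proof (rule LIMSEQ_I)
    fix e :: real assume e: "0 < e"
    then have "0 < e / 2" by simp
    then obtain R where R: "0 < R" "\<And>n. 0 < n \<Longrightarrow> prob {w\<in>space M. R < norm (sqrt (real n) *\<^sub>R grad_mean n w)} \<le> e / 2"
      using scaled_grad_mean_tight by metis
    let ?T = "\<lambda>n. {w\<in>space M. R < norm (sqrt (real n) *\<^sub>R grad_mean n w)}"
    have T_meas: "?T n \<in> sets M" for n by measurable
    have "0 < \<epsilon> / R" using \<epsilon> R by simp
    from measure_le_with_high_prob[OF estimator_expansion_whp[OF t this]]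
    obtain q where q: "q \<longlonglongrightarrow> 0" "\<And>n B. B \<in> sets M \<Longrightarrow>
      (\<And>w. w \<in> B \<Longrightarrow> \<not> norm (at_sample X t n w - \<theta>0 + cq.P *v grad_mean n w) \<le> \<epsilon> / R * norm (grad_mean n w)) \<Longrightarrow> prob B \<le> q n"
      by metis
    have le: "prob (?B n) \<le> e / 2 + q n" if n: "0 < n" for n
    proof -
      have "prob (?B n - ?T n) \<le> q n"
      proof (rule q(2))
        show "?B n - ?T n \<in> sets M" using B_meas T_meas by auto
        fix w assume "w \<in> ?B n - ?T n"
        then have w: "\<epsilon> < norm (?R n w)" "norm (sqrt (real n) *\<^sub>R grad_mean n w) \<le> R" by (auto simp del: norm_scaleR)
        show "\<not> norm (at_sample X t n w - \<theta>0 + cq.P *v grad_mean n w) \<le> \<epsilon> / R * norm (grad_mean n w)"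
        proof
          assume "norm (at_sample X t n w - \<theta>0 + cq.P *v grad_mean n w) \<le> \<epsilon> / R * norm (grad_mean n w)"
          then have "sqrt (real n) * norm (at_sample X t n w - \<theta>0 + cq.P *v grad_mean n w)
              \<le> sqrt (real n) * (\<epsilon> / R * norm (grad_mean n w))"
            by (intro mult_left_mono) auto
          also have "\<dots> = \<epsilon> / R * norm (sqrt (real n) *\<^sub>R grad_mean n w)" by simp
          also have "\<dots> \<le> \<epsilon> / R * R" using w(2) \<epsilon> R(1) by (intro mult_left_mono) auto
          finally show False using w(1) R(1) unfolding R_eq by simp
        qed
      qed
      moreover have "prob (?B n) \<le> prob (?T n) + prob (?B n - ?T n)"
      proof -
        have "prob (?B n) \<le> prob (?T n \<union> (?B n - ?T n))"
          using B_meas T_meas by (intro finite_measure_mono) auto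
        also have "\<dots> \<le> prob (?T n) + prob (?B n - ?T n)"
          using B_meas T_meas by (intro measure_Un_le) auto
        finally show ?thesis .
      qed
      ultimately show ?thesis using R(2)[OF n] by linarith
    qed
    from order_tendstoD(2)[OF q(1), of "e / 2"] e obtain no where no: "\<And>n. no \<le> n \<Longrightarrow> q n < e / 2"
      by (auto simp: eventually_sequentially)
    show "\<exists>no. \<forall>n\<ge>no. norm (prob (?B n) - 0) < e"
    proof (intro exI[of _ "max 1 no"] allI impI)
      fix n assume "max 1 no \<le> n"
      then have "0 < n" "no \<le> n" by auto
      then show "norm (prob (?B n) - 0) < e" using le[of n] no[of n] by simp
    qed
  qed
qed

text \<open>In direction \<open>a\<close> the scaled estimate behaves like the scaled gradient in
  direction \<open>- (P *v a)\<close>, whose limiting variance is the form of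
  \<open>P ** K ** P\<close> at \<open>a\<close>. Tightness is inherited through the same linear
  relation.\<close>

theorem restricted_estimator_asymptotically_normal:
  assumes t: "restricted_estimator t" "consistent_for M (at_sample X t) \<theta>0"
  shows "asymptotically_normal M (at_sample X t) \<theta>0 (cq.P ** K ** cq.P)"
proof -
  let ?C = "cq.P ** K ** cq.P"
  have quad: "a \<bullet> (?C *v a) = (cq.P *v a) \<bullet> (K *v (cq.P *v a))" for a
    by (simp add: matrix_vector_mul_assoc[symmetric] inner_transpose_mult[of a cq.P] cq.transpose_P)
  have K_psd: "0 \<le> a \<bullet> (K *v a)" for a
    unfolding \<psi>_var[symmetric] by (rule integral_nonneg_AE) simp
  have C_sym: "transpose ?C = ?C"
    by (simp add: matrix_transpose_mul cq.transpose_P K_sym matrix_mul_assoc)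
  obtain N where N: "multivariate_normal N 0 ?C"
    using multivariate_normal_exists[OF C_sym] quad K_psd by metis
  interpret N: prob_space N using N by (simp add: multivariate_normal_def)
  have sN[measurable_cong]: "sets N = sets borel" using N by (simp add: multivariate_normal_def)
  let ?Y = "\<lambda>n w. sqrt (real n) *\<^sub>R (at_sample X t n w - \<theta>0)"
  let ?S = "\<lambda>n w. sqrt (real n) *\<^sub>R grad_mean n w"
  have [measurable]: "at_sample X t n \<in> borel_measurable M" for n
    using t(1) by (intro at_sample_measurable) (simp add: restricted_estimator_def)
  have Pm[measurable]: "(\<lambda>w. A *v ?S n w) \<in> borel_measurable M" for A :: "real^'p^'p" and n
    by (rule measurable_compose[OF _ borel_measurable_continuous_onI, of "?S n"])
       (auto intro!: linear_continuous_on linear_linear[THEN iffD2])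
  have Y_meas: "?Y n \<in> borel_measurable M" for n by measurable
  note R0 = scaled_expansion_consistent[OF t]
  have "converges_in_law M ?Y N"
  proof (rule converges_in_law_cramer_wold[OF prob_space_axioms Y_meas N.prob_space_axioms sN])
    fix a :: "real^'p" and c :: real
    have "(\<lambda>n. expectation (\<lambda>w. cos ((- (cq.P *v a)) \<bullet> ?S n w + c))) \<longlonglongrightarrow> (\<integral>y. cos (y + c) \<partial>normal_law 0 (a \<bullet> (?C *v a)))"
    proof -
      have "(- (cq.P *v a)) \<bullet> (K *v (- (cq.P *v a))) = a \<bullet> (?C *v a)"
        unfolding quad by (simp add: linear_neg[OF matrix_vector_mul_linear])
      then show ?thesis using scaled_grad_mean_clt[of "- (cq.P *v a)" c] by simp
    qed
    then have "(\<lambda>n. expectation (\<lambda>w. cos (a \<bullet> ?Y n w + c))) \<longlonglongrightarrow> (\<integral>y. cos (y + c) \<partial>normal_law 0 (a \<bullet> (?C *v a)))"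
    proof (rule expectation_cos_slutsky[rotated 3])
      show "consistent_for M (\<lambda>n w. a \<bullet> ?Y n w - (- (cq.P *v a)) \<bullet> ?S n w) 0"
      proof (rule consistent_for_with_high_prob)
        fix e :: real assume e: "0 < e"
        have "with_high_prob M (\<lambda>n w. dist (?Y n w + cq.P *v ?S n w) 0 \<le> e / (norm a + 1))"
          using e by (intro with_high_prob_consistent_for[OF R0]) (measurable, simp add: add_nonneg_pos)
        then show "with_high_prob M (\<lambda>n w. dist (a \<bullet> ?Y n w - (- (cq.P *v a)) \<bullet> ?S n w) 0 \<le> e)"
        proof (rule with_high_prob_mono)
          fix n w assume le: "dist (?Y n w + cq.P *v ?S n w) 0 \<le> e / (norm a + 1)"
          have "a \<bullet> ?Y n w - (- (cq.P *v a)) \<bullet> ?S n w = a \<bullet> (?Y n w + cq.P *v ?S n w)"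
            by (simp add: inner_add_right inner_transpose_mult[of a cq.P] cq.transpose_P)
          also have "\<bar>\<dots>\<bar> \<le> norm a * norm (?Y n w + cq.P *v ?S n w)" by (rule Cauchy_Schwarz_ineq2)
          also have "\<dots> \<le> norm a * (e / (norm a + 1))" using le by (intro mult_left_mono) auto
          also have "\<dots> \<le> e"
          proof -
            have "0 < norm a + 1" by (simp add: add_nonneg_pos)
            then have "norm a / (norm a + 1) \<le> 1" by simp
            from mult_left_mono[OF this, of e] e show ?thesis by (simp add: mult.commute)
          qed
          finally show "dist (a \<bullet> ?Y n w - (- (cq.P *v a)) \<bullet> ?S n w) 0 \<le> e" by (simp add: dist_real_def)
        qed
      qed
    qed measurable
    also have "(\<integral>y. cos (y + c) \<partial>normal_law 0 (a \<bullet> (?C *v a))) = (\<integral>y. cos (a \<bullet> y + c) \<partial>N)"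
    proof -
      have "distr N borel (\<lambda>y. a \<bullet> y) = normal_law 0 (a \<bullet> (?C *v a))"
        using N by (simp add: multivariate_normal_def)
      then have "(\<integral>y. cos (y + c) \<partial>normal_law 0 (a \<bullet> (?C *v a)))
          = (\<integral>y. cos (y + c) \<partial>distr N borel (\<lambda>y. a \<bullet> y))" by simp
      also have "\<dots> = (\<integral>y. cos (a \<bullet> y + c) \<partial>N)"
        by (rule integral_distr) measurable
      finally show ?thesis .
    qed
    finally show "(\<lambda>n. expectation (\<lambda>w. cos (a \<bullet> ?Y n w + c))) \<longlonglongrightarrow> (\<integral>y. cos (a \<bullet> y + c) \<partial>N)" .
  next
    fix e :: real assume e: "0 < e"
    then have "0 < e / 2" by simp
    then obtain R where R: "0 < R" "\<And>n. 0 < n \<Longrightarrow> prob {w\<in>space M. R < norm (?S n w)} \<le> e / 2"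
      using scaled_grad_mean_tight by metis
    \<comment> \<open>The product bounds the image under \<open>P\<close> of a scaled gradient of
      norm at most \<open>R\<close>; the 1 covers the remainder, which exceeds 1 with vanishing
      probability.\<close>
    let ?R' = "norm cq.P * R + 1"
    let ?T = "\<lambda>n. {w\<in>space M. R < norm (?S n w)}"
    let ?B = "\<lambda>n. {w\<in>space M. 1 < dist (?Y n w + cq.P *v ?S n w) 0}"
    have meas: "?T n \<in> sets M" "?B n \<in> sets M" for n by measurable
    have "(\<lambda>n. prob (?B n)) \<longlonglongrightarrow> 0" using R0 by (simp add: consistent_for_def)
    then have "\<forall>\<^sub>F n in sequentially. prob (?B n) < e / 2"
      using order_tendstoD(2)[of "\<lambda>n. prob (?B n)" 0 sequentially "e / 2"] e by simp
    moreover have "\<forall>\<^sub>F n in sequentially. 0 < n" by (rule eventually_gt_at_top)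
    ultimately have "\<forall>\<^sub>F n in sequentially. prob {w\<in>space M. ?R' < norm (?Y n w)} < e"
    proof eventually_elim
      case (elim n)
      have "{w\<in>space M. ?R' < norm (?Y n w)} \<subseteq> ?T n \<union> ?B n"
      proof
        fix w assume w: "w \<in> {w\<in>space M. ?R' < norm (?Y n w)}"
        show "w \<in> ?T n \<union> ?B n"
        proof (rule ccontr)
          assume "w \<notin> ?T n \<union> ?B n"
          then have 1: "norm (?S n w) \<le> R" "norm (?Y n w + cq.P *v ?S n w) \<le> 1"
            using w by (auto simp del: norm_scaleR)
          have "norm (?Y n w) \<le> norm (?Y n w + cq.P *v ?S n w) + norm (cq.P *v ?S n w)"
            using norm_triangle_ineq4[of "?Y n w + cq.P *v ?S n w" "cq.P *v ?S n w"] by simp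
          also have "norm (cq.P *v ?S n w) \<le> norm cq.P * norm (?S n w)" by (rule norm_matrix_vector_mult_le)
          also have "\<dots> \<le> norm cq.P * R" using 1(1) by (intro mult_left_mono) auto
          finally show False using 1(2) w by simp
        qed
      qed
      then have "prob {w\<in>space M. ?R' < norm (?Y n w)} \<le> prob (?T n \<union> ?B n)"
        using meas by (intro finite_measure_mono) auto
      also have "\<dots> \<le> prob (?T n) + prob (?B n)" using meas by (intro measure_Un_le)
      finally show ?case using R(2)[of n] elim by simp
    qed
    then show "\<exists>R. \<forall>\<^sub>F n in sequentially. prob {w\<in>space M. R < norm (?Y n w)} < e" by blast
  qed
  with N show ?thesis unfolding asymptotically_normal_def by blast
qed

end

section \<open>Partial derivatives\<close>

lemma partial_deriv_eq:
  assumes "(F has_derivative F') (at \<theta>)"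
  shows "partial_deriv j F \<theta> = F' (axis j 1)"
  using frechet_derivative_at[OF assms] by (simp add: partial_deriv_def)

lemma linear_eq_sum_axis:
  fixes l :: "real^'p::finite \<Rightarrow> 'b::real_vector"
  assumes "linear l"
  shows "l v = (\<Sum>j\<in>UNIV. (v $ j) *\<^sub>R l (axis j 1))"
proof -
  have "v = (\<Sum>j\<in>UNIV. (v $ j) *\<^sub>R axis j 1)"
    using basis_expansion[of v, symmetric] unfolding scalar_mult_eq_scaleR .
  then have "l v = l (\<Sum>j\<in>UNIV. (v $ j) *\<^sub>R axis j 1)" by (rule arg_cong)
  also have "\<dots> = (\<Sum>j\<in>UNIV. (v $ j) *\<^sub>R l (axis j 1))"
    by (simp only: linear_sum[OF assms] linear_scale[OF assms])
  finally show ?thesis .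
qed

lemma has_derivative_partial_deriv:
  fixes F :: "real^'p::finite \<Rightarrow> real"
  assumes "F differentiable (at \<theta>)"
  shows "(F has_derivative (\<lambda>v. \<Sum>j\<in>UNIV. v $ j * partial_deriv j F \<theta>)) (at \<theta>)"
proof -
  obtain F' where F': "(F has_derivative F') (at \<theta>)" using assms by (auto simp: differentiable_def)
  have "F' = (\<lambda>v. \<Sum>j\<in>UNIV. v $ j * partial_deriv j F \<theta>)"
  proof
    show "F' v = (\<Sum>j\<in>UNIV. v $ j * partial_deriv j F \<theta>)" for v
      unfolding partial_deriv_eq[OF F'] real_scaleR_def[symmetric]
      by (rule linear_eq_sum_axis[OF has_derivative_linear[OF F']])
  qed
  with F' show ?thesis by simp
qed

text \<open>Formulas for partial derivatives are available only on an open set; agreement there lets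
  them be differentiated once more.\<close>

lemma partial_deriv_cong_open:
  assumes "open A" "\<theta> \<in> A" "\<And>t. t \<in> A \<Longrightarrow> F t = G t"
  shows "partial_deriv j F \<theta> = partial_deriv j G \<theta>"
proof -
  have "(F has_derivative F') (at \<theta>) \<longleftrightarrow> (G has_derivative F') (at \<theta>)" for F'
  proof
    assume "(F has_derivative F') (at \<theta>)"
    then show "(G has_derivative F') (at \<theta>)"
      by (rule has_derivative_transform_within_open[OF _ assms])
  next
    assume "(G has_derivative F') (at \<theta>)"
    then show "(F has_derivative F') (at \<theta>)"
      by (rule has_derivative_transform_within_open[OF _ assms(1,2) assms(3)[symmetric]])
  qed
  then show ?thesis by (simp add: partial_deriv_def frechet_derivative_def)
qed

lemma differentiable_cong_open:
  assumes "open A" "\<theta> \<in> A" "\<And>t. t \<in> A \<Longrightarrow> F t = G t" "F differentiable (at \<theta>)"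
  shows "G differentiable (at \<theta>)"
proof -
  obtain F' where "(F has_derivative F') (at \<theta>)" using assms(4) by (auto simp: differentiable_def)
  then have "(G has_derivative F') (at \<theta>)"
    by (rule has_derivative_transform_within_open[OF _ assms(1-3)])
  then show ?thesis by (auto simp: differentiable_def)
qed

lemma partial_deriv_const: "partial_deriv j (\<lambda>t. c) \<theta> = 0"
  by (rule partial_deriv_eq[where F'="\<lambda>_. 0"]) simp

lemma
  fixes F G :: "real^'p::finite \<Rightarrow> real"
  assumes "F differentiable (at \<theta>)" "G differentiable (at \<theta>)"
  shows partial_deriv_diff: "partial_deriv j (\<lambda>t. F t - G t) \<theta> = partial_deriv j F \<theta> - partial_deriv j G \<theta>"
    and partial_deriv_mult: "partial_deriv j (\<lambda>t. F t * G t) \<theta>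
      = partial_deriv j F \<theta> * G \<theta> + F \<theta> * partial_deriv j G \<theta>"
proof -
  obtain F' G' where F': "(F has_derivative F') (at \<theta>)" and G': "(G has_derivative G') (at \<theta>)"
    using assms by (auto simp: differentiable_def)
  show "partial_deriv j (\<lambda>t. F t - G t) \<theta> = partial_deriv j F \<theta> - partial_deriv j G \<theta>"
    using partial_deriv_eq[OF has_derivative_diff[OF F' G']] by (simp add: partial_deriv_eq[OF F'] partial_deriv_eq[OF G'])
  show "partial_deriv j (\<lambda>t. F t * G t) \<theta> = partial_deriv j F \<theta> * G \<theta> + F \<theta> * partial_deriv j G \<theta>"
    using partial_deriv_eq[OF has_derivative_mult[OF F' G']]
    by (simp add: partial_deriv_eq[OF F'] partial_deriv_eq[OF G'])
qed

lemma
  fixes F :: "real^'p::finite \<Rightarrow> real"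
  assumes "F differentiable (at \<theta>)" "(\<phi> has_real_derivative d) (at (F \<theta>))"
  shows differentiable_comp_real: "(\<lambda>t. \<phi> (F t)) differentiable (at \<theta>)"
    and partial_deriv_comp_real: "partial_deriv j (\<lambda>t. \<phi> (F t)) \<theta> = d * partial_deriv j F \<theta>"
proof -
  obtain F' where F': "(F has_derivative F') (at \<theta>)" using assms(1) by (auto simp: differentiable_def)
  have *: "((\<lambda>t. \<phi> (F t)) has_derivative (\<lambda>v. d * F' v)) (at \<theta>)"
    using has_derivative_compose[OF F', of \<phi> "(*) d"] assms(2) by (simp add: has_field_derivative_def)
  then show "(\<lambda>t. \<phi> (F t)) differentiable (at \<theta>)" by (auto simp: differentiable_def)
  show "partial_deriv j (\<lambda>t. \<phi> (F t)) \<theta> = d * partial_deriv j F \<theta>"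
    using partial_deriv_eq[OF *] partial_deriv_eq[OF F'] by simp
qed

text \<open>The outer functions are logarithms and powers, smooth on the positive reals only, hence
  the positivity of \<open>F\<close>. Openness of \<open>A\<close> lets the first-order formula be
  differentiated again.\<close>

lemma
  fixes F :: "real^'p::finite \<Rightarrow> real"
  assumes A: "open A" and F: "thrice_differentiable_on A F" and pos: "\<And>t. t \<in> A \<Longrightarrow> 0 < F t"
    and \<phi>: "\<And>y. 0 < y \<Longrightarrow> (\<phi> has_real_derivative \<phi>1 y) (at y)"
    and \<phi>1: "\<And>y. 0 < y \<Longrightarrow> (\<phi>1 has_real_derivative \<phi>2 y) (at y)"
    and t: "t \<in> A"
  shows partial_deriv_comp1: "partial_deriv j (\<lambda>t. \<phi> (F t)) t = \<phi>1 (F t) * partial_deriv j F t"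
    and differentiable_comp1: "(\<lambda>t. \<phi> (F t)) differentiable (at t)"
    and partial_deriv_comp2: "partial_deriv k (partial_deriv j (\<lambda>t. \<phi> (F t))) t
      = \<phi>2 (F t) * partial_deriv k F t * partial_deriv j F t + \<phi>1 (F t) * partial_deriv k (partial_deriv j F) t"
    and differentiable_comp2: "partial_deriv j (\<lambda>t. \<phi> (F t)) differentiable (at t)"
proof -
  have d: "F differentiable (at t)" "partial_deriv j F differentiable (at t)" if "t \<in> A" for t
    using F that by (auto simp: thrice_differentiable_on_def)
  have first: "partial_deriv j (\<lambda>t. \<phi> (F t)) t = \<phi>1 (F t) * partial_deriv j F t" if "t \<in> A" for t
    by (rule partial_deriv_comp_real[OF d(1)[OF that] \<phi>[OF pos[OF that]]])
  show "partial_deriv j (\<lambda>t. \<phi> (F t)) t = \<phi>1 (F t) * partial_deriv j F t" by (rule first[OF t])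
  show "(\<lambda>t. \<phi> (F t)) differentiable (at t)"
    by (rule differentiable_comp_real[OF d(1)[OF t] \<phi>[OF pos[OF t]]])
  have dc: "(\<lambda>t. \<phi>1 (F t)) differentiable (at t)"
    by (rule differentiable_comp_real[OF d(1)[OF t] \<phi>1[OF pos[OF t]]])
  have "partial_deriv k (partial_deriv j (\<lambda>t. \<phi> (F t))) t = partial_deriv k (\<lambda>t. \<phi>1 (F t) * partial_deriv j F t) t"
    by (rule partial_deriv_cong_open[OF A t first])
  also have "\<dots> = \<phi>2 (F t) * partial_deriv k F t * partial_deriv j F t + \<phi>1 (F t) * partial_deriv k (partial_deriv j F) t"
    unfolding partial_deriv_mult[OF dc d(2)[OF t]]
      partial_deriv_comp_real[OF d(1)[OF t] \<phi>1[OF pos[OF t]]] ..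
  finally show "partial_deriv k (partial_deriv j (\<lambda>t. \<phi> (F t))) t
      = \<phi>2 (F t) * partial_deriv k F t * partial_deriv j F t + \<phi>1 (F t) * partial_deriv k (partial_deriv j F) t" .
  have "(\<lambda>t. \<phi>1 (F t) * partial_deriv j F t) differentiable (at t)"
    using dc d(2)[OF t] by (rule differentiable_mult)
  then show "partial_deriv j (\<lambda>t. \<phi> (F t)) differentiable (at t)"
    by (rule differentiable_cong_open[OF A t, rotated]) (rule first[symmetric])
qed

section \<open>Second-order Taylor bounds\<close>

lemma abs_sum_component_le:
  fixes v :: "real^'p::finite"
  assumes "\<And>l. \<bar>a l\<bar> \<le> C l"
  shows "\<bar>\<Sum>l\<in>UNIV. v $ l * a l\<bar> \<le> (\<Sum>l\<in>UNIV. C l) * norm v"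
proof -
  have "\<bar>\<Sum>l\<in>UNIV. v $ l * a l\<bar> \<le> (\<Sum>l\<in>UNIV. \<bar>v $ l * a l\<bar>)" by (rule sum_abs)
  also have "\<dots> \<le> (\<Sum>l\<in>UNIV. norm v * C l)"
    unfolding abs_mult by (intro sum_mono mult_mono assms component_le_norm_cart) auto
  finally show ?thesis by (simp add: sum_distrib_left mult.commute)
qed

text \<open>The mean value inequality is applied twice, to the partial derivatives and then to
  \<open>h\<close> minus its linear part, so the constant carries no factor one half. It will be
  used with \<open>h\<close> a first partial derivative of the loss, so that \<open>C\<close> bounds
  third derivatives.\<close>

lemma taylor2_partial_deriv:
  fixes h :: "real^'p::finite \<Rightarrow> real"
  assumes ball: "\<And>t. t \<in> cball \<theta>0 r \<Longrightarrow> h differentiable (at t)"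
    and ball2: "\<And>t k. t \<in> cball \<theta>0 r \<Longrightarrow> partial_deriv k h differentiable (at t)"
    and C: "\<And>t k l. t \<in> cball \<theta>0 r \<Longrightarrow> \<bar>partial_deriv l (partial_deriv k h) t\<bar> \<le> C k l"
    and \<theta>: "\<theta> \<in> cball \<theta>0 r"
  shows "\<bar>h \<theta> - h \<theta>0 - (\<Sum>k\<in>UNIV. (\<theta> - \<theta>0) $ k * partial_deriv k h \<theta>0)\<bar>
    \<le> (\<Sum>k\<in>UNIV. \<Sum>l\<in>UNIV. C k l) * (norm (\<theta> - \<theta>0))\<^sup>2"
proof -
  \<comment> \<open>The second application takes place on the ball whose radius is exactly the
    distance, so the Lipschitz bound contributes the second factor
    \<open>norm (\<theta> - \<theta>0)\<close>.\<close>
  define \<rho> where "\<rho> = norm (\<theta> - \<theta>0)"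
  have "\<theta>0 \<in> cball \<theta>0 r" using order_trans[OF zero_le_dist, of \<theta>0 \<theta> r] \<theta> by simp
  then have C0: "0 \<le> C k l" for k l using order_trans[OF abs_ge_zero C] by blast
  have sub: "t \<in> cball \<theta>0 r" if "t \<in> cball \<theta>0 \<rho>" for t
    using that \<theta> by (simp add: \<rho>_def dist_norm norm_minus_commute)
  have lip: "\<bar>partial_deriv k h t - partial_deriv k h \<theta>0\<bar> \<le> (\<Sum>l\<in>UNIV. C k l) * norm (t - \<theta>0)"
    if t: "t \<in> cball \<theta>0 r" for k t
  proof -
    have "norm (partial_deriv k h t - partial_deriv k h \<theta>0) \<le> (\<Sum>l\<in>UNIV. C k l) * norm (t - \<theta>0)"
    proof (rule differentiable_bound[OF convex_cball, of \<theta>0 r])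
      show "(partial_deriv k h has_derivative (\<lambda>v. \<Sum>l\<in>UNIV. v $ l * partial_deriv l (partial_deriv k h) s))
          (at s within cball \<theta>0 r)" if "s \<in> cball \<theta>0 r" for s
        using has_derivative_partial_deriv[OF ball2[OF that]] by (rule has_derivative_at_withinI)
      show "onorm (\<lambda>v. \<Sum>l\<in>UNIV. v $ l * partial_deriv l (partial_deriv k h) s) \<le> (\<Sum>l\<in>UNIV. C k l)"
        if "s \<in> cball \<theta>0 r" for s
        using abs_sum_component_le[OF C[OF that]] by (intro onorm_le) simp
    qed (use t \<open>\<theta>0 \<in> cball \<theta>0 r\<close> in auto)
    then show ?thesis by simp
  qed
  let ?m = "\<lambda>t. h t - (\<Sum>k\<in>UNIV. t $ k * partial_deriv k h \<theta>0)"
  have "norm (?m \<theta> - ?m \<theta>0) \<le> (\<Sum>k\<in>UNIV. (\<Sum>l\<in>UNIV. C k l) * \<rho>) * norm (\<theta> - \<theta>0)"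
  proof (rule differentiable_bound[OF convex_cball, of \<theta>0 \<rho>])
    fix s assume s: "s \<in> cball \<theta>0 \<rho>"
    have "(?m has_derivative (\<lambda>v. (\<Sum>k\<in>UNIV. v $ k * partial_deriv k h s) - (\<Sum>k\<in>UNIV. v $ k * partial_deriv k h \<theta>0))) (at s)"
    proof (rule has_derivative_diff)
      show "(h has_derivative (\<lambda>v. \<Sum>k\<in>UNIV. v $ k * partial_deriv k h s)) (at s)"
        by (rule has_derivative_partial_deriv[OF ball[OF sub[OF s]]])
      have "linear (\<lambda>v::real^'p. \<Sum>k\<in>UNIV. v $ k * partial_deriv k h \<theta>0)"
        by (rule linearI) (simp_all add: sum.distrib distrib_right sum_distrib_left mult.assoc)
      then show "((\<lambda>v::real^'p. \<Sum>k\<in>UNIV. v $ k * partial_deriv k h \<theta>0) has_derivative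
          (\<lambda>v. \<Sum>k\<in>UNIV. v $ k * partial_deriv k h \<theta>0)) (at s)"
        by (intro bounded_linear_imp_has_derivative) (simp add: linear_conv_bounded_linear)
    qed
    also have "(\<lambda>v::real^'p. (\<Sum>k\<in>UNIV. v $ k * partial_deriv k h s) - (\<Sum>k\<in>UNIV. v $ k * partial_deriv k h \<theta>0))
        = (\<lambda>v. \<Sum>k\<in>UNIV. v $ k * (partial_deriv k h s - partial_deriv k h \<theta>0))"
      by (simp add: sum_subtractf right_diff_distrib)
    finally show "(?m has_derivative (\<lambda>v. \<Sum>k\<in>UNIV. v $ k * (partial_deriv k h s - partial_deriv k h \<theta>0))) (at s within cball \<theta>0 \<rho>)"
      by (rule has_derivative_at_withinI)
    have "\<bar>partial_deriv k h s - partial_deriv k h \<theta>0\<bar> \<le> (\<Sum>l\<in>UNIV. C k l) * \<rho>" for k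
    proof (rule order_trans[OF lip[OF sub[OF s]]])
      show "(\<Sum>l\<in>UNIV. C k l) * norm (s - \<theta>0) \<le> (\<Sum>l\<in>UNIV. C k l) * \<rho>"
        using s C0 by (intro mult_left_mono sum_nonneg) (auto simp: dist_norm norm_minus_commute)
    qed
    from abs_sum_component_le[OF this]
    show "onorm (\<lambda>v. \<Sum>k\<in>UNIV. v $ k * (partial_deriv k h s - partial_deriv k h \<theta>0)) \<le> (\<Sum>k\<in>UNIV. (\<Sum>l\<in>UNIV. C k l) * \<rho>)"
      by (intro onorm_le) simp
  qed (auto simp: \<rho>_def dist_norm norm_minus_commute)
  moreover have "?m \<theta> - ?m \<theta>0 = h \<theta> - h \<theta>0 - (\<Sum>k\<in>UNIV. (\<theta> - \<theta>0) $ k * partial_deriv k h \<theta>0)"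
    by (simp add: sum_subtractf left_diff_distrib)
  ultimately show ?thesis
    by (simp add: \<rho>_def sum_distrib_right power2_eq_square mult.assoc)
qed

section \<open>The density power divergence loss\<close>

text \<open>\<open>Gd\<close> is the support without a null set of points at which smoothness or domination
  fails.\<close>

locale dpd_model =
  fixes \<mu> :: "'x measure" and \<Theta> \<omega> :: "(real^'p::finite) set" and S Gd :: "'x set"
    and f :: "real^'p \<Rightarrow> 'x \<Rightarrow> real" and \<beta> :: real and \<theta>0 :: "real^'p"
    and B :: "'p \<Rightarrow> 'p \<Rightarrow> 'p \<Rightarrow> 'x \<Rightarrow> real"
  assumes \<beta>: "0 \<le> \<beta>" and model: "parametric_model \<mu> \<Theta> f"
    and support: "\<And>\<theta>. \<theta> \<in> \<Theta> \<Longrightarrow> {x\<in>space \<mu>. 0 < f \<theta> x} = S"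
    and \<omega>: "open \<omega>" "\<omega> \<subseteq> \<Theta>" "\<theta>0 \<in> \<omega>"
    and Gd: "Gd \<in> sets \<mu>" "Gd \<subseteq> S" "AE x in \<mu>. x \<in> S \<longrightarrow> x \<in> Gd"
    and smooth: "\<And>x. x \<in> Gd \<Longrightarrow> thrice_differentiable_on \<omega> (\<lambda>\<theta>. f \<theta> x)"
    and dominated: "\<And>x \<theta> j k l. x \<in> Gd \<Longrightarrow> \<theta> \<in> \<omega> \<Longrightarrow>
      \<bar>partial_deriv l (partial_deriv k (partial_deriv j (\<lambda>t. dpd_loss \<mu> f \<beta> t x))) \<theta>\<bar> \<le> B j k l x"
    and B_int: "\<And>j k l. integrable (density \<mu> (\<lambda>x. ennreal (f \<theta>0 x))) (B j k l)"
    and diff_int: "thrice_differentiable_under_integral \<mu> \<omega> (\<lambda>\<theta> x. f \<theta> x powr (1 + \<beta>))"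
    and mats: "dpd_matrices_exist \<mu> f \<beta> \<theta>0"
begin

abbreviation "p \<equiv> f \<theta>0"
abbreviation "c \<equiv> 1 + \<beta>"
definition "I \<theta> = (\<integral>x. f \<theta> x powr c \<partial>\<mu>)"
definition "i1 j \<theta> = partial_deriv j I \<theta> / c"
definition "i2 j k \<theta> = partial_deriv k (partial_deriv j I) \<theta> / c"
definition "L = density \<mu> (\<lambda>x. ennreal (p x))"
text \<open>Set to 0 off \<open>Gd\<close>, where the derivative may fail to exist; this makes
  \<open>f1\<close> and \<open>f2\<close> measurable and lets all products vanish outside the
  support.\<close>

definition "f1 j x = (if x \<in> Gd then partial_deriv j (\<lambda>t. f t x) \<theta>0 else 0)"
definition "f2 j k x = (if x \<in> Gd then partial_deriv k (partial_deriv j (\<lambda>t. f t x)) \<theta>0 else 0)"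
text \<open>The loss is \<open>I \<theta> - rho (f \<theta> x)\<close>; for \<open>\<beta> = 0\<close> this uses \<open>I \<theta> = 1\<close>. In this form
  \<open>rho y\<close> has derivative \<open>(1 + \<beta>) * y powr (\<beta> - 1)\<close> for every \<open>\<beta> \<ge> 0\<close>. The division by
  \<open>c\<close> in \<open>V\<close> turns the mean Hessian into \<open>dpd_J\<close> and the covariance of the gradient into \<open>dpd_K\<close>.\<close>

definition "rho y = (if \<beta> = 0 then 1 + ln y else (1 + 1 / \<beta>) * y powr \<beta>)"
definition "V \<theta> x = dpd_loss \<mu> f \<beta> \<theta> x / c"
definition "D \<theta> x = (\<chi> j. partial_deriv j (\<lambda>t. V t x) \<theta>)"
definition "\<psi> x = (\<chi> j. if x \<in> Gd then i1 j \<theta>0 - p x powr (\<beta> - 1) * f1 j x else 0)"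
definition "Hs x = (\<chi> j k. if x \<in> Gd then i2 j k \<theta>0 -
  ((\<beta> - 1) * p x powr (\<beta> - 2) * f1 k x * f1 j x + p x powr (\<beta> - 1) * f2 j k x) else 0)"
text \<open>The absolute values make \<open>b\<close> nonnegative at every point, including those
  where the domination is not known.\<close>

definition "b x = (\<Sum>j\<in>UNIV. \<Sum>k\<in>UNIV. \<Sum>l\<in>UNIV. \<bar>B j k l x\<bar>)"

lemma c: "1 \<le> c" "0 < c" "c \<noteq> 0" using \<beta> by auto

lemma \<theta>0: "\<theta>0 \<in> \<Theta>" using \<omega> by auto

lemma f_meas: "\<theta> \<in> \<Theta> \<Longrightarrow> f \<theta> \<in> borel_measurable \<mu>"
  using model by (simp add: parametric_model_def)

lemma f_nonneg: "\<theta> \<in> \<Theta> \<Longrightarrow> x \<in> space \<mu> \<Longrightarrow> 0 \<le> f \<theta> x"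
  using model by (simp add: parametric_model_def)

lemma p_meas[measurable]: "p \<in> borel_measurable \<mu>" by (rule f_meas[OF \<theta>0])

lemma Gd_meas[measurable]: "Gd \<in> sets \<mu>" by (rule Gd(1))

lemma f_pos: "x \<in> Gd \<Longrightarrow> \<theta> \<in> \<Theta> \<Longrightarrow> 0 < f \<theta> x"
  using support Gd(2) by blast

lemma f_pos_\<omega>: "x \<in> Gd \<Longrightarrow> \<theta> \<in> \<omega> \<Longrightarrow> 0 < f \<theta> x"
  using f_pos \<omega> by blast

lemma f_zero: "x \<in> space \<mu> \<Longrightarrow> x \<notin> S \<Longrightarrow> \<theta> \<in> \<Theta> \<Longrightarrow> f \<theta> x = 0"
  using support[of \<theta>] f_nonneg[of \<theta> x] by force

lemma sets_L[measurable_cong]: "sets L = sets \<mu>" by (simp add: L_def)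

lemma density_f:
  assumes "\<theta> \<in> \<Theta>"
  shows "integrable \<mu> (f \<theta>)" "integral\<^sup>L \<mu> (f \<theta>) = 1"
proof -
  interpret prob_space "density \<mu> (\<lambda>x. ennreal (f \<theta> x))"
    using model assms by (simp add: parametric_model_def)
  have nn: "AE x in \<mu>. 0 \<le> f \<theta> x" using f_nonneg[OF assms] by simp
  have "integrable (density \<mu> (\<lambda>x. ennreal (f \<theta> x))) (\<lambda>x. 1::real)" by simp
  then show "integrable \<mu> (f \<theta>)" by (subst (asm) integrable_real_density[OF f_meas[OF assms] nn]) auto
  have "(\<integral>x. 1 \<partial>density \<mu> (\<lambda>x. ennreal (f \<theta> x))) = (1::real)" by (simp add: prob_space[simplified])
  then show "integral\<^sup>L \<mu> (f \<theta>) = 1"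
    by (subst (asm) integral_real_density[OF f_meas[OF assms] nn]) auto
qed

text \<open>Identities between integrands are computed on \<open>Gd\<close> and hold trivially where
  all densities vanish; the points of the support outside \<open>Gd\<close> form a null set.\<close>

lemma AE_cases:
  assumes "\<And>x. x \<in> Gd \<Longrightarrow> P x" "\<And>x. x \<in> space \<mu> \<Longrightarrow> x \<notin> S \<Longrightarrow> P x"
  shows "AE x in \<mu>. P x"
  using Gd(3) AE_space by eventually_elim (use assms in blast)

lemma L_integral:
  assumes "\<phi> \<in> borel_measurable \<mu>"
  shows "integrable L \<phi> \<longleftrightarrow> integrable \<mu> (\<lambda>x. p x * \<phi> x)" "integral\<^sup>L L \<phi> = (\<integral>x. p x * \<phi> x \<partial>\<mu>)"
proof -
  have nn: "AE x in \<mu>. 0 \<le> p x" using f_nonneg[OF \<theta>0] by simp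
  show "integrable L \<phi> \<longleftrightarrow> integrable \<mu> (\<lambda>x. p x * \<phi> x)" "integral\<^sup>L L \<phi> = (\<integral>x. p x * \<phi> x \<partial>\<mu>)"
    unfolding L_def using integrable_real_density[OF p_meas nn assms] integral_real_density[OF p_meas nn assms]
    by auto
qed

lemma AE_L_Gd: "AE x in L. x \<in> Gd"
proof -
  have "AE x in \<mu>. 0 < ennreal (p x) \<longrightarrow> x \<in> Gd"
    by (rule AE_cases) (use f_zero[OF _ _ \<theta>0] in auto)
  then show ?thesis unfolding L_def by (subst AE_density) auto
qed

lemma rho_deriv: "0 < y \<Longrightarrow> (rho has_real_derivative c * y powr (\<beta> - 1)) (at y)"
proof (cases "\<beta> = 0")
  case True
  assume y: "0 < y"
  have "((\<lambda>y. 1 + ln y) has_real_derivative inverse y) (at y)"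
    using y by (auto intro!: derivative_eq_intros simp: divide_inverse)
  moreover have "rho = (\<lambda>y. 1 + ln y)" using True unfolding rho_def[abs_def] by simp
  ultimately show ?thesis using True y by (simp add: powr_minus)
next
  case False
  assume y: "0 < y"
  have "((\<lambda>y. (1 + 1 / \<beta>) * y powr \<beta>) has_real_derivative (1 + 1 / \<beta>) * (\<beta> * y powr (\<beta> - 1))) (at y)"
    using y by (intro DERIV_cmult has_real_derivative_powr)
  moreover have "rho = (\<lambda>y. (1 + 1 / \<beta>) * y powr \<beta>)" using False unfolding rho_def[abs_def] by simp
  moreover have "(1 + 1 / \<beta>) * (\<beta> * y powr (\<beta> - 1)) = c * y powr (\<beta> - 1)"
    using False by (simp add: field_simps)
  ultimately show ?thesis by simp
qed

lemma powr_deriv: "0 < y \<Longrightarrow> ((\<lambda>y. d * y powr a) has_real_derivative d * a * y powr (a - 1)) (at y)"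
  using DERIV_cmult[OF has_real_derivative_powr, of y d a] by (simp add: mult.assoc)

lemma V_eq: "x \<in> Gd \<Longrightarrow> \<theta> \<in> \<Theta> \<Longrightarrow> V \<theta> x = I \<theta> / c - rho (f \<theta> x) / c"
proof -
  assume x: "x \<in> Gd" and \<theta>: "\<theta> \<in> \<Theta>"
  have "dpd_loss \<mu> f \<beta> \<theta> x = I \<theta> - rho (f \<theta> x)"
  proof (cases "\<beta> = 0")
    case True
    have "I \<theta> = (\<integral>x. f \<theta> x \<partial>\<mu>)"
      unfolding I_def using True f_nonneg[OF \<theta>] by (intro Bochner_Integration.integral_cong) auto
    then have I1: "I \<theta> = 1" using density_f[OF \<theta>] by simp
    show ?thesis unfolding dpd_loss_def rho_def I1 using True by simp
  qed (simp add: dpd_loss_def rho_def I_def)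
  then show ?thesis by (simp add: V_def diff_divide_distrib)
qed

lemma I_diff:
  assumes "\<theta> \<in> \<omega>"
  shows "I differentiable (at \<theta>)" "partial_deriv j I differentiable (at \<theta>)"
    "partial_deriv k (partial_deriv j I) differentiable (at \<theta>)"
proof -
  have "thrice_differentiable_on \<omega> I"
    using diff_int by (simp add: thrice_differentiable_under_integral_def Let_def I_def[abs_def])
  then show "I differentiable (at \<theta>)" "partial_deriv j I differentiable (at \<theta>)"
    "partial_deriv k (partial_deriv j I) differentiable (at \<theta>)"
    using assms by (auto simp: thrice_differentiable_on_def)
qed

lemma differentiable_divide_const:
  fixes F :: "real^'p \<Rightarrow> real"
  assumes "F differentiable (at \<theta>)"
  shows "(\<lambda>t. F t / c) differentiable (at \<theta>)" "partial_deriv j (\<lambda>t. F t / c) \<theta> = partial_deriv j F \<theta> / c"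
proof -
  have d: "((\<lambda>y. y / c) has_real_derivative 1 / c) (at y)" for y
    using c by (auto intro!: derivative_eq_intros)
  show "(\<lambda>t. F t / c) differentiable (at \<theta>)" by (rule differentiable_comp_real[OF assms d])
  show "partial_deriv j (\<lambda>t. F t / c) \<theta> = partial_deriv j F \<theta> / c"
    using partial_deriv_comp_real[OF assms d] by simp
qed

lemma rho_c_deriv: "0 < y \<Longrightarrow> ((\<lambda>y. rho y / c) has_real_derivative y powr (\<beta> - 1)) (at y)"
  using DERIV_cdivide[OF rho_deriv, of y c] c by simp

lemma powr_deriv1: "0 < y \<Longrightarrow> ((\<lambda>y. y powr a) has_real_derivative a * y powr (a - 1)) (at y)"
  using powr_deriv[of y 1 a] by simp

section \<open>Derivatives of the loss at a fixed good observation\<close>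

context
  fixes x assumes x: "x \<in> Gd"
begin

lemma V1:
  assumes \<theta>: "\<theta> \<in> \<omega>"
  shows "(\<lambda>t. V t x) differentiable (at \<theta>)"
    and "partial_deriv j (\<lambda>t. V t x) \<theta> = i1 j \<theta> - f \<theta> x powr (\<beta> - 1) * partial_deriv j (\<lambda>t. f t x) \<theta>"
proof -
  have d: "(\<lambda>t. I t / c - rho (f t x) / c) differentiable (at \<theta>)"
    by (intro differentiable_diff differentiable_divide_const I_diff \<theta>
        differentiable_comp1[OF \<omega>(1) smooth[OF x] f_pos_\<omega>[OF x] rho_c_deriv powr_deriv1 \<theta>])
  have eq: "I t / c - rho (f t x) / c = V t x" if "t \<in> \<omega>" for t
    using V_eq[OF x] \<omega> that by auto
  show "(\<lambda>t. V t x) differentiable (at \<theta>)"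
    by (rule differentiable_cong_open[OF \<omega>(1) \<theta> eq d])
  have "partial_deriv j (\<lambda>t. V t x) \<theta> = partial_deriv j (\<lambda>t. I t / c - rho (f t x) / c) \<theta>"
    by (rule partial_deriv_cong_open[OF \<omega>(1) \<theta> eq[symmetric]])
  also have "\<dots> = i1 j \<theta> - f \<theta> x powr (\<beta> - 1) * partial_deriv j (\<lambda>t. f t x) \<theta>"
    by (subst partial_deriv_diff)
       (auto simp: i1_def differentiable_divide_const I_diff \<theta>
         partial_deriv_comp1[OF \<omega>(1) smooth[OF x] f_pos_\<omega>[OF x] rho_c_deriv powr_deriv1 \<theta>]
         intro!: differentiable_comp1[OF \<omega>(1) smooth[OF x] f_pos_\<omega>[OF x] rho_c_deriv powr_deriv1 \<theta>])
  finally show "partial_deriv j (\<lambda>t. V t x) \<theta> = i1 j \<theta> - f \<theta> x powr (\<beta> - 1) * partial_deriv j (\<lambda>t. f t x) \<theta>" .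
qed

lemma V2:
  assumes \<theta>: "\<theta> \<in> \<omega>"
  shows "partial_deriv j (\<lambda>t. V t x) differentiable (at \<theta>)"
    and "partial_deriv k (partial_deriv j (\<lambda>t. V t x)) \<theta> = i2 j k \<theta> -
      ((\<beta> - 1) * f \<theta> x powr (\<beta> - 2) * partial_deriv k (\<lambda>t. f t x) \<theta> * partial_deriv j (\<lambda>t. f t x) \<theta>
       + f \<theta> x powr (\<beta> - 1) * partial_deriv k (partial_deriv j (\<lambda>t. f t x)) \<theta>)"
proof -
  let ?r = "\<lambda>t. rho (f t x) / c"
  note comp = \<omega>(1) smooth[OF x] f_pos_\<omega>[OF x] rho_c_deriv powr_deriv1
  have eq: "partial_deriv j I t / c - partial_deriv j ?r t = partial_deriv j (\<lambda>t. V t x) t" if "t \<in> \<omega>" for t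
    unfolding V1(2)[OF that] by (simp add: i1_def partial_deriv_comp1[OF comp that])
  have dd: "(\<lambda>t. partial_deriv j I t / c) differentiable (at \<theta>)" "partial_deriv j ?r differentiable (at \<theta>)"
    using differentiable_divide_const(1)[OF I_diff(2)[OF \<theta>]] differentiable_comp2[OF comp \<theta>] by auto
  show "partial_deriv j (\<lambda>t. V t x) differentiable (at \<theta>)"
    by (rule differentiable_cong_open[OF \<omega>(1) \<theta> eq differentiable_diff[OF dd]])
  have "partial_deriv k (partial_deriv j (\<lambda>t. V t x)) \<theta>
      = partial_deriv k (\<lambda>t. partial_deriv j I t / c - partial_deriv j ?r t) \<theta>"
    by (rule partial_deriv_cong_open[OF \<omega>(1) \<theta> eq[symmetric]])
  also have "\<dots> = i2 j k \<theta> - partial_deriv k (partial_deriv j ?r) \<theta>"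
    unfolding partial_deriv_diff[OF dd] differentiable_divide_const(2)[OF I_diff(2)[OF \<theta>]] i2_def ..
  also have "partial_deriv k (partial_deriv j ?r) \<theta> =
      (\<beta> - 1) * f \<theta> x powr (\<beta> - 2) * partial_deriv k (\<lambda>t. f t x) \<theta> * partial_deriv j (\<lambda>t. f t x) \<theta>
       + f \<theta> x powr (\<beta> - 1) * partial_deriv k (partial_deriv j (\<lambda>t. f t x)) \<theta>"
    using partial_deriv_comp2[OF comp \<theta>, of k j] by simp
  finally show "partial_deriv k (partial_deriv j (\<lambda>t. V t x)) \<theta> = i2 j k \<theta> -
      ((\<beta> - 1) * f \<theta> x powr (\<beta> - 2) * partial_deriv k (\<lambda>t. f t x) \<theta> * partial_deriv j (\<lambda>t. f t x) \<theta>
       + f \<theta> x powr (\<beta> - 1) * partial_deriv k (partial_deriv j (\<lambda>t. f t x)) \<theta>)"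
    .
qed

lemma V3_diff:
  assumes \<theta>: "\<theta> \<in> \<omega>"
  shows "partial_deriv k (partial_deriv j (\<lambda>t. V t x)) differentiable (at \<theta>)"
proof (rule differentiable_cong_open[OF \<omega>(1) \<theta> V2(2)[symmetric]])
  have fd: "(\<lambda>t. f t x) differentiable (at \<theta>)" "partial_deriv j (\<lambda>t. f t x) differentiable (at \<theta>)"
    "partial_deriv k (partial_deriv j (\<lambda>t. f t x)) differentiable (at \<theta>)" for j k
    using smooth[OF x] \<theta> by (auto simp: thrice_differentiable_on_def)
  have pw: "(\<lambda>t. f t x powr a) differentiable (at \<theta>)" for a
    by (rule differentiable_comp_real[OF fd(1) powr_deriv1[OF f_pos_\<omega>[OF x \<theta>]]])
  have "i2 j k = (\<lambda>t. partial_deriv k (partial_deriv j I) t / c)" by (simp add: i2_def fun_eq_iff)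
  then have "i2 j k differentiable (at \<theta>)"
    using differentiable_divide_const(1)[OF I_diff(3)[OF \<theta>]] by simp
  then show "(\<lambda>\<theta>. i2 j k \<theta> -
      ((\<beta> - 1) * f \<theta> x powr (\<beta> - 2) * partial_deriv k (\<lambda>t. f t x) \<theta> * partial_deriv j (\<lambda>t. f t x) \<theta>
       + f \<theta> x powr (\<beta> - 1) * partial_deriv k (partial_deriv j (\<lambda>t. f t x)) \<theta>)) differentiable (at \<theta>)"
    by (intro differentiable_diff differentiable_add differentiable_mult differentiable_const pw fd)
qed

lemma V3_bound:
  assumes \<theta>: "\<theta> \<in> \<omega>"
  shows "\<bar>partial_deriv l (partial_deriv k (partial_deriv j (\<lambda>t. V t x))) \<theta>\<bar> \<le> \<bar>B j k l x\<bar>"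
proof -
  have loss: "(\<lambda>t. dpd_loss \<mu> f \<beta> t x) = (\<lambda>t. V t x * c)" using c by (simp add: V_def)
  have mc: "partial_deriv j (\<lambda>t. F t * c) t = partial_deriv j F t * c" if "F differentiable (at t)" for F t j
  proof -
    have d: "((\<lambda>y. y * c) has_real_derivative c) (at y)" for y by (auto intro!: derivative_eq_intros)
    show ?thesis using partial_deriv_comp_real[OF that d] by simp
  qed
  have 1: "partial_deriv j (\<lambda>t. dpd_loss \<mu> f \<beta> t x) t = partial_deriv j (\<lambda>t. V t x) t * c" if "t \<in> \<omega>" for t
    unfolding loss by (rule mc[OF V1(1)[OF that]])
  have 2: "partial_deriv k (partial_deriv j (\<lambda>t. dpd_loss \<mu> f \<beta> t x)) t
      = partial_deriv k (partial_deriv j (\<lambda>t. V t x)) t * c" if "t \<in> \<omega>" for t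
    using partial_deriv_cong_open[OF \<omega>(1) that 1] mc[OF V2(1)[OF that]] by simp
  have 3: "partial_deriv l (partial_deriv k (partial_deriv j (\<lambda>t. dpd_loss \<mu> f \<beta> t x))) \<theta>
      = partial_deriv l (partial_deriv k (partial_deriv j (\<lambda>t. V t x))) \<theta> * c"
    using partial_deriv_cong_open[OF \<omega>(1) \<theta> 2] mc[OF V3_diff[OF \<theta>]] by simp
  let ?v = "partial_deriv l (partial_deriv k (partial_deriv j (\<lambda>t. V t x))) \<theta>"
  have "\<bar>?v\<bar> * 1 \<le> \<bar>?v\<bar> * c" using c by (intro mult_left_mono) auto
  also have "\<dots> = \<bar>?v * c\<bar>" using c by (simp add: abs_mult)
  also have "\<dots> \<le> B j k l x" using dominated[OF x \<theta>, of l k j] unfolding 3 .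
  finally show ?thesis by simp
qed

lemma D_\<theta>0: "D \<theta>0 x = \<psi> x"
  using x by (simp add: D_def \<psi>_def V1(2)[OF \<omega>(3)] f1_def vec_eq_iff)

lemma Hs_eq: "Hs x $ j $ k = partial_deriv k (partial_deriv j (\<lambda>t. V t x)) \<theta>0"
  using x by (simp add: Hs_def V2(2)[OF \<omega>(3)] f1_def f2_def)

lemma V_has_derivative:
  assumes "\<theta> \<in> \<omega>"
  shows "((\<lambda>\<theta>. V \<theta> x) has_derivative (\<lambda>v. D \<theta> x \<bullet> v)) (at \<theta>)"
proof -
  have "(\<lambda>v. \<Sum>j\<in>UNIV. v $ j * partial_deriv j (\<lambda>t. V t x) \<theta>) = (\<lambda>v. D \<theta> x \<bullet> v)"
    by (simp add: D_def inner_vec_def mult.commute)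
  with has_derivative_partial_deriv[OF V1(1)[OF assms]] show ?thesis by simp
qed

text \<open>Each component of the gradient is expanded separately, and the Euclidean norm is bounded
  by the sum of the components; \<open>b\<close> collects the constants.\<close>

lemma D_expansion:
  assumes ball: "cball \<theta>0 r \<subseteq> \<omega>" and \<theta>: "\<theta> \<in> cball \<theta>0 r"
  shows "norm (D \<theta> x - \<psi> x - Hs x *v (\<theta> - \<theta>0)) \<le> b x * (norm (\<theta> - \<theta>0))\<^sup>2"
proof -
  have "norm (D \<theta> x - \<psi> x - Hs x *v (\<theta> - \<theta>0)) \<le> (\<Sum>j\<in>UNIV. \<bar>(D \<theta> x - \<psi> x - Hs x *v (\<theta> - \<theta>0)) $ j\<bar>)"
    by (rule norm_le_l1_cart)
  also have "\<dots> \<le> (\<Sum>j\<in>UNIV. (\<Sum>k\<in>UNIV. \<Sum>l\<in>UNIV. \<bar>B j k l x\<bar>) * (norm (\<theta> - \<theta>0))\<^sup>2)"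
  proof (rule sum_mono)
    fix j
    have "(D \<theta> x - \<psi> x - Hs x *v (\<theta> - \<theta>0)) $ j = partial_deriv j (\<lambda>t. V t x) \<theta> - partial_deriv j (\<lambda>t. V t x) \<theta>0
        - (\<Sum>k\<in>UNIV. (\<theta> - \<theta>0) $ k * partial_deriv k (partial_deriv j (\<lambda>t. V t x)) \<theta>0)"
      by (simp add: D_\<theta>0[symmetric] matrix_vector_mult_def Hs_eq) (simp add: D_def mult.commute)
    also have "\<bar>\<dots>\<bar> \<le> (\<Sum>k\<in>UNIV. \<Sum>l\<in>UNIV. \<bar>B j k l x\<bar>) * (norm (\<theta> - \<theta>0))\<^sup>2"
      using ball by (intro taylor2_partial_deriv[OF _ _ _ \<theta>] V2(1) V3_diff V3_bound) auto
    finally show "\<bar>(D \<theta> x - \<psi> x - Hs x *v (\<theta> - \<theta>0)) $ j\<bar> \<le> (\<Sum>k\<in>UNIV. \<Sum>l\<in>UNIV. \<bar>B j k l x\<bar>) * (norm (\<theta> - \<theta>0))\<^sup>2" .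
  qed
  finally show ?thesis by (simp add: b_def sum_distrib_right)
qed

end

lemma V_meas:
  assumes "\<theta> \<in> \<Theta>"
  shows "V \<theta> \<in> borel_measurable \<mu>"
proof -
  have [measurable]: "f \<theta> \<in> borel_measurable \<mu>" by (rule f_meas[OF assms])
  show ?thesis unfolding V_def dpd_loss_def by measurable
qed

lemma b_nonneg: "0 \<le> b x" by (simp add: b_def sum_nonneg)

lemma b_int: "integrable L b"
  using B_int unfolding b_def[abs_def] L_def by (intro Bochner_Integration.integrable_sum integrable_abs)

end

section \<open>Moments of the score and the main theorem\<close>

lemma outer_prod_nth: "outer_prod u v $ i $ j = u $ i * v $ j"
  by (simp add: outer_prod_def)

lemma
  fixes F :: "'x \<Rightarrow> 'b::euclidean_space^'n::finite"
  assumes "integrable M F"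
  shows integrable_vec_nth: "integrable M (\<lambda>x. F x $ i)"
    and integral_vec_nth: "(\<integral>x. F x $ i \<partial>M) = (\<integral>x. F x \<partial>M) $ i"
proof -
  have lin: "bounded_linear (\<lambda>v::'b^'n. v $ i)" by (rule bounded_linear_vec_nth)
  show "integrable M (\<lambda>x. F x $ i)" by (rule integrable_bounded_linear[OF lin assms])
  show "(\<integral>x. F x $ i \<partial>M) = (\<integral>x. F x \<partial>M) $ i" by (rule integral_bounded_linear[OF lin assms])
qed

lemma constraint_jacobian_derivative:
  assumes "g differentiable (at \<theta>)"
  shows "(g has_derivative (\<lambda>v. transpose (constraint_jacobian g \<theta>) *v v)) (at \<theta>)"
proof -
  obtain g' where g': "(g has_derivative g') (at \<theta>)" using assms by (auto simp: differentiable_def)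
  have comp: "((\<lambda>t. g t $ j) has_derivative (\<lambda>v. g' v $ j)) (at \<theta>)" for j
    by (rule bounded_linear.has_derivative[OF bounded_linear_vec_nth g'])
  have "g' v $ j = (transpose (constraint_jacobian g \<theta>) *v v) $ j" for v j
    using linear_eq_sum_axis[OF has_derivative_linear[OF comp[of j]], of v]
    by (simp add: matrix_vector_mult_def transpose_def constraint_jacobian_def partial_deriv_eq[OF comp] mult.commute)
  then have "g' = (\<lambda>v. transpose (constraint_jacobian g \<theta>) *v v)" by (simp add: fun_eq_iff vec_eq_iff)
  with g' show ?thesis by simp
qed

section \<open>Means and covariance of the gradient, mean of the Hessian\<close>

context dpd_model
begin

text \<open>Derivatives of the integrand \<open>f powr (1 + \<beta>)\<close>, not of the loss.
  Differentiation under the integral sign makes them integrable, and information on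
  \<open>f1\<close> and \<open>f2\<close> is extracted from them.\<close>

definition "D1 j x = partial_deriv j (\<lambda>t. f t x powr c) \<theta>0"
definition "D2 j k x = partial_deriv k (partial_deriv j (\<lambda>t. f t x powr c)) \<theta>0"

lemma D_integral:
  shows "integrable \<mu> (D1 j)" "(\<integral>x. D1 j x \<partial>\<mu>) = c * i1 j \<theta>0"
    "integrable \<mu> (D2 j k)" "(\<integral>x. D2 j k x \<partial>\<mu>) = c * i2 j k \<theta>0"
proof -
  note d = diff_int[unfolded thrice_differentiable_under_integral_def Let_def, folded I_def[abs_def]]
  show "integrable \<mu> (D1 j)" "integrable \<mu> (D2 j k)"
    using d \<omega>(3) unfolding D1_def[abs_def] D2_def[abs_def] by blast+
  have "partial_deriv j I \<theta>0 = (\<integral>x. D1 j x \<partial>\<mu>)" "partial_deriv k (partial_deriv j I) \<theta>0 = (\<integral>x. D2 j k x \<partial>\<mu>)"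
    using d \<omega>(3) unfolding D1_def[abs_def] D2_def[abs_def] I_def[abs_def] by blast+
  then show "(\<integral>x. D1 j x \<partial>\<mu>) = c * i1 j \<theta>0" "(\<integral>x. D2 j k x \<partial>\<mu>) = c * i2 j k \<theta>0"
    using c by (simp_all add: i1_def i2_def)
qed

lemma D_meas[measurable]: "D1 j \<in> borel_measurable \<mu>" "D2 j k \<in> borel_measurable \<mu>"
  using D_integral(1,3) by (auto dest: borel_measurable_integrable)

lemma D_on_Gd:
  assumes x: "x \<in> Gd"
  shows "D1 j x = c * p x powr \<beta> * f1 j x"
    "D2 j k x = c * (\<beta> * p x powr (\<beta> - 1) * f1 k x * f1 j x + p x powr \<beta> * f2 j k x)"
proof -
  note comp = \<omega>(1) smooth[OF x] f_pos_\<omega>[OF x] powr_deriv1[where a=c] powr_deriv[where d=c and a="c - 1"] \<omega>(3)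
  show "D1 j x = c * p x powr \<beta> * f1 j x"
    using partial_deriv_comp1[OF comp, of j] x by (simp add: D1_def f1_def)
  show "D2 j k x = c * (\<beta> * p x powr (\<beta> - 1) * f1 k x * f1 j x + p x powr \<beta> * f2 j k x)"
    using partial_deriv_comp2[OF comp, of k j] x by (simp add: D2_def f1_def f2_def algebra_simps)
qed

text \<open>Outside the support all densities with parameter in the open set \<open>\<omega>\<close>
  vanish, so the differentiated function is locally 0.\<close>

lemma D_off_support:
  assumes x: "x \<in> space \<mu>" "x \<notin> S"
  shows "D1 j x = 0" "D2 j k x = 0"
proof -
  have z: "f t x powr c = 0" if "t \<in> \<omega>" for t using f_zero[OF x] that \<omega>(2) by auto
  have 1: "partial_deriv j (\<lambda>t. f t x powr c) t = 0" if "t \<in> \<omega>" for t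
    using partial_deriv_cong_open[OF \<omega>(1) that z] partial_deriv_const by simp
  show "D1 j x = 0" unfolding D1_def by (rule 1[OF \<omega>(3)])
  show "D2 j k x = 0" unfolding D2_def
    using partial_deriv_cong_open[OF \<omega>(1,3) 1] partial_deriv_const by simp
qed

lemma f12_off_support: "x \<notin> S \<Longrightarrow> f1 j x = 0" "x \<notin> S \<Longrightarrow> f2 j k x = 0"
  using Gd(2) by (auto simp: f1_def f2_def)

lemma p_nonzero: "x \<in> Gd \<Longrightarrow> p x \<noteq> 0"
  using f_pos[OF _ \<theta>0, of x] by simp

text \<open>On \<open>Gd\<close> the derivative of the density is recovered by dividing the
  measurable \<open>D1 j\<close> by a positive measurable function; \<open>f2\<close> is treated in
  the same way.\<close>

lemma f1_meas[measurable]: "f1 j \<in> borel_measurable \<mu>"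
proof -
  have "f1 j = (\<lambda>x. if x \<in> Gd then D1 j x / (c * p x powr \<beta>) else 0)"
    using D_on_Gd(1) p_nonzero c by (auto simp: fun_eq_iff f1_def)
  then show ?thesis by simp
qed

lemma f2_meas[measurable]: "f2 j k \<in> borel_measurable \<mu>"
proof -
  have "f2 j k = (\<lambda>x. if x \<in> Gd then (D2 j k x / c - \<beta> * p x powr (\<beta> - 1) * f1 k x * f1 j x) / p x powr \<beta> else 0)"
  proof
    fix x
    show "f2 j k x = (if x \<in> Gd then (D2 j k x / c - \<beta> * p x powr (\<beta> - 1) * f1 k x * f1 j x) / p x powr \<beta> else 0)"
      using D_on_Gd(2)[of x j k] p_nonzero[of x] c by (auto simp: f2_def)
  qed
  then show ?thesis by simp
qed

lemma \<psi>_meas: "\<psi> \<in> borel_measurable \<mu>"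
proof (rule borel_measurable_vecI)
  fix i show "(\<lambda>x. \<psi> x $ i) \<in> borel_measurable \<mu>" unfolding \<psi>_def vec_lambda_beta by measurable
qed

lemma \<psi>_nth_meas[measurable]: "(\<lambda>x. \<psi> x $ i) \<in> borel_measurable \<mu>"
  by (rule borel_measurable_vec_nth[OF \<psi>_meas])

lemma Hs_nth_meas[measurable]: "(\<lambda>x. Hs x $ i $ j) \<in> borel_measurable \<mu>"
  unfolding Hs_def vec_lambda_beta by measurable

text \<open>With the score equal to \<open>f1\<close> divided by the density, \<open>q\<close>,
  \<open>s\<close> and \<open>m\<close> are almost everywhere the integrands of
  \<open>dpd_J\<close>, of \<open>dpd_xi\<close> and of the first term of
  \<open>dpd_K\<close>.\<close>

definition "q j k x = p x powr (\<beta> - 1) * f1 j x * f1 k x"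
definition "s j x = p x powr \<beta> * f1 j x"
definition "m j k x = p x powr (2 * \<beta> - 1) * f1 j x * f1 k x"

lemma qsm_meas[measurable]: "q j k \<in> borel_measurable \<mu>" "s j \<in> borel_measurable \<mu>" "m j k \<in> borel_measurable \<mu>"
  unfolding q_def s_def m_def by measurable

lemma score_Gd:
  assumes "x \<in> Gd"
  shows "score f \<theta>0 x $ j = f1 j x / p x"
proof -
  have "(\<lambda>t. f t x) differentiable (at \<theta>0)"
    using smooth[OF assms] \<omega>(3) by (auto simp: thrice_differentiable_on_def)
  from partial_deriv_comp_real[OF this, of ln "1 / p x" j] f_pos[OF assms \<theta>0] assms
  show ?thesis by (simp add: score_def f1_def DERIV_ln_divide)
qed

lemma powr_sq_cancel: "0 < w \<Longrightarrow> w powr (a + 2) * (u / w) * (v / w) = w powr a * u * (v::real)"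
  by (simp add: powr_add powr_numeral power2_eq_square)

lemma AE_matrices:
  "AE x in \<mu>. p x powr c * (score f \<theta>0 x $ j * score f \<theta>0 x $ k) = q j k x"
  "AE x in \<mu>. p x powr c * score f \<theta>0 x $ j = s j x"
  "AE x in \<mu>. p x powr (1 + 2 * \<beta>) * (score f \<theta>0 x $ j * score f \<theta>0 x $ k) = m j k x"
proof -
  show "AE x in \<mu>. p x powr c * (score f \<theta>0 x $ j * score f \<theta>0 x $ k) = q j k x"
  proof (rule AE_cases)
    fix x assume x: "x \<in> Gd"
    show "p x powr c * (score f \<theta>0 x $ j * score f \<theta>0 x $ k) = q j k x"
      using powr_sq_cancel[OF f_pos[OF x \<theta>0], of "\<beta> - 1" "f1 j x" "f1 k x"]
      by (simp add: score_Gd[OF x] q_def mult.assoc)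
  qed (use f_zero[OF _ _ \<theta>0] f12_off_support in \<open>auto simp: q_def\<close>)
  show "AE x in \<mu>. p x powr c * score f \<theta>0 x $ j = s j x"
  proof (rule AE_cases)
    fix x assume x: "x \<in> Gd"
    show "p x powr c * score f \<theta>0 x $ j = s j x"
      using f_pos[OF x \<theta>0] by (simp add: score_Gd[OF x] s_def powr_add)
  qed (use f_zero[OF _ _ \<theta>0] f12_off_support in \<open>auto simp: s_def\<close>)
  show "AE x in \<mu>. p x powr (1 + 2 * \<beta>) * (score f \<theta>0 x $ j * score f \<theta>0 x $ k) = m j k x"
  proof (rule AE_cases)
    fix x assume x: "x \<in> Gd"
    show "p x powr (1 + 2 * \<beta>) * (score f \<theta>0 x $ j * score f \<theta>0 x $ k) = m j k x"
      using powr_sq_cancel[OF f_pos[OF x \<theta>0], of "2 * \<beta> - 1" "f1 j x" "f1 k x"]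
      by (simp add: score_Gd[OF x] m_def mult.assoc add.commute)
  qed (use f_zero[OF _ _ \<theta>0] f12_off_support in \<open>auto simp: m_def\<close>)
qed

lemma integral_AE_eq:
  fixes F G :: "'x \<Rightarrow> real"
  assumes "integrable \<mu> F" "G \<in> borel_measurable \<mu>" "AE x in \<mu>. F x = G x"
  shows "integrable \<mu> G" "integral\<^sup>L \<mu> G = integral\<^sup>L \<mu> F"
  using assms integrable_cong_AE_imp[OF assms(1,2)] integral_cong_AE[OF _ assms(2,3)]
  by (auto simp: eq_commute)

lemma q_integral: "integrable \<mu> (q j k)" "integral\<^sup>L \<mu> (q j k) = dpd_J \<mu> f \<beta> \<theta>0 $ j $ k"
proof -
  let ?F = "\<lambda>x. (p x powr c) *\<^sub>R outer_prod (score f \<theta>0 x) (score f \<theta>0 x)"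
  have F: "integrable \<mu> ?F" using mats by (simp add: dpd_matrices_exist_def)
  have Fn: "?F x $ j $ k = p x powr c * (score f \<theta>0 x $ j * score f \<theta>0 x $ k)" for x
    by (simp add: outer_prod_nth)
  note int = integrable_vec_nth[OF integrable_vec_nth[OF F], of j k, unfolded Fn]
  note val = integral_vec_nth[OF integrable_vec_nth[OF F], of j k, unfolded Fn integral_vec_nth[OF F]]
  show "integrable \<mu> (q j k)" "integral\<^sup>L \<mu> (q j k) = dpd_J \<mu> f \<beta> \<theta>0 $ j $ k"
    using integral_AE_eq[OF int qsm_meas(1) AE_matrices(1)] val unfolding dpd_J_def by simp_all
qed

text \<open>The same integral is the component of \<open>dpd_xi\<close> by definition and the
  rescaled derivative of \<open>I\<close> by differentiation under the integral sign. This equality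
  centres the gradient and produces the subtracted outer product in \<open>dpd_K\<close>.\<close>

lemma s_integral: "integrable \<mu> (s j)" "integral\<^sup>L \<mu> (s j) = dpd_xi \<mu> f \<beta> \<theta>0 $ j" "integral\<^sup>L \<mu> (s j) = i1 j \<theta>0"
proof -
  let ?F = "\<lambda>x. (p x powr c) *\<^sub>R score f \<theta>0 x"
  have F: "integrable \<mu> ?F" using mats by (simp add: dpd_matrices_exist_def)
  have Fn: "?F x $ j = p x powr c * score f \<theta>0 x $ j" for x by simp
  note int = integrable_vec_nth[OF F, of j, unfolded Fn]
  note val = integral_vec_nth[OF F, of j, unfolded Fn]
  show "integrable \<mu> (s j)" and "integral\<^sup>L \<mu> (s j) = dpd_xi \<mu> f \<beta> \<theta>0 $ j"
    using integral_AE_eq[OF int qsm_meas(2) AE_matrices(2)] val unfolding dpd_xi_def by simp_all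
  have "AE x in \<mu>. D1 j x = c * s j x"
    by (rule AE_cases) (auto simp: D_on_Gd s_def D_off_support f12_off_support)
  then have "(\<integral>x. c * s j x \<partial>\<mu>) = c * i1 j \<theta>0"
    using integral_AE_eq(2)[OF D_integral(1) _, where G="\<lambda>x. c * s j x"] D_integral(2) by simp
  then show "integral\<^sup>L \<mu> (s j) = i1 j \<theta>0" using c by simp
qed

lemma m_integral: "integrable \<mu> (m j k)"
  "integral\<^sup>L \<mu> (m j k) - i1 j \<theta>0 * i1 k \<theta>0 = dpd_K \<mu> f \<beta> \<theta>0 $ j $ k"
proof -
  let ?F = "\<lambda>x. (p x powr (1 + 2 * \<beta>)) *\<^sub>R outer_prod (score f \<theta>0 x) (score f \<theta>0 x)"
  have F: "integrable \<mu> ?F" using mats by (simp add: dpd_matrices_exist_def)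
  have Fn: "?F x $ j $ k = p x powr (1 + 2 * \<beta>) * (score f \<theta>0 x $ j * score f \<theta>0 x $ k)" for x
    by (simp add: outer_prod_nth)
  note int = integrable_vec_nth[OF integrable_vec_nth[OF F], of j k, unfolded Fn]
  note val = integral_vec_nth[OF integrable_vec_nth[OF F], of j k, unfolded Fn integral_vec_nth[OF F]]
  have mm: "integrable \<mu> (m j k)" "integral\<^sup>L \<mu> (m j k) = (\<integral>x. ?F x \<partial>\<mu>) $ j $ k"
    using integral_AE_eq[OF int qsm_meas(3) AE_matrices(3)] val by simp_all
  show "integrable \<mu> (m j k)" by (rule mm)
  show "integral\<^sup>L \<mu> (m j k) - i1 j \<theta>0 * i1 k \<theta>0 = dpd_K \<mu> f \<beta> \<theta>0 $ j $ k"
    unfolding dpd_K_def mm(2) by (simp add: outer_prod_nth s_integral(2)[symmetric] s_integral(3))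
qed

lemma p_powr: "x \<in> Gd \<Longrightarrow> p x * p x powr a = p x powr (a + 1)"
  using f_pos[OF _ \<theta>0, of x] by (simp add: powr_add)

text \<open>Multiplied by the density, the gradient becomes
  \<open>i1 j \<theta>0 * p x - s j x\<close>; both terms have integral
  \<open>i1 j \<theta>0\<close>.\<close>

lemma \<psi>_first: "integrable L (\<lambda>x. \<psi> x $ j)" "(\<integral>x. \<psi> x $ j \<partial>L) = 0"
proof -
  have int: "integrable \<mu> (\<lambda>x. i1 j \<theta>0 * p x - s j x)"
    using density_f(1)[OF \<theta>0] s_integral(1) by auto
  have val: "(\<integral>x. i1 j \<theta>0 * p x - s j x \<partial>\<mu>) = 0"
    using density_f[OF \<theta>0] s_integral by simp
  have "AE x in \<mu>. i1 j \<theta>0 * p x - s j x = p x * \<psi> x $ j"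
  proof (rule AE_cases)
    fix x assume x: "x \<in> Gd"
    show "i1 j \<theta>0 * p x - s j x = p x * \<psi> x $ j"
      using x p_powr[OF x, of "\<beta> - 1"] by (simp add: \<psi>_def s_def right_diff_distrib mult.assoc[symmetric] mult.commute[of "i1 j \<theta>0"])
  qed (use f_zero[OF _ _ \<theta>0] f12_off_support in \<open>auto simp: s_def\<close>)
  from integral_AE_eq[OF int _ this] val
  show "integrable L (\<lambda>x. \<psi> x $ j)" "(\<integral>x. \<psi> x $ j \<partial>L) = 0"
    by (simp_all add: L_integral)
qed

lemma \<psi>_second: "integrable L (\<lambda>x. \<psi> x $ j * \<psi> x $ k)"
  "(\<integral>x. \<psi> x $ j * \<psi> x $ k \<partial>L) = dpd_K \<mu> f \<beta> \<theta>0 $ j $ k"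
proof -
  \<comment> \<open>The expanded product of two centred gradient components times the density. After
    integration the two mixed terms and the first one combine to a single subtracted product of
    means.\<close>
  let ?G = "\<lambda>x. i1 j \<theta>0 * i1 k \<theta>0 * p x - i1 j \<theta>0 * s k x - i1 k \<theta>0 * s j x + m j k x"
  have int: "integrable \<mu> ?G"
    using density_f(1)[OF \<theta>0] s_integral(1) m_integral(1) by auto
  have val: "(\<integral>x. ?G x \<partial>\<mu>) = dpd_K \<mu> f \<beta> \<theta>0 $ j $ k"
    unfolding m_integral(2)[symmetric] using density_f[OF \<theta>0] s_integral(1,3) m_integral(1) by simp
  have "AE x in \<mu>. ?G x = p x * (\<psi> x $ j * \<psi> x $ k)"
  proof (rule AE_cases)
    fix x assume x: "x \<in> Gd"
    have b1: "p x powr \<beta> = p x * p x powr (\<beta> - 1)" using p_powr[OF x, of "\<beta> - 1"] by simp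
    have b2: "p x powr (2 * \<beta> - 1) = p x * p x powr (\<beta> - 1) * p x powr (\<beta> - 1)"
      using p_powr[OF x, of "\<beta> - 1"] by (simp flip: powr_add)
    show "?G x = p x * (\<psi> x $ j * \<psi> x $ k)"
      using x unfolding \<psi>_def s_def m_def b1 b2 by (simp add: algebra_simps)
  qed (use f_zero[OF _ _ \<theta>0] f12_off_support in \<open>auto simp: s_def m_def\<close>)
  from integral_AE_eq[OF int _ this] val
  show "integrable L (\<lambda>x. \<psi> x $ j * \<psi> x $ k)"
    "(\<integral>x. \<psi> x $ j * \<psi> x $ k \<partial>L) = dpd_K \<mu> f \<beta> \<theta>0 $ j $ k"
    by (simp_all add: L_integral)
qed

text \<open>The second derivative of the density is not integrated by itself: it is hidden in
  \<open>D2\<close>. The integral of \<open>D2 j k x / c\<close> cancels the term with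
  \<open>i2\<close>, and what remains is the integral of \<open>q\<close>.\<close>

lemma Hs_first: "integrable L (\<lambda>x. Hs x $ j $ k)" "(\<integral>x. Hs x $ j $ k \<partial>L) = dpd_J \<mu> f \<beta> \<theta>0 $ j $ k"
proof -
  let ?G = "\<lambda>x. i2 j k \<theta>0 * p x + q j k x - D2 j k x / c"
  have int: "integrable \<mu> ?G"
    using density_f(1)[OF \<theta>0] q_integral(1) D_integral(3) by auto
  have val: "(\<integral>x. ?G x \<partial>\<mu>) = dpd_J \<mu> f \<beta> \<theta>0 $ j $ k"
    using density_f[OF \<theta>0] q_integral D_integral(3,4) c by simp
  have "AE x in \<mu>. ?G x = p x * Hs x $ j $ k"
  proof (rule AE_cases)
    fix x assume x: "x \<in> Gd"
    have b1: "p x powr \<beta> = p x * p x powr (\<beta> - 1)" using p_powr[OF x, of "\<beta> - 1"] by simp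
    have b2: "p x powr (\<beta> - 1) = p x * p x powr (\<beta> - 2)" using p_powr[OF x, of "\<beta> - 2"] by simp
    have "D2 j k x / c = \<beta> * p x powr (\<beta> - 1) * f1 k x * f1 j x + p x powr \<beta> * f2 j k x"
      using D_on_Gd(2)[OF x, of j k] c by simp
    then show "?G x = p x * Hs x $ j $ k"
      using x by (simp add: Hs_def q_def b1 b2 algebra_simps)
  qed (use f_zero[OF _ _ \<theta>0] f12_off_support in \<open>auto simp: q_def D_off_support\<close>)
  from integral_AE_eq[OF int _ this] val
  show "integrable L (\<lambda>x. Hs x $ j $ k)" "(\<integral>x. Hs x $ j $ k \<partial>L) = dpd_J \<mu> f \<beta> \<theta>0 $ j $ k"
    by (simp_all add: L_integral)
qed

lemma inner_\<psi>: "a \<bullet> \<psi> x = (\<Sum>j\<in>UNIV. a $ j * \<psi> x $ j)"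
  by (simp add: inner_vec_def)

lemma \<psi>_mean: "(\<integral>x. a \<bullet> \<psi> x \<partial>L) = 0"
  unfolding inner_\<psi> using \<psi>_first by (subst Bochner_Integration.integral_sum) auto

lemma \<psi>_inner_sq: "(a \<bullet> \<psi> x)\<^sup>2 = (\<Sum>j\<in>UNIV. \<Sum>k\<in>UNIV. a $ j * a $ k * (\<psi> x $ j * \<psi> x $ k))"
  unfolding inner_\<psi> power2_eq_square sum_product by (simp add: mult_ac)

lemma \<psi>_sq: "integrable L (\<lambda>x. (a \<bullet> \<psi> x)\<^sup>2)"
  unfolding \<psi>_inner_sq by (intro Bochner_Integration.integrable_sum integrable_mult_right \<psi>_second)

lemma \<psi>_var: "(\<integral>x. (a \<bullet> \<psi> x)\<^sup>2 \<partial>L) = a \<bullet> (dpd_K \<mu> f \<beta> \<theta>0 *v a)"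
proof -
  have "(\<integral>x. (a \<bullet> \<psi> x)\<^sup>2 \<partial>L) = (\<Sum>j\<in>UNIV. \<Sum>k\<in>UNIV. (\<integral>x. a $ j * a $ k * (\<psi> x $ j * \<psi> x $ k) \<partial>L))"
    unfolding \<psi>_inner_sq
    by (simp add: Bochner_Integration.integral_sum Bochner_Integration.integrable_sum \<psi>_second(1))
  also have "\<dots> = (\<Sum>j\<in>UNIV. \<Sum>k\<in>UNIV. a $ j * a $ k * dpd_K \<mu> f \<beta> \<theta>0 $ j $ k)"
    by (simp add: \<psi>_second)
  also have "\<dots> = a \<bullet> (dpd_K \<mu> f \<beta> \<theta>0 *v a)"
    unfolding inner_matrix_eq_sum by (simp add: mult_ac)
  finally show ?thesis .
qed

lemma K_sym: "transpose (dpd_K \<mu> f \<beta> \<theta>0) = dpd_K \<mu> f \<beta> \<theta>0"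
  by (simp add: vec_eq_iff transpose_def \<psi>_second(2)[symmetric] mult.commute)

end

theorem theorem2:
  fixes \<mu> :: "'x measure" and M :: "'w measure"
    and \<Theta> \<omega> :: "(real^'p::finite) set" and S :: "'x set"
    and f :: "real^'p \<Rightarrow> 'x \<Rightarrow> real"
    and g :: "real^'p \<Rightarrow> real^'r::finite"
    and \<beta> :: real and \<theta>\<^sub>0 :: "real^'p"
    and X :: "nat \<Rightarrow> 'w \<Rightarrow> 'x"
  assumes "0 \<le> \<beta>"
    and "parametric_model \<mu> \<Theta> f"
    and "CARD('r) < CARD('p)"
    and "regular_constraint \<Theta> g"
    and "\<theta>\<^sub>0 \<in> constrained_set \<Theta> g"
    and "iid_sample M \<mu> (f \<theta>\<^sub>0) X"
    and "common_support \<mu> S \<Theta> f (f \<theta>\<^sub>0)"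
    and "open \<omega>" and "\<omega> \<subseteq> \<Theta>" and "\<theta>\<^sub>0 \<in> \<omega>"
    and "smooth_density \<mu> S \<omega> f"
    and "differentiable_integrals \<mu> \<omega> f \<beta> (f \<theta>\<^sub>0)"
    and "dpd_matrices_exist \<mu> f \<beta> \<theta>\<^sub>0"
    and "positive_definite (dpd_J_general \<mu> f \<beta> (f \<theta>\<^sub>0) \<theta>\<^sub>0)"
    and "third_derivatives_dominated \<mu> S \<omega> f \<beta> (f \<theta>\<^sub>0)"
  shows "(\<exists>t. restricted_mdpde M X \<mu> \<Theta> f g \<beta> t \<and> consistent_for M (at_sample X t) \<theta>\<^sub>0)
    \<and> (\<forall>t. restricted_mdpde M X \<mu> \<Theta> f g \<beta> t \<and> consistent_for M (at_sample X t) \<theta>\<^sub>0 \<longrightarrow>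
          asymptotically_normal M (at_sample X t) \<theta>\<^sub>0 (dpd_Sigma \<mu> f g \<beta> \<theta>\<^sub>0))"
proof -
  have \<theta>0: "\<theta>\<^sub>0 \<in> \<Theta>" "g \<theta>\<^sub>0 = 0" using assms(5) by (auto simp: constrained_set_def)
  have open_\<Theta>: "open \<Theta>" and f0: "f \<theta>\<^sub>0 \<in> borel_measurable \<mu>"
    using assms(2) \<theta>0(1) by (auto simp: parametric_model_def)
  obtain B :: "'p \<Rightarrow> 'p \<Rightarrow> 'p \<Rightarrow> 'x \<Rightarrow> real" where B: "\<And>j k l. integrable (density \<mu> (\<lambda>x. ennreal (f \<theta>\<^sub>0 x))) (B j k l)"
    "AE x in \<mu>. x \<in> S \<longrightarrow> (\<forall>\<theta>\<in>\<omega>. \<forall>j k l.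
      \<bar>partial_deriv l (partial_deriv k (partial_deriv j (\<lambda>t. dpd_loss \<mu> f \<beta> t x))) \<theta>\<bar> \<le> B j k l x)"
    using assms(15) unfolding third_derivatives_dominated_def by blast
  have S: "S = {x\<in>space \<mu>. 0 < f \<theta>\<^sub>0 x}" using assms(7) by (simp add: common_support_def)
  have S_meas: "S \<in> sets \<mu>" unfolding S using f0 by measurable
  have "AE x in \<mu>. x \<in> S \<longrightarrow> thrice_differentiable_on \<omega> (\<lambda>\<theta>. f \<theta> x) \<and> (\<forall>\<theta>\<in>\<omega>. \<forall>j k l.
      \<bar>partial_deriv l (partial_deriv k (partial_deriv j (\<lambda>t. dpd_loss \<mu> f \<beta> t x))) \<theta>\<bar> \<le> B j k l x)"
    using B(2) assms(11)[unfolded smooth_density_def] by eventually_elim blast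
  then obtain N where N: "N \<in> sets \<mu>" "emeasure \<mu> N = 0"
    "{x\<in>space \<mu>. \<not> (x \<in> S \<longrightarrow> thrice_differentiable_on \<omega> (\<lambda>\<theta>. f \<theta> x) \<and> (\<forall>\<theta>\<in>\<omega>. \<forall>j k l.
      \<bar>partial_deriv l (partial_deriv k (partial_deriv j (\<lambda>t. dpd_loss \<mu> f \<beta> t x))) \<theta>\<bar> \<le> B j k l x))} \<subseteq> N"
    by (auto elim: AE_E)
  \<comment> \<open>Smoothness and domination fail on the support only inside the null set
    \<open>N\<close>; removing a measurable \<open>N\<close> keeps \<open>Gd\<close> measurable and
    makes both hold at every point of it.\<close>
  define Gd where "Gd = S - N"
  have Gd_good: "thrice_differentiable_on \<omega> (\<lambda>\<theta>. f \<theta> x) \<and> (\<forall>\<theta>\<in>\<omega>. \<forall>j k l.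
      \<bar>partial_deriv l (partial_deriv k (partial_deriv j (\<lambda>t. dpd_loss \<mu> f \<beta> t x))) \<theta>\<bar> \<le> B j k l x)"
    if "x \<in> Gd" for x
    using that N(3) S unfolding Gd_def by blast
  interpret dm: dpd_model \<mu> \<Theta> \<omega> S Gd f \<beta> \<theta>\<^sub>0 B
  proof
    show "{x\<in>space \<mu>. 0 < f \<theta> x} = S" if "\<theta> \<in> \<Theta>" for \<theta> using assms(7) that by (simp add: common_support_def)
    show "Gd \<in> sets \<mu>" using S_meas N(1) by (simp add: Gd_def)
    show "Gd \<subseteq> S" by (auto simp: Gd_def)
    have "AE x in \<mu>. x \<notin> N" using N(1,2) by (auto intro!: AE_not_in simp: null_sets_def)
    then show "AE x in \<mu>. x \<in> S \<longrightarrow> x \<in> Gd" by eventually_elim (simp add: Gd_def)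
    show "thrice_differentiable_under_integral \<mu> \<omega> (\<lambda>\<theta> x. f \<theta> x powr (1 + \<beta>))"
      using assms(12) by (simp add: differentiable_integrals_def)
  qed (use assms Gd_good B(1) in auto)
  obtain r where r: "0 < r" "cball \<theta>\<^sub>0 r \<subseteq> \<omega>"
    using assms(8,10) open_contains_cball by blast
  have reg: "\<theta> \<in> \<Theta> \<Longrightarrow> g differentiable (at \<theta>)" "continuous_on \<Theta> (constraint_jacobian g)"
    "\<theta> \<in> \<Theta> \<Longrightarrow> rank (constraint_jacobian g \<theta>) = CARD('r)" for \<theta>
    using assms(4) by (auto simp: regular_constraint_def)
  have iid: "prob_space M" "prob_space.indep_vars M (\<lambda>_. \<mu>) X UNIV"
    "\<And>i. distributed M \<mu> (X i) (\<lambda>x. ennreal (f \<theta>\<^sub>0 x))"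
    using assms(6) by (auto simp: iid_sample_def)
  interpret prob_space M by (rule iid(1))
  have pd: "positive_definite (dpd_J \<mu> f \<beta> \<theta>\<^sub>0)" using assms(14) by (simp add: dpd_J_general_at_model)
  have ball_\<Theta>: "\<theta> \<in> \<Theta>" if "\<theta> \<in> cball \<theta>\<^sub>0 r" for \<theta> using r(2) assms(9) that by blast
  interpret ce: constrained_iid_loss M \<mu> dm.L X dm.V dm.D dm.\<psi> dm.Hs dm.b Gd \<theta>\<^sub>0 r
    "dpd_J \<mu> f \<beta> \<theta>\<^sub>0" "dpd_K \<mu> f \<beta> \<theta>\<^sub>0" \<Theta> g "constraint_jacobian g"
  proof
    show "indep_vars (\<lambda>_. \<mu>) X UNIV" by (rule iid(2))
    show "distr M \<mu> (X i) = dm.L" for i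
      using distributed_distr_eq_density[OF iid(3)[of i]] by (simp add: dm.L_def)
    show "dm.V \<theta> \<in> borel_measurable \<mu>" if "\<theta> \<in> cball \<theta>\<^sub>0 r" for \<theta>
      by (rule dm.V_meas[OF ball_\<Theta>[OF that]])
    show "((\<lambda>\<theta>. dm.V \<theta> x) has_derivative (\<lambda>v. dm.D \<theta> x \<bullet> v)) (at \<theta>)"
      if "x \<in> Gd" "\<theta> \<in> cball \<theta>\<^sub>0 r" for x \<theta>
      using that r(2) by (intro dm.V_has_derivative) auto
    show "norm (dm.D \<theta> x - dm.\<psi> x - dm.Hs x *v (\<theta> - \<theta>\<^sub>0)) \<le> dm.b x * (norm (\<theta> - \<theta>\<^sub>0))\<^sup>2"
      if "x \<in> Gd" "\<theta> \<in> cball \<theta>\<^sub>0 r" for x \<theta>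
      by (rule dm.D_expansion[OF that(1) r(2) that(2)])
    show "cball \<theta>\<^sub>0 r \<subseteq> \<Theta>" using ball_\<Theta> by blast
    show "(g has_derivative (\<lambda>v. transpose (constraint_jacobian g \<theta>) *v v)) (at \<theta>)"
      if "\<theta> \<in> cball \<theta>\<^sub>0 r" for \<theta>
      by (rule constraint_jacobian_derivative[OF reg(1)[OF ball_\<Theta>[OF that]]])
    show "isCont (constraint_jacobian g) \<theta>\<^sub>0"
      using reg(2) open_\<Theta> \<theta>0(1) by (simp add: continuous_on_eq_continuous_at)
    \<comment> \<open>The Jacobian has as many columns as constraints, so rank
      \<open>CARD('r)\<close> means full column rank, that is, injectivity.\<close>
    show "inj ((*v) (constraint_jacobian g \<theta>))" if "\<theta> \<in> cball \<theta>\<^sub>0 r" for \<theta>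
      using reg(3)[OF ball_\<Theta>[OF that]] by (simp add: full_rank_injective)
  qed (fact dm.Gd_meas dm.AE_L_Gd r(1) dm.b_nonneg dm.b_int dm.\<psi>_meas dm.\<psi>_mean dm.\<psi>_sq dm.\<psi>_var
      dm.K_sym dm.Hs_first pd \<theta>0(2))+
  \<comment> \<open>The rescaling by \<open>1 + \<beta>\<close> is undone here: a positive factor
    does not change local minimizers, so the two notions of estimator coincide.\<close>
  have obj: "dpd_objective \<mu> f \<beta> n xs \<theta> = (1 + \<beta>) * ce.obj n xs \<theta>" for n xs \<theta>
    using dm.c by (simp add: dpd_objective_def ce.obj_def dm.V_def sum_divide_distrib[symmetric])
  have min: "local_minimizer_on (dpd_objective \<mu> f \<beta> n xs) A t \<longleftrightarrow> local_minimizer_on (ce.obj n xs) A t" for n xs A t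
    using dm.c by (simp add: local_minimizer_on_def minimizer_on_def obj)
  have est: "restricted_mdpde M X \<mu> \<Theta> f g \<beta> t \<longleftrightarrow> ce.restricted_estimator t" for t
    by (simp add: restricted_mdpde_def ce.restricted_estimator_def with_high_prob_def min)
  have "dpd_Sigma \<mu> f g \<beta> \<theta>\<^sub>0 = ce.cq.P ** dpd_K \<mu> f \<beta> \<theta>\<^sub>0 ** ce.cq.P"
    by (simp add: dpd_Sigma_def dpd_P_def dpd_Q_def ce.cq.P_def ce.cq.Q_def ce.cq.Ai_def Let_def)
  then show ?thesis
    using ce.restricted_estimator_exists ce.restricted_estimator_asymptotically_normal unfolding est by metis
qed

end
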